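(* Let $(V,h)$ be an oriented eight-dimensional Euclidean vector space and let $$W_h:\wedge^4_+V^*\to\mathbb{R},\qquad W_h(\Phi)=\frac{\sqrt{14}}{3}\langle\Phi\,\Delta_2^h\,\Phi,\Phi\rangle_h+4\langle\Phi,\Phi\rangle_h^{3/2}.$$ A self-dual four-form $\Phi\in\wedge^4_+V^*\setminus\{0\}$ is a conformal $\mathrm{Spin}(7)_+$ form on $(V,h)$ if and only if it is a critical point of the function $W_h$. In this case, $W_h(\Phi)=0$.
   Context: $h$ induces on $\wedge V^*$ (whose elements are called polyforms) the determinant scalar product $\langle\cdot,\cdot\rangle_h$, for which the $e^{i_1}\wedge\cdots\wedge e^{i_k}$ ($i_1<\dots<i_k$) are orthonormal whenever $(e^1,\dots,e^8)$ is an orthonormal basis of $V^*$; $*_h$ is the Hodge operator and $\wedge^4_+V^*=\{\omega\in\wedge^4V^*: *_h\omega=\omega\}$ is the space of self-dual four-forms. For polyforms $\alpha,\beta$, $$\alpha\,\Delta_2^h\,\beta=\tfrac12 h^{a_1b_1}h^{a_2b_2}(\iota_{e_{a_1}}\iota_{e_{a_2}}\alpha)\wedge(\iota_{e_{b_1}}\iota_{e_{b_2}}\beta)$$ for any basis $(e_a)$ of $V$ with dual basis $(e^a)$ (summation implied, $h^{ab}=h^*(e^a,e^b)$). For $\Phi\in\wedge^4_+V^*$, the form $\Phi\Delta_2^h\Phi$ is again a self-dual four-form. On $\mathbb{R}^8$ with its standard metric $h_0$ and orientation, write $e^{ijkl}=e^i\wedge e^j\wedge e^k\wedge e^l$ and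 set $$\Phi_0=e^{1234}+e^{1256}+e^{1278}+e^{1357}-e^{1368}-e^{1458}-e^{1467}+e^{5678}+e^{3478}+e^{3456}+e^{2468}-e^{2457}-e^{2358}-e^{2367}.$$ A $\mathrm{Spin}(7)_+$ form on $V$ is a four-form $\Phi=f^*\Phi_0$ with $f:V\to\mathbb{R}^8$ an orientation-preserving linear isomorphism; it induces the Euclidean metric $h_\Phi=f^*h_0$ (independent of the choice of $f$). It is a conformal $\mathrm{Spin}(7)_+$ form on $(V,h)$ if $h_\Phi=c\,h$ for some $c>0$.
   Formalization: With the printed Φ₀ one has Φ₀Δ₂Φ₀ = 12Φ₀ and W(Φ₀) = 112√14 ≠ 0, so the claim fails; the formal statement corrects the sign, taking a Spin(7)₊ form to be f^*(−Φ₀) instead of f^*Φ₀, with everything else as printed. *)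

theory Defs
  imports "HOL-Analysis.Analysis" "HOL-Library.Function_Algebras"
begin

text \<open>The Euclidean space \<open>(V, h)\<close> is a type of class \<open>euclidean_space\<close>, with \<open>h\<close> its inner
  product. A polyform is given by its values on finite lists of vectors: its degree \<open>k\<close> component
  is its restriction to lists of length \<open>k\<close>.\<close>

type_synonym 'a polyform = "'a list \<Rightarrow> real"

definition kforms :: "nat \<Rightarrow> 'a::real_vector polyform set" where
  "kforms k = {\<alpha>. (\<forall>xs. length xs \<noteq> k \<longrightarrow> \<alpha> xs = 0)
     \<and> (\<forall>xs i. length xs = k \<and> i < k \<longrightarrow> linear (\<lambda>v. \<alpha> (xs[i := v])))
     \<and> (\<forall>xs. \<not> distinct xs \<longrightarrow> \<alpha> xs = 0)}"

text \<open>Shuffle formula: \<open>S\<close> is the set of positions of the arguments given to \<open>\<alpha>\<close>, and the exponent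
  counts the inversions of the corresponding shuffle.\<close>

definition wedge :: "'a polyform \<Rightarrow> 'a polyform \<Rightarrow> 'a polyform" (infixr "\<and>\<^sub>f" 70) where
  "\<alpha> \<and>\<^sub>f \<beta> = (\<lambda>xs. \<Sum>S\<in>Pow {..<length xs}.
     (-1) ^ card {(i, j). i \<in> S \<and> j \<in> {..<length xs} - S \<and> j < i}
       * \<alpha> (nths xs S) * \<beta> (nths xs ({..<length xs} - S)))"

definition interior :: "'a \<Rightarrow> 'a polyform \<Rightarrow> 'a polyform" where
  "interior v \<alpha> = (\<lambda>xs. \<alpha> (v # xs))"

definition pullback :: "('a \<Rightarrow> 'b) \<Rightarrow> 'b polyform \<Rightarrow> 'a polyform" where
  "pullback f \<alpha> = (\<lambda>xs. \<alpha> (map f xs))"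

text \<open>The determinant scalar product in components over the orthonormal basis \<open>Basis\<close>. The sum runs
  over all multi-indices of length \<open>k\<close>; each increasing one is counted \<open>k!\<close> times.\<close>

definition form_inner :: "'a::euclidean_space polyform \<Rightarrow> 'a polyform \<Rightarrow> real" where
  "form_inner \<alpha> \<beta> = (\<Sum>k\<le>DIM('a).
     (\<Sum>xs | length xs = k \<and> set xs \<subseteq> Basis. \<alpha> xs * \<beta> xs) / fact k)"

definition form_norm :: "'a::euclidean_space polyform \<Rightarrow> real" where
  "form_norm \<alpha> = sqrt (form_inner \<alpha> \<alpha>)"

text \<open>An orientation of a Euclidean space is given by its volume form \<open>vol\<close>, one of the two
  top-degree forms of norm \<open>1\<close>.\<close>

definition volume_form :: "'a::euclidean_space polyform \<Rightarrow> bool" where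
  "volume_form vol \<longleftrightarrow> vol \<in> kforms DIM('a) \<and> form_inner vol vol = 1"

text \<open>The convention is \<open>\<alpha> \<and> *\<beta> = \<langle>\<alpha>, \<beta>\<rangle> vol\<close> for \<open>\<alpha>\<close>, \<open>\<beta>\<close> of the same degree.\<close>

definition hodge :: "'a::euclidean_space polyform \<Rightarrow> 'a polyform \<Rightarrow> 'a polyform" where
  "hodge vol \<beta> = (\<lambda>ys. \<Sum>k\<le>DIM('a).
     (\<Sum>xs | length xs = k \<and> set xs \<subseteq> Basis. \<beta> xs * vol (xs @ ys)) / fact k)"

definition self_dual_four_forms :: "'a::euclidean_space polyform \<Rightarrow> 'a polyform set" where
  "self_dual_four_forms vol = {\<omega> \<in> kforms 4. hodge vol \<omega> = \<omega>}"

text \<open>The definition by an arbitrary basis \<open>(e\<^sub>a)\<close> is independent of the basis; in the orthonormal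
  basis \<open>Basis\<close> one has \<open>h\<^sup>a\<^sup>b = \<delta>\<^sup>a\<^sup>b\<close>, which removes the sums over \<open>b\<^sub>1\<close>, \<open>b\<^sub>2\<close>.\<close>

definition Delta2 :: "'a::euclidean_space polyform \<Rightarrow> 'a polyform \<Rightarrow> 'a polyform" where
  "Delta2 \<alpha> \<beta> = (\<lambda>xs. 1 / 2 * (\<Sum>a1\<in>Basis. \<Sum>a2\<in>Basis.
     (interior a1 (interior a2 \<alpha>) \<and>\<^sub>f interior a1 (interior a2 \<beta>)) xs))"

definition potential :: "'a::euclidean_space polyform \<Rightarrow> real" where
  "potential \<Phi> = sqrt 14 / 3 * form_inner (Delta2 \<Phi> \<Phi>) \<Phi> + 4 * form_inner \<Phi> \<Phi> powr (3 / 2)"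

text \<open>Critical points of a function on a linear space \<open>S\<close> of forms: the Frechet derivative at \<open>\<Phi>\<close>
  exists and is zero, i.e. \<open>F (\<Phi> + \<Psi>) - F \<Phi> = o(\<parallel>\<Psi>\<parallel>)\<close> as \<open>\<Psi> \<rightarrow> 0\<close> in \<open>S\<close>.\<close>

definition critical_point_on ::
    "'a::euclidean_space polyform set \<Rightarrow> ('a polyform \<Rightarrow> real) \<Rightarrow> 'a polyform \<Rightarrow> bool" where
  "critical_point_on S F \<Phi> \<longleftrightarrow> \<Phi> \<in> S \<and>
     (\<forall>\<epsilon>>0. \<exists>\<delta>>0. \<forall>\<Psi>\<in>S. form_norm \<Psi> < \<delta> \<longrightarrow>
        \<bar>F (\<Phi> + \<Psi>) - F \<Phi>\<bar> \<le> \<epsilon> * form_norm \<Psi>)"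

text \<open>\<open>covectors [i\<^sub>1, ..., i\<^sub>k]\<close> is the form written \<open>e\<^sup>i\<^sup>1 \<and> ... \<and> e\<^sup>i\<^sup>k\<close> on \<open>\<real>\<^sup>8\<close>. The index type \<open>8\<close>
  is the ring of integers modulo 8, so the index \<open>8\<close> is its element \<open>0\<close>.\<close>

definition covector :: "8 \<Rightarrow> (real^8) polyform" where
  "covector i = (\<lambda>xs. case xs of [x] \<Rightarrow> x $ i | _ \<Rightarrow> 0)"

definition covectors :: "8 list \<Rightarrow> (real^8) polyform" where
  "covectors is = foldr (\<lambda>i \<omega>. covector i \<and>\<^sub>f \<omega>) is (\<lambda>xs. if xs = [] then 1 else 0)"

definition vol0 :: "(real^8) polyform" where
  "vol0 = covectors [1, 2, 3, 4, 5, 6, 7, 8]"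

definition Phi0 :: "(real^8) polyform" where
  "Phi0 = covectors [1,2,3,4] + covectors [1,2,5,6] + covectors [1,2,7,8] + covectors [1,3,5,7]
     - covectors [1,3,6,8] - covectors [1,4,5,8] - covectors [1,4,6,7] + covectors [5,6,7,8]
     + covectors [3,4,7,8] + covectors [3,4,5,6] + covectors [2,4,6,8] - covectors [2,4,5,7]
     - covectors [2,3,5,8] - covectors [2,3,6,7]"

text \<open>Sign of the model form. One computes \<open>Phi0 \<Delta>\<^sub>2 Phi0 = 12 Phi0\<close>, while the critical points of
  \<open>potential\<close> satisfy \<open>\<surd>14 \<Phi> \<Delta>\<^sub>2 \<Phi> = - 12 \<parallel>\<Phi>\<parallel> \<Phi>\<close>. So \<open>- Phi0\<close> is a critical point and \<open>Phi0\<close> is not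
  (its potential is \<open>112 \<surd>14\<close>), and the forms which the potential detects are the pull-backs of
  \<open>- Phi0\<close>. The two signs give the same metric, the same stabilizer and the same self-duality; the
  negative one corresponds to squares of spinors for the Clifford relation \<open>v\<^sup>2 = h(v, v)\<close>.\<close>

definition spin7_model :: "(real^8) polyform" where
  "spin7_model = - Phi0"

text \<open>\<open>spin7_frame vol \<Phi> f\<close>: \<open>f\<close> is an orientation-preserving linear isomorphism onto \<open>\<real>\<^sup>8\<close> which
  pulls the model form back to \<open>\<Phi>\<close>.\<close>

definition spin7_frame ::
    "'a::euclidean_space polyform \<Rightarrow> 'a polyform \<Rightarrow> ('a \<Rightarrow> real^8) \<Rightarrow> bool" where
  "spin7_frame vol \<Phi> f \<longleftrightarrow> linear f \<and> bij f
     \<and> (\<exists>c>0. pullback f vol0 = (\<lambda>xs. c * vol xs))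
     \<and> \<Phi> = pullback f spin7_model"

text \<open>The metric \<open>h\<^sub>\<Phi>(x, y) = f x \<bullet> f y\<close> does not depend on the choice of the frame \<open>f\<close>.\<close>

definition conformal_spin7_form :: "'a::euclidean_space polyform \<Rightarrow> 'a polyform \<Rightarrow> bool" where
  "conformal_spin7_form vol \<Phi> \<longleftrightarrow>
     (\<exists>f. spin7_frame vol \<Phi> f \<and> (\<exists>c>0. \<forall>x y. f x \<bullet> f y = c * (x \<bullet> y)))"

end

theory Submission
  imports Defs "HOL-Combinatorics.Multiset_Permutations"
begin

text \<open>Spinors linearise the problem. The octonion product gives matrices \<open>\<gamma>\<^sub>x\<close> from the positive to the
negative spinors of \<open>\<real>\<^sup>8\<close>, both copies of \<open>\<real>\<^sup>8\<close>, with \<open>\<gamma>\<^sub>x\<^sup>T \<gamma>\<^sub>y + \<gamma>\<^sub>y\<^sup>T \<gamma>\<^sub>x = 2 \<langle>x, y\<rangle>\<close>. In a positively oriented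
orthonormal frame every symmetric traceless \<open>8 \<times> 8\<close> matrix \<open>B\<close> defines a self-dual four-form
\<open>\<Phi>\<^sub>B (x, y, z, w) = tr (B \<gamma>\<^sub>x\<^sup>T \<gamma>\<^sub>y \<gamma>\<^sub>z\<^sup>T \<gamma>\<^sub>w)\<close>, and each self-dual four-form is \<open>\<Phi>\<^sub>B\<close> for some \<open>B\<close>: this is the
isomorphism of \<open>\<Lambda>\<^sup>4\<^sub>+\<close> with the traceless part of \<open>Sym\<^sup>2\<close> of the positive spinors
(\<open>matrix_form_self_dual\<close>, \<open>self_dual_is_matrix_form\<close>).

The product \<open>\<Delta>\<^sub>2\<close> becomes the matrix square: \<open>\<langle>\<Phi>\<^sub>B, \<Phi>\<^sub>C\<rangle> = 16 tr (B C)\<close> and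
\<open>\<langle>\<Phi>\<^sub>B \<Delta>\<^sub>2 \<Phi>\<^sub>B, \<Phi>\<^sub>C\<rangle> = - 256 tr (B\<^sup>2 C)\<close> (\<open>matrix_form_inner\<close>, \<open>matrix_form_Delta2_inner\<close>). Both formulas come from one
Fierz identity, the completeness of the matrices \<open>\<gamma>\<^sub>a\<^sup>T \<gamma>\<^sub>b\<close>, and triality proves that identity: the roles of
vectors and positive spinors in the octonion product can be exchanged, and completeness turns into the formula
for the trace of four gamma matrices of the exchanged system.

Hence the potential of \<open>\<Phi>\<^sub>B\<close> is \<open>256 (|B|\<^sup>3 - \<surd>14/3 tr (B\<^sup>3))\<close>, and for \<open>B \<noteq> 0\<close> the form \<open>\<Phi>\<^sub>B\<close> is critical if and only if
\<open>\<surd>14 B\<^sup>2 - 3 |B| B\<close> is a multiple of the identity. Such a \<open>B\<close> has two eigenvalues, and the constants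
\<open>\<surd>14\<close> and \<open>3\<close> force one of them to be positive and simple: \<open>B = t (v v\<^sup>T - 1/8)\<close> with
\<open>t > 0\<close> and a unit spinor \<open>v\<close> (\<open>critical_imp_spinor_matrix\<close>, \<open>spinor_matrix_critical\<close>).

Finally, the model form is the square of the first basis spinor, the case \<open>t = 1\<close>, \<open>v = e\<^sub>1\<close>
(\<open>spin7_model_matrix_form\<close>). A product of two reflections of \<open>\<real>\<^sup>8\<close> carries \<open>e\<^sub>1\<close> to any
unit spinor \<open>v\<close>, and a homothety changes \<open>t\<close>; so the forms \<open>\<Phi>\<^sub>B\<close> with \<open>B = t (v v\<^sup>T - 1/8)\<close>
are the conformal \<open>Spin(7)\<^sub>+\<close> forms (\<open>spinor_form_conformal\<close>, \<open>conformal_imp_spinor_form\<close>).\<close>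

section \<open>Octonion multiplication\<close>

lemma UNIV_8: "(UNIV :: 8 set) = {1,2,3,4,5,6,7,8}"
proof -
  have "card {1,2,3,4,5,6,7,8::8} = CARD(8)" by simp
  then show ?thesis by (metis card_subset_eq finite_class.finite_UNIV top_greatest)
qed

lemma sum_8: "sum f (UNIV::8 set) = f 1 + f 2 + f 3 + f 4 + f 5 + f 6 + f 7 + f 8"
  unfolding UNIV_8 by (simp add: add.assoc)

lemma forall_8: "(\<forall>i::8. P i) \<longleftrightarrow> P 1 \<and> P 2 \<and> P 3 \<and> P 4 \<and> P 5 \<and> P 6 \<and> P 7 \<and> P 8"
proof -
  have "(\<forall>i::8. P i) \<longleftrightarrow> (\<forall>i\<in>{1,2,3,4,5,6,7,8}. P i)" unfolding UNIV_8[symmetric] by simp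
  then show ?thesis by simp
qed

lemma vec_eq_8: "(x::'b^8) = y \<longleftrightarrow> x$1 = y$1 \<and> x$2 = y$2 \<and> x$3 = y$3 \<and> x$4 = y$4 \<and> x$5 = y$5 \<and> x$6 = y$6 \<and> x$7
    = y$7 \<and> x$8 = y$8"
  by (simp only: vec_eq_iff forall_8)

text \<open>The octonion product with unit \<open>e\<^sub>1\<close> whose structure constants \<open>\<langle>e\<^sub>j e\<^sub>i, e\<^sub>k\<rangle>\<close> for distinct imaginary units are
the components \<open>Phi0 (e\<^sub>1, e\<^sub>j, e\<^sub>k, e\<^sub>i)\<close> of the Cayley form. With this table the square of the spinor \<open>e\<^sub>1\<close> is
\<open>- Phi0\<close> in the standard basis.\<close>

definition oct_mult :: "real^8 \<Rightarrow> real^8 \<Rightarrow> real^8" where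
  "oct_mult x y = (\<chi> k.
     if k = 1 then x$1 * y$1 - x$2 * y$2 - x$3 * y$3 - x$4 * y$4 - x$5 * y$5 - x$6 * y$6 - x$7 * y$7 - x$8 * y$8
     else if k = 2 then x$1 * y$2 + x$2 * y$1 - x$3 * y$4 + x$4 * y$3 - x$5 * y$6 + x$6 * y$5 - x$7 * y$8 + x$8 * y$7
     else if k = 3 then x$1 * y$3 + x$2 * y$4 + x$3 * y$1 - x$4 * y$2 - x$5 * y$7 + x$6 * y$8 + x$7 * y$5 - x$8 * y$6
     else if k = 4 then x$1 * y$4 - x$2 * y$3 + x$3 * y$2 + x$4 * y$1 + x$5 * y$8 + x$6 * y$7 - x$7 * y$6 - x$8 * y$5
     else if k = 5 then x$1 * y$5 + x$2 * y$6 + x$3 * y$7 - x$4 * y$8 + x$5 * y$1 - x$6 * y$2 - x$7 * y$3 + x$8 * y$4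
     else if k = 6 then x$1 * y$6 - x$2 * y$5 - x$3 * y$8 - x$4 * y$7 + x$5 * y$2 + x$6 * y$1 + x$7 * y$4 + x$8 * y$3
     else if k = 7 then x$1 * y$7 + x$2 * y$8 - x$3 * y$5 + x$4 * y$6 + x$5 * y$3 - x$6 * y$4 + x$7 * y$1 - x$8 * y$2
     else x$1 * y$8 - x$2 * y$7 + x$3 * y$6 + x$4 * y$5 - x$5 * y$4 - x$6 * y$3 + x$7 * y$2 + x$8 * y$1)"

lemma oct_mult_nth:
  "oct_mult x y $ 1 = x$1 * y$1 - x$2 * y$2 - x$3 * y$3 - x$4 * y$4 - x$5 * y$5 - x$6 * y$6 - x$7 * y$7 - x$8 * y$8"
  "oct_mult x y $ 2 = x$1 * y$2 + x$2 * y$1 - x$3 * y$4 + x$4 * y$3 - x$5 * y$6 + x$6 * y$5 - x$7 * y$8 + x$8 * y$7"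
  "oct_mult x y $ 3 = x$1 * y$3 + x$2 * y$4 + x$3 * y$1 - x$4 * y$2 - x$5 * y$7 + x$6 * y$8 + x$7 * y$5 - x$8 * y$6"
  "oct_mult x y $ 4 = x$1 * y$4 - x$2 * y$3 + x$3 * y$2 + x$4 * y$1 + x$5 * y$8 + x$6 * y$7 - x$7 * y$6 - x$8 * y$5"
  "oct_mult x y $ 5 = x$1 * y$5 + x$2 * y$6 + x$3 * y$7 - x$4 * y$8 + x$5 * y$1 - x$6 * y$2 - x$7 * y$3 + x$8 * y$4"
  "oct_mult x y $ 6 = x$1 * y$6 - x$2 * y$5 - x$3 * y$8 - x$4 * y$7 + x$5 * y$2 + x$6 * y$1 + x$7 * y$4 + x$8 * y$3"
  "oct_mult x y $ 7 = x$1 * y$7 + x$2 * y$8 - x$3 * y$5 + x$4 * y$6 + x$5 * y$3 - x$6 * y$4 + x$7 * y$1 - x$8 * y$2"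
  "oct_mult x y $ 8 = x$1 * y$8 - x$2 * y$7 + x$3 * y$6 + x$4 * y$5 - x$5 * y$4 - x$6 * y$3 + x$7 * y$2 + x$8 * y$1"
  by (simp_all add: oct_mult_def)

text \<open>The eight-square identity. Polarised in each factor it gives both Clifford systems used below.\<close>

lemma oct_mult_norm: "oct_mult x y \<bullet> oct_mult x y = (x \<bullet> x) * (y \<bullet> y)"
  unfolding inner_vec_def sum_8 oct_mult_nth inner_real_def by algebra

lemma bilinear_oct_mult: "bilinear oct_mult"
  unfolding bilinear_def
  by (auto intro!: linearI simp: vec_eq_8 oct_mult_nth algebra_simps)

lemmas oct_mult_add_left = bilinear_ladd[OF bilinear_oct_mult]
lemmas oct_mult_add_right = bilinear_radd[OF bilinear_oct_mult]

lemma oct_mult_polar: "oct_mult x y \<bullet> oct_mult x z = (x \<bullet> x) * (y \<bullet> z)"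
proof -
  have "oct_mult x (y+z) \<bullet> oct_mult x (y+z) = (x\<bullet>x) * ((y+z) \<bullet> (y+z))" by (rule oct_mult_norm)
  then show ?thesis 
    by (simp add: oct_mult_add_right inner_add_left inner_add_right oct_mult_norm algebra_simps inner_commute)
qed

lemma oct_mult_clifford: "oct_mult x y \<bullet> oct_mult z w + oct_mult z y \<bullet> oct_mult x w = 2 * (x \<bullet> z) * (y \<bullet> w)"
proof -
  have "oct_mult (x+z) y \<bullet> oct_mult (x+z) w = ((x+z)\<bullet>(x+z)) * (y \<bullet> w)" by (rule oct_mult_polar)
  then show ?thesis 
    by (simp add: oct_mult_add_left inner_add_left inner_add_right oct_mult_polar algebra_simps inner_commute)
qed

section \<open>Clifford systems on \<open>\<real>\<^sup>8\<close>\<close>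

type_synonym mat8 = "real^8^8"

lemma bilinear_matrix_mult: "bilinear ((**) :: real^'n^'m \<Rightarrow> real^'p^'n \<Rightarrow> real^'p^'m)"
  unfolding bilinear_def
  by (auto intro!: linearI simp: vec_eq_iff matrix_matrix_mult_def
      sum_distrib_left sum.distrib algebra_simps)

interpretation mm: bounded_bilinear "(**) :: mat8 \<Rightarrow> mat8 \<Rightarrow> mat8"
  using bilinear_matrix_mult bilinear_conv_bounded_bilinear by blast

lemma linear_trace: "linear (trace :: mat8 \<Rightarrow> real)"
  by (auto intro!: linearI simp: trace_def sum.distrib sum_distrib_left)

lemma linear_transpose: "linear (transpose :: mat8 \<Rightarrow> mat8)"
  by (auto intro!: linearI simp: transpose_def vec_eq_iff)

lemmas trace_lin = linear_add[OF linear_trace] linear_diff[OF linear_trace] linear_neg[OF linear_trace]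
  linear_cmul[OF linear_trace] linear_sum[OF linear_trace] linear_0[OF linear_trace]
lemmas transpose_lin = linear_add[OF linear_transpose] linear_diff[OF linear_transpose]
  linear_neg[OF linear_transpose] linear_cmul[OF linear_transpose] linear_sum[OF linear_transpose] linear_0[OF
      linear_transpose]
lemmas mm_lin = mm.add_left mm.add_right mm.diff_left mm.diff_right mm.minus_left mm.minus_right
  mm.scaleR_left mm.scaleR_right mm.zero_left mm.zero_right

lemma trace_mat1 [simp]: "trace (mat 1 :: mat8) = 8"
  by (simp add: trace_I)

lemma trace_transpose [simp]: "trace (transpose A) = trace (A :: mat8)"
  by (simp add: trace_def transpose_def)

lemma inner_matrix: "A \<bullet> B = trace (transpose A ** (B :: mat8))"
proof -
  have "A \<bullet> B = (\<Sum>i\<in>UNIV. \<Sum>j\<in>UNIV. A$i$j * B$i$j)" by (simp add: inner_vec_def)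
  also have "\<dots> = (\<Sum>j\<in>UNIV. \<Sum>i\<in>UNIV. A$i$j * B$i$j)" by (rule sum.swap)
  finally show ?thesis
    by (simp add: trace_def matrix_matrix_mult_def transpose_def)
qed

lemma trace_mult: "trace (A ** (B::mat8)) = (\<Sum>i\<in>UNIV. \<Sum>j\<in>UNIV. A$i$j * B$j$i)"
  by (simp add: trace_def matrix_matrix_mult_def)

lemma inner_matrix_sym: "transpose A = A \<Longrightarrow> A \<bullet> B = trace (A ** (B :: mat8))"
  by (simp add: inner_matrix)

lemma trace_cycle3: "trace (A ** B ** C) = trace (C ** A ** (B::mat8))"
  by (metis trace_mul_sym matrix_mul_assoc)

abbreviation ax :: "8 \<Rightarrow> real^8" where "ax i \<equiv> axis i 1"

text \<open>A Clifford system on \<open>\<real>\<^sup>8\<close>: the off-diagonal block of a representation of the Clifford algebra on the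
sum of two copies of \<open>\<real>\<^sup>8\<close>.\<close>

locale clifford =
  fixes g :: "real^8 \<Rightarrow> mat8"
  assumes lin: "linear g"
    and rel: "transpose (g x) ** g y + transpose (g y) ** g x = (2 * (x \<bullet> y)) *\<^sub>R mat 1"
begin

lemma g_add: "g (x + y) = g x + g y" and g_scaleR: "g (c *\<^sub>R x) = c *\<^sub>R g x"
  and g_diff: "g (x - y) = g x - g y"
  using lin by (simp_all add: linear_add linear_cmul linear_diff linear_neg)

lemma sq: "transpose (g x) ** g x = (x \<bullet> x) *\<^sub>R mat 1"
proof -
  have "2 *\<^sub>R (transpose (g x) ** g x) = 2 *\<^sub>R ((x \<bullet> x) *\<^sub>R mat 1 :: mat8)"
    using rel[of x x] by (simp add: scaleR_2[symmetric])
  then show ?thesis by (simp only: scaleR_cancel_left) simp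
qed

lemma sq': "g x ** transpose (g x) = (x \<bullet> x) *\<^sub>R mat 1"
proof (cases "x = 0")
  case True
  then show ?thesis using lin by (simp add: linear_0 mm.zero_left)
next
  case False
  then have "((1 / (x \<bullet> x)) *\<^sub>R transpose (g x)) ** g x = mat 1" 
    by (simp add: mm.scaleR_left sq)
  then have "g x ** ((1 / (x \<bullet> x)) *\<^sub>R transpose (g x)) = mat 1" 
    by (simp add: matrix_left_right_inverse)
  then have "(x \<bullet> x) *\<^sub>R ((1 / (x \<bullet> x)) *\<^sub>R (g x ** transpose (g x))) = (x \<bullet> x) *\<^sub>R mat 1" 
    by (simp add: mm.scaleR_right)
  with False show ?thesis by simp
qed

lemma rel': "g x ** transpose (g y) + g y ** transpose (g x) = (2 * (x \<bullet> y)) *\<^sub>R mat 1"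
  using sq'[of "x + y"] sq'[of x] sq'[of y]
  by (simp add: g_add transpose_lin mm.add_left mm.add_right inner_add_left inner_add_right inner_commute 
      algebra_simps mult_2)


text \<open>Alternating products \<open>g(x\<^sub>1)\<^sup>T g(x\<^sub>2) g(x\<^sub>3)\<^sup>T \<dots>\<close> (for \<open>s = True\<close>) or \<open>g(x\<^sub>1) g(x\<^sub>2)\<^sup>T g(x\<^sub>3) \<dots>\<close>. Words of even
length act on one of the two half-spinor spaces, chosen by \<open>s\<close>.\<close>

fun word :: "bool \<Rightarrow> (real^8) list \<Rightarrow> mat8" where
  "word s [] = mat 1"
| "word s (x # xs) = (if s then transpose (g x) else g x) ** word (\<not> s) xs"

lemma word_rel:
  "word s [x, y] + word s [y, x] = (2 * (x \<bullet> y)) *\<^sub>R mat 1"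
  by (cases s) (simp_all add: rel rel')

lemma word_append: "word s (xs @ ys) = word s xs ** word (s = even (length xs)) ys"
  by (induction xs arbitrary: s) (auto simp: matrix_mul_assoc[symmetric])

lemma word_swap:
  assumes "x \<bullet> y = 0"
  shows "word s (us @ x # y # vs) = - word s (us @ y # x # vs)"
proof -
  have 1: "word t [x, y] = - word t [y, x]" for t
    using word_rel[of t x y] assms by (simp add: eq_neg_iff_add_eq_0)
  have 2: "word s (us @ a # b # vs) = word s us ** word (s = even (length us)) [a, b] 
      ** word (s = even (length us)) vs" for a b
    using word_append[of s us "[a,b] @ vs"] word_append[of "s = even (length us)" "[a,b]" vs]
    by (simp add: matrix_mul_assoc)
  show ?thesis unfolding 2 1 by (simp add: mm_lin)
qed

lemma word_conj:
  "word (\<not> s) (ax i # map ax is) = (- 1) ^ (length is + count_list is i) *\<^sub>R word (\<not> s) (map ax is @ [ax i])"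
proof (induction "is" arbitrary: s)
  case (Cons j js)
  have "word (\<not> s) (ax i # ax j # map ax js) = (if i = j then 1 else - 1) *\<^sub>R word (\<not> s) (ax j # ax i # map ax js)"
    using word_swap[of "ax i" "ax j" "\<not> s" "[]"] by (auto simp: inner_axis_axis)
  also have "\<dots> = (- 1) ^ (length (j # js) + count_list (j # js) i) *\<^sub>R word (\<not> s) (map ax (j # js) @ [ax i])"
    using Cons[of "\<not> s"] by (simp add: mm_lin)
  finally show ?case by simp
qed simp

text \<open>Conjugation by a generator moves a word of even length from one half-spinor space to the other, and costs one
sign for each letter that differs from the generator. The letter \<open>i\<close> is arbitrary, so two letters of different
parity give opposite signs and the trace vanishes.\<close>

lemma trace_word_flip:
  assumes "even (length is)"
  shows "trace (word True (map ax is)) = (- 1) ^ count_list is i * trace (word False (map ax is))"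
proof -
  have "word False (ax i # map ax is @ [ax i]) = g (ax i) ** word True (map ax is) ** transpose (g (ax i))"
    using assms word_append[of True "map ax is" "[ax i]"] by (simp add: matrix_mul_assoc)
  then have 1: "trace (word False (ax i # map ax is @ [ax i])) = trace (word True (map ax is))"
    by (simp add: trace_cycle3 sq inner_axis_axis)
  have "word False (ax i # map ax is @ [ax i]) = word False (ax i # map ax is) ** transpose (g (ax i))"
    using assms word_append[of False "ax i # map ax is" "[ax i]"] by simp
  also have "\<dots> = (- 1) ^ count_list is i *\<^sub>R (word False (map ax is @ [ax i]) ** transpose (g (ax i)))"
    using word_conj[of True i "is"] assms by (simp add: mm_lin power_add)
  also have "word False (map ax is @ [ax i]) ** transpose (g (ax i)) = word False (map ax is)"
    using assms word_append[of False "map ax is" "[ax i]"] sq'[of "ax i"]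
    by (simp add: matrix_mul_assoc[symmetric] inner_axis_axis)
  finally show ?thesis using 1 by (simp add: trace_lin)
qed

lemma trace_word_eq_0:
  assumes "even (length is)" "even (count_list is i)" "odd (count_list is j)"
  shows "trace (word True (map ax is)) = 0"
  using trace_word_flip[OF assms(1), of i] trace_word_flip[OF assms(1), of j] assms by simp

lemma trace_word2: "trace (transpose (g x) ** g y) = 8 * (x \<bullet> y)"
proof -
  have "trace (transpose (g x) ** g y) = trace (transpose (g y) ** g x)"
    by (metis trace_transpose matrix_transpose_mul transpose_transpose)
  then show ?thesis
    using arg_cong[OF rel[of x y], of trace] by (simp add: trace_lin)
qed

text \<open>Vectors anticommute up to multiples of the identity, so both sides have the same behaviour when neighbours are
exchanged; this reduces coincident indices to traces of two letters. For four distinct indices a fifth letter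
kills the trace.\<close>

lemma trace_word4:
  "trace (transpose (g (ax p)) ** g (ax q) ** transpose (g (ax r)) ** g (ax s)) =
     8 * (of_bool (p = q \<and> r = s) - of_bool (p = r \<and> q = s) + of_bool (p = s \<and> q = r))"
proof -
  define T where "T x y z w = trace (transpose (g x) ** g y ** transpose (g z) ** g w)" for x y z w
  have a: "T x y z w = 2 * (x \<bullet> y) * (8 * (z \<bullet> w)) - T y x z w" for x y z w
  proof -
    have "T x y z w + T y x z w = trace ((transpose (g x) ** g y + transpose (g y) ** g x) ** (transpose (g z) ** g w))"
      by (simp add: T_def mm_lin trace_lin matrix_mul_assoc)
    then show ?thesis unfolding rel by (simp add: mm_lin trace_lin trace_word2)
  qed
  have b: "T x y z w = 2 * (y \<bullet> z) * (8 * (x \<bullet> w)) - T x z y w" for x y z w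
  proof -
    have "T x y z w + T x z y w = trace (transpose (g x) ** (g y ** transpose (g z) + g z ** transpose (g y)) ** g w)"
      by (simp add: T_def mm_lin trace_lin matrix_mul_assoc)
    then show ?thesis unfolding rel' by (simp add: mm_lin trace_lin trace_word2)
  qed
  have c: "T x y z w = 2 * (z \<bullet> w) * (8 * (x \<bullet> y)) - T x y w z" for x y z w
  proof -
    have "T x y z w + T x y w z = trace ((transpose (g x) ** g y) ** (transpose (g z) ** g w + transpose (g w) ** g z))"
      by (simp add: T_def mm_lin trace_lin matrix_mul_assoc)
    then show ?thesis unfolding rel by (simp add: mm_lin trace_lin trace_word2)
  qed
  have aa: "T x x z w = (x \<bullet> x) * (8 * (z \<bullet> w))" for x z w using a[of x x z w] by simp
  show ?thesis
  proof (cases "distinct [p, q, r, s]")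
    case True
    have "card (set [p,q,r,s]) \<noteq> CARD(8)" using True distinct_card[of "[p,q,r,s]"] by simp
    \<comment> \<open>A fifth index exists because there are eight.\<close>
    then obtain i where i: "i \<notin> set [p,q,r,s]" by (metis UNIV_eq_I)
    have "trace (word True (map ax [p,q,r,s])) = 0"
      by (rule trace_word_eq_0[of _ i p]) (use True i in auto)
    with True show ?thesis by (auto simp: matrix_mul_assoc)
  next
    case False
    have "T (ax p) (ax q) (ax r) (ax s) = 8 * (of_bool (p = q \<and> r = s) - of_bool (p = r \<and> q = s) + of_bool (p = s \<and> q = r))"
    proof -
      consider "p = q" | "p \<noteq> q" "p = r" | "p \<noteq> q" "p \<noteq> r" "p = s" | "p \<noteq> q" "p \<noteq> r" "p \<noteq> s" "q = r" 
        | "p \<noteq> q" "p \<noteq> r" "p \<noteq> s" "q \<noteq> r" "q = s" | "p \<noteq> q" "p \<noteq> r" "p \<noteq> s" "q \<noteq> r" "q \<noteq> s" "r = s"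
        using False by auto
      then show ?thesis
      proof cases
        case 1 then show ?thesis by (auto simp: aa inner_axis_axis)
      next
        case 2 then show ?thesis using b[of "ax p" "ax q" "ax p" "ax s"] by (auto simp: aa inner_axis_axis)
      next
        case 3 then show ?thesis using c[of "ax p" "ax q" "ax r" "ax p"] b[of "ax p" "ax q" "ax p" "ax r"]
            by (auto simp: aa inner_axis_axis)
      next
        case 4 then show ?thesis using a[of "ax p" "ax q" "ax q" "ax s"] b[of "ax q" "ax p" "ax q" "ax s"]
            by (auto simp: aa inner_axis_axis)
      next
        case 5 then show ?thesis using a[of "ax p" "ax q" "ax r" "ax q"] c[of "ax q" "ax p" "ax r" "ax q"] b[of
            "ax q" "ax p" "ax q" "ax r"] by (auto simp: aa inner_axis_axis)
      next
        case 6 then show ?thesis using b[of "ax p" "ax q" "ax r" "ax r"] a[of "ax p" "ax r" "ax q" "ax r"] c[of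
            "ax r" "ax p" "ax q" "ax r"] b[of "ax r" "ax p" "ax r" "ax q"] by (auto simp: aa inner_axis_axis)
      qed
    qed
    then show ?thesis by (simp add: T_def)
  qed
qed

end

section \<open>Gamma matrices and triality\<close>

lemma sum_swap22:
  fixes f :: "'a::finite \<Rightarrow> 'b::finite \<Rightarrow> 'c::finite \<Rightarrow> 'd::finite \<Rightarrow> real"
  shows "(\<Sum>a\<in>UNIV. \<Sum>b\<in>UNIV. \<Sum>k\<in>UNIV. \<Sum>l\<in>UNIV. f a b k l) = (\<Sum>k\<in>UNIV. \<Sum>l\<in>UNIV. \<Sum>a\<in>UNIV. \<Sum>b\<in>UNIV. f a b k l)"
proof -
  have "(\<Sum>a\<in>UNIV. \<Sum>b\<in>UNIV. \<Sum>k\<in>UNIV. \<Sum>l\<in>UNIV. f a b k l) = (\<Sum>a\<in>UNIV. \<Sum>k\<in>UNIV. \<Sum>b\<in>UNIV. \<Sum>l\<in>UNIV. f a b k l)"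
    by (intro sum.cong refl sum.swap)
  also have "\<dots> = (\<Sum>a\<in>UNIV. \<Sum>k\<in>UNIV. \<Sum>l\<in>UNIV. \<Sum>b\<in>UNIV. f a b k l)"
    by (intro sum.cong refl sum.swap)
  also have "\<dots> = (\<Sum>k\<in>UNIV. \<Sum>a\<in>UNIV. \<Sum>l\<in>UNIV. \<Sum>b\<in>UNIV. f a b k l)"
    by (rule sum.swap)
  also have "\<dots> = (\<Sum>k\<in>UNIV. \<Sum>l\<in>UNIV. \<Sum>a\<in>UNIV. \<Sum>b\<in>UNIV. f a b k l)"
    by (intro sum.cong refl sum.swap)
  finally show ?thesis .
qed

definition gam :: "real^8 \<Rightarrow> mat8" where "gam x = matrix (oct_mult x)"
text \<open>The triality partner of \<open>gam\<close>: the product read as a linear map in the vector, with the spinor as parameter.\<close>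

definition rho :: "real^8 \<Rightarrow> mat8" where "rho y = matrix (\<lambda>x. oct_mult x y)"

lemma linear_oct_mult: "linear (oct_mult x)" "linear (\<lambda>x. oct_mult x y)"
  using bilinear_oct_mult by (simp_all add: bilinear_def)

lemma gam_mult_vec: "gam x *v y = oct_mult x y"
  by (simp add: gam_def matrix_works linear_oct_mult linear_matrix_vector_mul_eq)

lemma gam_nth: "gam x $ i $ j = oct_mult x (ax j) $ i" and rho_nth: "rho y $ i $ j = oct_mult (ax j) y $ i"
  by (simp_all add: gam_def rho_def matrix_def)

lemma gam_gram: "(transpose (gam x) ** gam y) $ p $ q = oct_mult x (ax p) \<bullet> oct_mult y (ax q)"
  by (simp add: matrix_matrix_mult_def transpose_def gam_nth inner_vec_def)

lemma rho_gram: "(transpose (rho x) ** rho y) $ p $ q = oct_mult (ax p) x \<bullet> oct_mult (ax q) y"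
  by (simp add: matrix_matrix_mult_def transpose_def rho_nth inner_vec_def)

interpretation gam: clifford gam
proof (rule clifford.intro)
  show "linear gam"
    by (rule linearI) (simp_all add: vec_eq_iff gam_nth linear_add[OF linear_oct_mult(2)] linear_cmul[OF
        linear_oct_mult(2)])
  show "transpose (gam x) ** gam y + transpose (gam y) ** gam x = (2 * (x \<bullet> y)) *\<^sub>R mat 1" for x y
    by (simp add: vec_eq_iff gam_gram oct_mult_clifford mat_def inner_axis_axis)
qed

interpretation rho: clifford rho
proof (rule clifford.intro)
  show "linear rho"
    by (rule linearI) (simp_all add: vec_eq_iff rho_nth linear_add[OF linear_oct_mult(1)] linear_cmul[OF
        linear_oct_mult(1)])
  have "oct_mult p x \<bullet> oct_mult q y + oct_mult p y \<bullet> oct_mult q x = 2 * (x \<bullet> y) * (p \<bullet> q)" for p q x y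
    using oct_mult_clifford[of p x q y] by (simp add: inner_commute mult.commute mult.left_commute)
  then show "transpose (rho x) ** rho y + transpose (rho y) ** rho x = (2 * (x \<bullet> y)) *\<^sub>R mat 1" for x y
    by (simp add: vec_eq_iff rho_gram mat_def inner_axis_axis)
qed

text \<open>The Clifford action of the bivector \<open>e\<^sub>a \<and> e\<^sub>b\<close> on positive spinors, if \<open>a \<noteq> b\<close>; the identity if \<open>a = b\<close>.\<close>

definition bivec :: "8 \<Rightarrow> 8 \<Rightarrow> mat8" where "bivec a b = transpose (gam (ax a)) ** gam (ax b)"

text \<open>Entries of the bivector matrices for vectors are entries of the bivector matrices for spinors, with the two
index pairs exchanged. Sums over vector indices thus become traces in the exchanged system.\<close>

lemma triality: "bivec a b $ p $ q = (transpose (rho (ax p)) ** rho (ax q)) $ a $ b"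
  by (simp add: bivec_def gam_gram rho_gram)

lemma bivec_complete_entries:
  "(\<Sum>a\<in>UNIV. \<Sum>b\<in>UNIV. bivec a b $ p $ q * bivec a b $ r $ s) =
     8 * (of_bool (q = p \<and> r = s) - of_bool (q = r \<and> p = s) + of_bool (q = s \<and> p = r))"
proof -
  define R where "R p q = transpose (rho (ax p)) ** rho (ax q)" for p q
  have "(\<Sum>a\<in>UNIV. \<Sum>b\<in>UNIV. bivec a b $ p $ q * bivec a b $ r $ s) = R p q \<bullet> R r s"
    by (simp add: triality R_def inner_vec_def)
  also have "\<dots> = trace (transpose (rho (ax q)) ** rho (ax p) ** transpose (rho (ax r)) ** rho (ax s))"
    by (simp add: inner_matrix R_def matrix_transpose_mul matrix_mul_assoc)
  finally show ?thesis by (simp only: rho.trace_word4)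
qed

text \<open>The matrices \<open>bivec a b\<close> span the skew matrices (and the identity), so they see of \<open>N\<close> its skew part and
its trace only.\<close>

lemma bivec_complete:
  "(\<Sum>a\<in>UNIV. \<Sum>b\<in>UNIV. trace (N ** bivec a b) *\<^sub>R bivec a b) = 8 *\<^sub>R (trace N *\<^sub>R mat 1 - N + transpose N)"
proof -
  have "(\<Sum>a\<in>UNIV. \<Sum>b\<in>UNIV. trace (N ** bivec a b) *\<^sub>R bivec a b) $ j $ i =
     (8 *\<^sub>R (trace N *\<^sub>R mat 1 - N + transpose N)) $ j $ i" for j i
  proof -
    have "(\<Sum>a\<in>UNIV. \<Sum>b\<in>UNIV. trace (N ** bivec a b) *\<^sub>R bivec a b) $ j $ i
       = (\<Sum>a\<in>UNIV. \<Sum>b\<in>UNIV. \<Sum>k\<in>UNIV. \<Sum>l\<in>UNIV. N$k$l * (bivec a b $ l $ k * bivec a b $ j $ i))"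
      by (simp add: trace_mult sum_distrib_right mult.assoc)
    also have "\<dots> = (\<Sum>k\<in>UNIV. \<Sum>l\<in>UNIV. N$k$l * (\<Sum>a\<in>UNIV. \<Sum>b\<in>UNIV. bivec a b $ l $ k * bivec a b $ j $ i))"
      by (subst sum_swap22) (simp add: sum_distrib_left)
    also have "\<dots> = (\<Sum>k\<in>UNIV. \<Sum>l\<in>UNIV. (if l = k then 8 * (of_bool (j = i) * N$k$l) else 0)
          - (if l = i then if k = j then 8 * N$k$l else 0 else 0) + (if l = j then if k = i then 8 * N$k$l else 0 else 0))"
      by (intro sum.cong refl, subst bivec_complete_entries) auto
    also have "\<dots> = 8 * (of_bool (j = i) * trace N) - 8 * N$j$i + 8 * N$i$j"
      by (simp add: sum.distrib sum_subtractf trace_def sum_distrib_left)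
    finally show ?thesis by (simp add: mat_def transpose_def algebra_simps)
  qed
  then show ?thesis by (simp add: vec_eq_iff)
qed

lemma fierz:
  "(\<Sum>a\<in>UNIV. \<Sum>b\<in>UNIV. trace (M ** bivec a b) * trace (N ** bivec a b)) = 8 * (trace M * trace N - trace (M ** N) + M \<bullet> N)"
proof -
  have "(\<Sum>a\<in>UNIV. \<Sum>b\<in>UNIV. trace (M ** bivec a b) * trace (N ** bivec a b))
     = trace (M ** (\<Sum>a\<in>UNIV. \<Sum>b\<in>UNIV. trace (N ** bivec a b) *\<^sub>R bivec a b))"
    by (simp add: mm.sum_right trace_lin mm_lin mult.commute)
  also have "\<dots> = 8 * (trace M * trace N - trace (M ** N) + trace (M ** transpose N))"
    by (simp add: bivec_complete mm_lin trace_lin)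
  also have "trace (M ** transpose N) = M \<bullet> N"
    by (simp add: inner_commute[of M] inner_matrix[of N M] trace_mul_sym[of M])
  finally show ?thesis .
qed

text \<open>For \<open>N = v v\<^sup>T\<close> this says that \<open>x \<mapsto> \<gamma>\<^sub>x v\<close> is \<open>|v|\<close> times an isometry; that map is \<open>rho v\<close>.\<close>

lemma gam_conj_sum:
  assumes "transpose N = N"
  shows "(\<Sum>a\<in>UNIV. gam (ax a) ** N ** transpose (gam (ax a))) = trace N *\<^sub>R mat 1"
proof -
  have ent: "(\<Sum>a\<in>UNIV. gam (ax a) ** N ** transpose (gam (ax a))) $ k $ l
      = (\<Sum>p\<in>UNIV. \<Sum>q\<in>UNIV. N$p$q * (rho (ax p) ** transpose (rho (ax q))) $ k $ l)" for k l
  proof -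
    have "(\<Sum>a\<in>UNIV. gam (ax a) ** N ** transpose (gam (ax a))) $ k $ l =
       (\<Sum>a\<in>UNIV. \<Sum>q\<in>UNIV. \<Sum>p\<in>UNIV. N$p$q * (oct_mult (ax a) (ax p) $ k * oct_mult (ax a) (ax q) $ l))"
      by (simp add: matrix_matrix_mult_def transpose_def gam_nth sum_distrib_left sum_distrib_right mult_ac)
    also have "\<dots> = (\<Sum>q\<in>UNIV. \<Sum>a\<in>UNIV. \<Sum>p\<in>UNIV. N$p$q * (oct_mult (ax a) (ax p) $ k * oct_mult (ax a) (ax q) $ l))"
      by (rule sum.swap)
    also have "\<dots> = (\<Sum>q\<in>UNIV. \<Sum>p\<in>UNIV. \<Sum>a\<in>UNIV. N$p$q * (oct_mult (ax a) (ax p) $ k * oct_mult (ax a) (ax q) $ l))"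
      by (intro sum.cong refl sum.swap)
    also have "\<dots> = (\<Sum>p\<in>UNIV. \<Sum>q\<in>UNIV. \<Sum>a\<in>UNIV. N$p$q * (oct_mult (ax a) (ax p) $ k * oct_mult (ax a) (ax q) $ l))"
      by (rule sum.swap)
    finally show ?thesis by (simp add: matrix_matrix_mult_def transpose_def rho_nth sum_distrib_left)
  qed
  have sym: "N$q$p = N$p$q" for p q using arg_cong[OF assms, of "\<lambda>M. M$p$q"] by (simp add: transpose_def)
  have "2 * (\<Sum>p\<in>UNIV. \<Sum>q\<in>UNIV. N$p$q * (rho (ax p) ** transpose (rho (ax q))) $ k $ l)
      = 2 * (trace N * mat 1 $ k $ l)" for k l
  proof -
    have "(\<Sum>p\<in>UNIV. \<Sum>q\<in>UNIV. N$p$q * (rho (ax p) ** transpose (rho (ax q))) $ k $ l)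
       = (\<Sum>p\<in>UNIV. \<Sum>q\<in>UNIV. N$p$q * (rho (ax q) ** transpose (rho (ax p))) $ k $ l)"
      by (subst sum.swap) (simp add: sym)
    then have "2 * (\<Sum>p\<in>UNIV. \<Sum>q\<in>UNIV. N$p$q * (rho (ax p) ** transpose (rho (ax q))) $ k $ l) =
      (\<Sum>p\<in>UNIV. \<Sum>q\<in>UNIV. N$p$q * (rho (ax p) ** transpose (rho (ax q)) + rho (ax q) ** transpose (rho (ax p))) $ k $ l)"
      by (simp add: sum.distrib distrib_left)
    also have "\<dots> = 2 * (trace N * mat 1 $ k $ l)"
      by (simp add: rho.rel' inner_axis_axis trace_def sum_distrib_right sum_distrib_left mult_ac if_distrib
          if_distribR cong: if_cong)
    finally show ?thesis .
  qed
  then have "(\<Sum>a\<in>UNIV. gam (ax a) ** N ** transpose (gam (ax a))) $ k $ l = (trace N *\<^sub>R mat 1) $ k $ l" for k l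
    unfolding ent by simp
  then show ?thesis by (simp only: vec_eq_iff) simp
qed

section \<open>The four-form of a traceless symmetric matrix\<close>

text \<open>The four-form of \<open>B\<close> on \<open>\<real>\<^sup>8\<close>. For symmetric traceless \<open>B\<close> it is alternating for all vectors, with no
antisymmetrisation: the corrections are traces of \<open>B\<close> against the identity or against skew matrices.\<close>

definition qform :: "mat8 \<Rightarrow> real^8 \<Rightarrow> real^8 \<Rightarrow> real^8 \<Rightarrow> real^8 \<Rightarrow> real" where
  "qform B x y z w = trace (B ** (transpose (gam x) ** gam y) ** (transpose (gam z) ** gam w))"

definition traceless_sym :: "mat8 set" where "traceless_sym = {B. transpose B = B \<and> trace B = 0}"

lemma trace_sym_bivector:
  assumes "transpose B = B"
  shows "trace (B ** (transpose (gam x) ** gam y)) = trace B * (x \<bullet> y)"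
proof -
  have "trace (B ** (transpose (gam x) ** gam y)) = trace (transpose (B ** (transpose (gam x) ** gam y)))"
    by simp
  also have "\<dots> = trace (B ** (transpose (gam y) ** gam x))"
    by (simp add: matrix_transpose_mul assms trace_mul_sym[of _ B])
  finally have "2 * trace (B ** (transpose (gam x) ** gam y)) = trace (B ** (transpose (gam x) ** gam y
      + transpose (gam y) ** gam x))"
    by (simp add: mm_lin trace_lin)
  then show ?thesis unfolding gam.rel by (simp add: mm_lin trace_lin)
qed

lemma qform_linear:
  "linear (\<lambda>x. qform B x y z w)" "linear (\<lambda>y. qform B x y z w)"
  "linear (\<lambda>z. qform B x y z w)" "linear (\<lambda>w. qform B x y z w)"
  by (auto intro!: linearI simp: qform_def gam.g_add gam.g_scaleR mm_lin trace_lin transpose_lin)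

lemma qform_linear_matrix: "linear (\<lambda>B. qform B x y z w)"
  by (auto intro!: linearI simp: qform_def mm_lin trace_lin)

lemma qform_eq12:
  assumes "B \<in> traceless_sym" shows "qform B x x z w = 0"
  using assms trace_sym_bivector[of B z w] by (simp add: qform_def gam.sq mm_lin trace_lin traceless_sym_def)

lemma qform_eq34:
  assumes "B \<in> traceless_sym" shows "qform B x y z z = 0"
  using assms trace_sym_bivector[of B x y] by (simp add: qform_def gam.sq mm_lin trace_lin traceless_sym_def)

lemma qform_eq23:
  assumes "B \<in> traceless_sym" shows "qform B x y y w = 0"
proof -
  have "qform B x y y w = trace (B ** transpose (gam x) ** (gam y ** transpose (gam y)) ** gam w)"
    by (simp add: qform_def matrix_mul_assoc)
  then show ?thesis using assms trace_sym_bivector[of B x w]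
    by (simp add: gam.sq' mm_lin trace_lin traceless_sym_def matrix_mul_assoc)
qed

lemma linear_alt_swap:
  fixes f :: "'v::real_vector \<Rightarrow> 'v \<Rightarrow> real"
  assumes "\<And>y. linear (\<lambda>x. f x y)" "\<And>x. linear (f x)" "\<And>x. f x x = 0"
  shows "f x y = - f y x"
proof -
  have "f (x + y) (x + y) = f x x + f x y + f y x + f y y"
    using linear_add[OF assms(1)] linear_add[OF assms(2)] by simp
  then show ?thesis by (simp add: assms(3))
qed

lemma qform_swap:
  assumes "B \<in> traceless_sym"
  shows "qform B x y z w = - qform B y x z w" "qform B x y z w = - qform B x z y w" "qform B x y z w = - qform B x y w z"
  by (rule linear_alt_swap; simp add: qform_linear qform_eq12 qform_eq23 qform_eq34 assms)+

lemma qform_eq13: assumes "B \<in> traceless_sym" shows "qform B x y x w = 0"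
  and "qform B x y z x = 0" and "qform B x y z y = 0"
  using qform_swap[OF assms, of x y x w] qform_swap[OF assms, of x y z x] qform_swap[OF assms, of x y z y] 
    qform_eq12[OF assms] qform_eq23[OF assms] qform_swap[OF assms, of x y x z]
  by simp_all

lemmas qform_eq = qform_eq12 qform_eq13 qform_eq23 qform_eq34

lemma bivec_self [simp]: "bivec i i = mat 1"
  by (simp add: bivec_def gam.sq inner_axis_axis)

lemma transpose_bivec [simp]: "transpose (bivec i j) = bivec j i"
  by (simp add: bivec_def matrix_transpose_mul)

lemma bivec_add_flip: "bivec i j + bivec j i = (if i = j then 2 else 0) *\<^sub>R mat 1"
  using gam.rel[of "ax i" "ax j"] by (simp add: bivec_def inner_axis_axis)

lemma bivec_flip: "i \<noteq> j \<Longrightarrow> bivec j i = - bivec i j"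
  using bivec_add_flip[of i j] by (simp add: eq_neg_iff_add_eq_0 add.commute)

lemma bivec_orth: "bivec i j ** bivec j i = mat 1"
proof -
  have "bivec i j ** bivec j i = transpose (gam (ax i)) ** (gam (ax j) ** transpose (gam (ax j))) ** gam (ax i)"
    by (simp add: bivec_def matrix_mul_assoc)
  then show ?thesis by (simp add: gam.sq gam.sq' inner_axis_axis)
qed

lemma bivec_sq: "i \<noteq> j \<Longrightarrow> bivec i j ** bivec i j = - mat 1"
  by (metis bivec_orth bivec_flip mm.minus_right minus_minus)

lemma bivec_mid: assumes "j \<noteq> k" shows "bivec i j ** bivec k l = - (bivec i k ** bivec j l)"
proof -
  have "bivec i j ** bivec k l + bivec i k ** bivec j l = 
    transpose (gam (ax i)) ** (gam (ax j) ** transpose (gam (ax k)) + gam (ax k) ** transpose (gam (ax j))) ** gam (ax l)"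
    by (simp add: bivec_def mm_lin matrix_mul_assoc)
  also have "\<dots> = 0" unfolding gam.rel' using assms by (simp add: inner_axis_axis mm_lin)
  finally show ?thesis by (simp add: eq_neg_iff_add_eq_0)
qed

lemma bivec_mid2: assumes "distinct [i, j, k, l]" shows "bivec i j ** bivec k l = bivec i l ** bivec j k"
  using assms bivec_mid[of j l i k] bivec_flip[of k l] by (simp add: mm_lin)

lemma bivec_commute: assumes "distinct [i, j, k, l]" shows "bivec k l ** bivec i j = bivec i j ** bivec k l"
  using assms bivec_mid[of l i k j] bivec_mid[of j k i l] bivec_flip[of i k] bivec_flip[of j l] by (auto simp: mm_lin)

lemma qform_bivec: "qform B (ax i) (ax j) (ax k) (ax l) = trace (B ** bivec i j ** bivec k l)"
  by (simp add: qform_def bivec_def)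

lemma qform_bv': "qform B (ax i) (ax j) (ax k) (ax l) = trace ((bivec k l ** B) ** bivec i j)"
  by (simp only: qform_bivec trace_cycle3[of B])

text \<open>Reversing the second factor, \<open>\<gamma>\<^sub>k\<^sup>T \<gamma>\<^sub>l = 2 \<delta>\<^sub>k\<^sub>l - \<gamma>\<^sub>l\<^sup>T \<gamma>\<^sub>k\<close>, turns the sum into two nested
conjugations, each summed by \<open>gam_conj_sum\<close>.\<close>

lemma bivec_sandwich:
  assumes "transpose B = B"
  shows "(\<Sum>k\<in>UNIV. \<Sum>l\<in>UNIV. bivec k l ** B ** bivec k l) = 16 *\<^sub>R B - (8 * trace B) *\<^sub>R mat 1"
proof -
  have "bivec k l ** B ** bivec k l = (if k = l then 2 *\<^sub>R B else 0) - bivec k l ** B ** bivec l k" for k l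
  proof -
    have "bivec k l ** B ** (bivec k l + bivec l k) = (if k = l then 2 *\<^sub>R B else 0)"
      by (simp add: bivec_add_flip mm_lin)
    then show ?thesis by (simp add: mm_lin algebra_simps)
  qed
  then have "(\<Sum>k\<in>UNIV. \<Sum>l\<in>UNIV. bivec k l ** B ** bivec k l) = 16 *\<^sub>R B - (\<Sum>k\<in>UNIV. \<Sum>l\<in>UNIV. bivec k l ** B ** bivec l k)"
    by (simp add: sum_subtractf sum_constant_scaleR)
  also have "(\<Sum>k\<in>UNIV. \<Sum>l\<in>UNIV. bivec k l ** B ** bivec l k) = 
     (\<Sum>k\<in>UNIV. transpose (gam (ax k)) ** (\<Sum>l\<in>UNIV. gam (ax l) ** B ** transpose (gam (ax l))) ** gam (ax k))"
    by (simp add: bivec_def mm.sum_left mm.sum_right matrix_mul_assoc)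
  also have "\<dots> = (8 * trace B) *\<^sub>R mat 1"
    by (simp add: gam_conj_sum assms mm_lin gam.sq inner_axis_axis sum_constant_scaleR del: sum_constant)
  finally show ?thesis .
qed

text \<open>The sum over the first two indices is a Fierz sum and the sum over the last two is \<open>bivec_sandwich\<close>; the factor is
\<open>384 = 8 (64 - 16)\<close>.\<close>

lemma qform_inner:
  assumes "transpose B = B" and C: "C \<in> traceless_sym"
  shows "(\<Sum>i\<in>UNIV. \<Sum>j\<in>UNIV. \<Sum>k\<in>UNIV. \<Sum>l\<in>UNIV. qform B (ax i) (ax j) (ax k) (ax l) * qform C (ax i) (ax j) (ax k)
      (ax l)) = 384 * (B \<bullet> C)"
proof -
  have tC: "transpose C = C" "trace C = 0" using C by (auto simp: traceless_sym_def)
  have kl: "(\<Sum>i\<in>UNIV. \<Sum>j\<in>UNIV. qform B (ax i) (ax j) (ax k) (ax l) * qform C (ax i) (ax j) (ax k) (ax l))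
     = 8 * (B \<bullet> C) - 8 * trace ((bivec k l ** B ** bivec k l) ** C)" for k l
  proof -
    have "trace (bivec k l ** C) = 0"
      using trace_sym_bivector[OF tC(1), of "ax k" "ax l"] tC
          by (simp add: trace_mul_sym[of "bivec k l"]) (simp add: bivec_def)
    moreover have "(bivec k l ** B) \<bullet> (bivec k l ** C) = B \<bullet> C"
    proof -
      have "(bivec k l ** B) \<bullet> (bivec k l ** C) = trace (transpose B ** (bivec l k ** bivec k l) ** C)"
        by (simp add: inner_matrix matrix_transpose_mul matrix_mul_assoc)
      then show ?thesis by (simp add: bivec_orth inner_matrix)
    qed
    ultimately show ?thesis
      unfolding qform_bv' fierz by (simp add: matrix_mul_assoc)
  qed
  have "(\<Sum>i\<in>UNIV. \<Sum>j\<in>UNIV. \<Sum>k\<in>UNIV. \<Sum>l\<in>UNIV. qform B (ax i) (ax j) (ax k) (ax l) * qform C (ax i) (ax j) (ax k) (ax l))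
    = (\<Sum>k\<in>UNIV. \<Sum>l\<in>UNIV. 8 * (B \<bullet> C) - 8 * trace ((bivec k l ** B ** bivec k l) ** C))"
    by (subst sum_swap22) (simp only: kl)
  also have "\<dots> = 512 * (B \<bullet> C) - 8 * trace ((\<Sum>k\<in>UNIV. \<Sum>l\<in>UNIV. bivec k l ** B ** bivec k l) ** C)"
    by (simp add: sum_subtractf mm.sum_left trace_lin sum_distrib_left)
  also have "\<dots> = 384 * (B \<bullet> C)"
    by (simp add: bivec_sandwich assms mm_lin trace_lin tC inner_matrix_sym[OF assms(1)])
  finally show ?thesis .
qed

text \<open>Half of the conjugation sum. Let \<open>G\<close> be the involution \<open>bivec i j ** bivec k l\<close>. The letters \<open>i, j, k, l\<close>
anticommute past it and the other four commute, so the conjugation sum of \<open>N ** G\<close> is the difference of the two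
halves of the conjugation sum of \<open>N\<close>; it vanishes with the trace of \<open>N ** G\<close>, and the halves are equal.\<close>

lemma gam_half_sum:
  assumes d: "distinct [i, j, k, l]" and N: "transpose N = N" 
    and com: "N ** (bivec i j ** bivec k l) = (bivec i j ** bivec k l) ** N" and tr: "trace (N ** (bivec i j **
        bivec k l)) = 0"
  shows "(\<Sum>a\<in>{i,j,k,l}. gam (ax a) ** N ** transpose (gam (ax a))) = (trace N / 2) *\<^sub>R mat 1"
proof -
  define G where "G = bivec i j ** bivec k l"
  define G' where "G' = gam (ax i) ** transpose (gam (ax j)) ** gam (ax k) ** transpose (gam (ax l))"
  \<comment> \<open>The sign picked up by \<open>\<gamma>\<^sub>a\<close> when it passes the four letters of \<open>G\<close>.\<close>
  define e :: "8 \<Rightarrow> real" where "e a = (if a \<in> {i,j,k,l} then - 1 else 1)" for a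
  define X where "X a = gam (ax a) ** N ** transpose (gam (ax a))" for a
  have GT: "transpose G = G"
    using d bivec_commute[OF d] by (simp add: G_def matrix_transpose_mul mm_lin bivec_flip[of i j] bivec_flip[of k l])
  have 1: "gam (ax a) ** G = e a *\<^sub>R (G' ** gam (ax a))" for a
    using gam.word_conj[of True a "[i,j,k,l]"] d
    by (auto simp: G_def G'_def bivec_def matrix_mul_assoc e_def)
  have "transpose (N ** G) = N ** G"
    unfolding matrix_transpose_mul N GT using com by (simp add: G_def)
  then have "0 = (\<Sum>a\<in>UNIV. gam (ax a) ** (N ** G) ** transpose (gam (ax a)))"
    using gam_conj_sum[of "N ** G"] tr by (simp add: G_def)
  also have "\<dots> = (\<Sum>a\<in>UNIV. (gam (ax a) ** G) ** N ** transpose (gam (ax a)))"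
    using com by (simp add: G_def matrix_mul_assoc)
  also have "\<dots> = G' ** (\<Sum>a\<in>UNIV. e a *\<^sub>R X a)"
    by (simp add: 1 mm_lin mm.sum_right X_def matrix_mul_assoc)
  finally have 2: "G' ** (\<Sum>a\<in>UNIV. e a *\<^sub>R X a) = 0" by simp
  have "transpose G' ** G' = gam (ax l) ** (transpose (gam (ax k)) ** (gam (ax j) ** (transpose (gam (ax i)) ** gam (ax i)) 
      ** transpose (gam (ax j))) ** gam (ax k)) ** transpose (gam (ax l))"
    by (simp add: G'_def matrix_transpose_mul matrix_mul_assoc)
  also have "\<dots> = mat 1" by (simp add: gam.sq gam.sq' inner_axis_axis)
  finally have "transpose G' ** G' = mat 1" .
  then have D: "(\<Sum>a\<in>UNIV. e a *\<^sub>R X a) = 0"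
    using arg_cong[OF 2, of "\<lambda>M. transpose G' ** M"] by (simp add: matrix_mul_assoc mm_lin)
  have "2 *\<^sub>R (\<Sum>a\<in>{i,j,k,l}. X a) = (\<Sum>a\<in>UNIV. (1 - e a) *\<^sub>R X a)"
    by (rule trans[OF _ sum.mono_neutral_left[of UNIV "{i,j,k,l}"]]) (auto simp: e_def scaleR_sum_right)
  also have "\<dots> = trace N *\<^sub>R mat 1"
    using gam_conj_sum[OF N] D by (simp add: scaleR_diff_left sum_subtractf X_def)
  finally have "(1/2) *\<^sub>R (2 *\<^sub>R (\<Sum>a\<in>{i,j,k,l}. X a)) = (1/2) *\<^sub>R (trace N *\<^sub>R mat 1)" by simp
  then show ?thesis by (simp add: X_def)
qed


text \<open>The contraction of two indices, which \<open>\<Delta>\<^sub>2\<close> is built of, is a Fierz sum.\<close>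

lemma bivector_pair_sum:
  assumes B: "B \<in> traceless_sym" and "i \<noteq> j"
  shows "(\<Sum>a\<in>UNIV. \<Sum>b\<in>UNIV. qform B (ax a) (ax b) (ax i) (ax j) * qform B (ax a) (ax b) (ax k) (ax l)) =
    - 8 * (trace (bivec i j ** B ** bivec k l ** B) + qform (B ** B) (ax i) (ax j) (ax k) (ax l))"
proof -
  have tB: "transpose B = B" "trace B = 0" using B by (auto simp: traceless_sym_def)
  have 0: "trace (bivec i j ** B) = 0"
    using trace_sym_bivector[OF tB(1), of "ax i" "ax j"] tB
        by (simp add: trace_mul_sym[of "bivec i j"]) (simp add: bivec_def)
  have "(bivec i j ** B) \<bullet> (bivec k l ** B) = trace ((B ** bivec j i ** bivec k l) ** B)"
    by (simp add: inner_matrix matrix_transpose_mul tB matrix_mul_assoc)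
  also have "\<dots> = trace (B ** (B ** bivec j i ** bivec k l))" by (rule trace_mul_sym)
  also have "\<dots> = - qform (B ** B) (ax i) (ax j) (ax k) (ax l)"
    using bivec_flip[OF \<open>i \<noteq> j\<close>] by (simp add: qform_bivec mm_lin trace_lin matrix_mul_assoc)
  finally show ?thesis unfolding qform_bv' fierz 0 by (simp add: matrix_mul_assoc)
qed

text \<open>On each eigenspace of the involution \<open>G = bivec i j ** bivec k l\<close> the matrices \<open>u = bivec i j\<close>, \<open>bivec i k\<close>, \<open>bivec i l\<close> act
as the quaternion units, and the products on the left are \<open>u\<close> and \<open>u ** G\<close> up to sign. So the left hand side is a
sum of \<open>tr (B u N u)\<close> over the units, where \<open>N\<close> is the part of \<open>G ** B\<close> commuting with \<open>G\<close>, and \<open>gam_half_sum\<close>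
evaluates it.\<close>

lemma quaternion_sum:
  assumes B: "B \<in> traceless_sym" and d: "distinct [i, j, k, l]"
  shows "trace (bivec i j ** B ** bivec k l ** B) - trace (bivec i k ** B ** bivec j l ** B)
      + trace (bivec i l ** B ** bivec j k ** B)
    = - qform (B ** B) (ax i) (ax j) (ax k) (ax l)"
proof -
  have tB: "transpose B = B" "trace B = 0" using B by (auto simp: traceless_sym_def)
  define G where "G = bivec i j ** bivec k l"
  have GG: "G ** G = mat 1"
  proof -
    have "G ** G = bivec i j ** (bivec k l ** bivec i j) ** bivec k l" by (simp add: G_def matrix_mul_assoc)
    also have "\<dots> = (bivec i j ** bivec i j) ** (bivec k l ** bivec k l)"
      unfolding bivec_commute[OF d] by (simp add: matrix_mul_assoc)
    finally show ?thesis using d by (simp add: bivec_sq mm_lin)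
  qed
  have GT: "transpose G = G"
    using d bivec_commute[OF d] by (simp add: G_def matrix_transpose_mul mm_lin bivec_flip[of i j] bivec_flip[of k l])
  have G2: "G = - (bivec i k ** bivec j l)" and G3: "G = bivec i l ** bivec j k"
    using d bivec_mid[of j k i l] bivec_mid2[OF d] by (auto simp: G_def)
  have uu: "u ** (u ** X) = - X" if "u ** u = - mat 1" for u X :: mat8
    by (simp add: matrix_mul_assoc that mm_lin)
  have kl: "bivec k l = - (bivec i j ** G)"
    using d by (simp add: G_def uu bivec_sq)
  have jl: "bivec j l = bivec i k ** G"
    using d by (simp add: G2 uu bivec_sq mm_lin)
  have jk: "bivec j k = - (bivec i l ** G)"
    using d by (simp add: G3 uu bivec_sq)
  \<comment> \<open>The symmetric part of \<open>G ** B\<close> commutes with the involution \<open>G\<close>.\<close>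
  define N where "N = (1/2) *\<^sub>R (G ** B + B ** G)"
  have NT: "transpose N = N"
    by (simp add: N_def transpose_lin matrix_transpose_mul tB GT add.commute)
  have NG: "N ** G = G ** N"
  proof -
    have "N ** G = (1/2) *\<^sub>R (G ** B ** G + B ** (G ** G))" "G ** N = (1/2) *\<^sub>R ((G ** G) ** B + G ** B ** G)"
      by (simp_all add: N_def mm_lin matrix_mul_assoc)
    then show ?thesis by (simp add: GG add.commute)
  qed
  have trNG: "trace (N ** G) = 0"
  proof -
    have "trace (G ** B ** G) = trace (G ** G ** B)" by (rule trace_cycle3)
    moreover have "N ** G = (1/2) *\<^sub>R (G ** B ** G + B ** (G ** G))"
      by (simp add: N_def mm_lin matrix_mul_assoc)
    ultimately show ?thesis by (simp add: GG trace_lin tB)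
  qed
  have tru: "trace (u ** B ** (u ** G) ** B) = trace (B ** (u ** N ** u))" if u: "transpose u = - u" for u
  proof -
    have uT: "transpose (u ** B ** u) = u ** B ** u"
      by (simp add: matrix_transpose_mul u tB mm_lin matrix_mul_assoc)
    have "trace ((u ** B ** u) ** (B ** G)) = trace (transpose ((u ** B ** u) ** (B ** G)))" by simp
    also have "\<dots> = trace ((G ** B) ** (u ** B ** u))"
      by (simp only: matrix_transpose_mul[of _ "B ** G"] matrix_transpose_mul[of B G] uT GT tB)
    also have "\<dots> = trace ((u ** B ** u) ** (G ** B))" by (rule trace_mul_sym)
    finally have "trace ((u ** B ** u) ** N) = trace ((u ** B ** u) ** (G ** B))"
      by (simp add: N_def mm_lin trace_lin)
    then have "trace (u ** B ** (u ** G) ** B) = trace ((u ** B) ** (u ** N))"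
      by (simp add: matrix_mul_assoc)
    also have "\<dots> = trace ((u ** N) ** (u ** B))" by (rule trace_mul_sym)
    also have "\<dots> = trace ((u ** N ** u) ** B)" by (simp add: matrix_mul_assoc)
    also have "\<dots> = trace (B ** (u ** N ** u))" by (rule trace_mul_sym)
    finally show ?thesis .
  qed
  have uN: "N - bivec i j ** N ** bivec i j - bivec i k ** N ** bivec i k - bivec i l ** N ** bivec i l
      = (trace N / 2) *\<^sub>R mat 1"
  proof -
    define X where "X a = gam (ax a) ** N ** transpose (gam (ax a))" for a
    have "(\<Sum>a\<in>{i,j,k,l}. X a) = (trace N / 2) *\<^sub>R mat 1"
      unfolding X_def by (rule gam_half_sum) (use d NT NG trNG in \<open>simp_all add: G_def\<close>)
    then have "X i + X j + X k + X l = (trace N / 2) *\<^sub>R mat 1" using d by (simp add: add.assoc)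
    then have "transpose (gam (ax i)) ** (X i + X j + X k + X l) ** gam (ax i) = (trace N / 2) *\<^sub>R mat 1"
      by (simp add: mm_lin gam.sq inner_axis_axis)
    moreover have "transpose (gam (ax i)) ** X a ** gam (ax i) = bivec i a ** N ** bivec a i" for a
      by (simp add: X_def bivec_def matrix_mul_assoc)
    ultimately show ?thesis using d
      by (simp add: mm_lin bivec_flip[of i])
  qed
  have "trace (bivec i j ** B ** bivec k l ** B) - trace (bivec i k ** B ** bivec j l ** B)
      + trace (bivec i l ** B ** bivec j k ** B)
     = - trace (B ** (bivec i j ** N ** bivec i j)) - trace (B ** (bivec i k ** N ** bivec i k))
         - trace (B ** (bivec i l ** N ** bivec i l))"
    using d tru[of "bivec i j"] tru[of "bivec i k"] tru[of "bivec i l"] unfolding kl jl jk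
    by (simp add: bivec_flip[of i] mm_lin trace_lin)
  also have "\<dots> = trace (B ** (N - bivec i j ** N ** bivec i j - bivec i k ** N ** bivec i k
      - bivec i l ** N ** bivec i l)) - trace (B ** N)"
    by (simp add: mm_lin trace_lin)
  also have "\<dots> = - trace (B ** N)" unfolding uN by (simp add: mm_lin trace_lin tB)
  also have "trace (B ** N) = qform (B ** B) (ax i) (ax j) (ax k) (ax l)"
  proof -
    have "trace (B ** (G ** B)) = trace ((B ** B) ** G)"
      by (metis trace_mul_sym matrix_mul_assoc)
    then show ?thesis by (simp add: N_def mm_lin trace_lin qform_bivec G_def matrix_mul_assoc)
  qed
  finally show ?thesis .
qed

text \<open>The components of \<open>\<Phi>\<^sub>B \<Delta>\<^sub>2 \<Phi>\<^sub>B\<close>, after the six shuffles in the wedge product have been joined in pairs.\<close>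

definition delta_comp :: "mat8 \<Rightarrow> 8 \<Rightarrow> 8 \<Rightarrow> 8 \<Rightarrow> 8 \<Rightarrow> real" where
  "delta_comp B i j k l = (let q = (\<lambda>a b c d. qform B (ax a) (ax b) (ax c) (ax d)) in
     \<Sum>a\<in>UNIV. \<Sum>b\<in>UNIV. q a b i j * q a b k l - q a b i k * q a b j l + q a b i l * q a b j k)"

lemma delta_comp_eq:
  assumes B: "B \<in> traceless_sym" and d: "distinct [i, j, k, l]"
  shows "delta_comp B i j k l = - 16 * qform (B ** B) (ax i) (ax j) (ax k) (ax l)"
proof -
  let ?w = "\<lambda>i j k l. qform (B ** B) (ax i) (ax j) (ax k) (ax l)"
  have w: "?w i k j l = - ?w i j k l" "?w i l j k = ?w i j k l"
    using bivec_mid2[OF d] bivec_mid[of j k i l] d by (simp_all add: qform_bivec matrix_mul_assoc[symmetric]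
        mm_lin trace_lin)
  have "delta_comp B i j k l = - 8 * (trace (bivec i j ** B ** bivec k l ** B) + ?w i j k l)
      + 8 * (trace (bivec i k ** B ** bivec j l ** B) + ?w i k j l)
          - 8 * (trace (bivec i l ** B ** bivec j k ** B) + ?w i l j k)"
    using d unfolding delta_comp_def Let_def sum.distrib sum_subtractf by (simp add: bivector_pair_sum[OF B])
  also have "\<dots> = - 16 * ?w i j k l"
    using quaternion_sum[OF B d] w by simp
  finally show ?thesis .
qed

text \<open>Only distinct indices contribute, because the four-form of \<open>C\<close> vanishes on the others.\<close>

lemma delta_comp_inner:
  assumes B: "B \<in> traceless_sym" and C: "C \<in> traceless_sym"
  shows "(\<Sum>i\<in>UNIV. \<Sum>j\<in>UNIV. \<Sum>k\<in>UNIV. \<Sum>l\<in>UNIV. delta_comp B i j k l * qform C (ax i) (ax j) (ax k) (ax l)) 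
     = - 6144 * ((B ** B) \<bullet> C)"
proof -
  have "transpose (B ** B) = B ** B" using B by (simp add: traceless_sym_def matrix_transpose_mul)
  note I = qform_inner[OF this C]
  have "delta_comp B i j k l * qform C (ax i) (ax j) (ax k) (ax l) =
      - 16 * (qform (B ** B) (ax i) (ax j) (ax k) (ax l) * qform C (ax i) (ax j) (ax k) (ax l))" for i j k l
    by (cases "distinct [i, j, k, l]") (auto simp: delta_comp_eq[OF B] qform_eq[OF C])
  then show ?thesis by (simp only: sum_distrib_left[symmetric] I)
qed

section \<open>Alternating forms and orthonormal frames\<close>

text \<open>Adjacent exchanges connect all arrangements of a list. The hypothesis covers unequal neighbours only, because
gamma matrices anticommute only then.\<close>

lemma perm_induct_adjacent:
  assumes swap: "\<And>us a b vs. a \<noteq> b \<Longrightarrow> P (us @ a # b # vs) \<Longrightarrow> P (us @ b # a # vs)"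
    and "P xs" "mset ys = mset xs"
  shows "P ys"
proof -
  have move: "P (ps @ us @ a # vs) \<Longrightarrow> P (ps @ a # us @ vs)" for ps us a vs
  proof (induction us arbitrary: vs rule: rev_induct)
    case (snoc u us)
    then have "P ((ps @ us) @ u # a # vs)" by simp
    then have "P ((ps @ us) @ a # u # vs)" using swap[of u a "ps @ us" vs] by (cases "u = a") simp_all
    then show ?case using snoc.IH[of "u # vs"] by simp
  qed simp
  have "P (ps @ xs) \<Longrightarrow> mset ys = mset xs \<Longrightarrow> P (ps @ ys)" for ps
  proof (induction ys arbitrary: ps xs)
    case (Cons y ys)
    then have "y \<in> set xs" by (metis list.set_intros(1) mset_eq_setD)
    then obtain us vs where xs: "xs = us @ y # vs" by (meson split_list)
    then have "P ((ps @ [y]) @ us @ vs)" using move Cons.prems(1) by simp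
    moreover have "mset ys = mset (us @ vs)" using Cons.prems(2) by (simp add: xs)
    ultimately have "P ((ps @ [y]) @ ys)" by (rule Cons.IH)
    then show ?case by simp
  qed simp
  from this[of "[]"] assms(2,3) show ?thesis by simp
qed

lemma alternating_agree:
  fixes F G :: "'a list \<Rightarrow> 'b::ab_group_add"
  assumes "\<And>us a b vs. a \<noteq> b \<Longrightarrow> F (us @ b # a # vs) = - F (us @ a # b # vs)"
    and "\<And>us a b vs. a \<noteq> b \<Longrightarrow> G (us @ b # a # vs) = - G (us @ a # b # vs)"
    and "F xs = G xs" "mset ys = mset xs"
  shows "F ys = G ys"
proof (rule perm_induct_adjacent[of "\<lambda>l. F l = G l", OF _ assms(3,4)])
  fix us vs and a b :: 'a
  assume "a \<noteq> b" "F (us @ a # b # vs) = G (us @ a # b # vs)"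
  then show "F (us @ b # a # vs) = G (us @ b # a # vs)"
    using assms(1)[of a b us vs] assms(2)[of a b us vs] by metis
qed

text \<open>Sums over all index lists collapse if the summand lives on the arrangements of one set of indices and does not see
their order.\<close>

lemma sum_over_arrangements:
  fixes Q :: "'a::finite list \<Rightarrow> real"
  assumes "distinct ps"
    and swap: "\<And>us a b vs. a \<noteq> b \<Longrightarrow> Q (us @ b # a # vs) = Q (us @ a # b # vs)"
    and zero: "\<And>is. length is = length ps \<Longrightarrow> \<not> (distinct is \<and> set is = set ps) \<Longrightarrow> Q is = 0"
  shows "(\<Sum>is | length is = length ps. Q is) = fact (length ps) * Q ps"
proof -
  have fin: "finite {is :: 'a list. length is = length ps}"
    using finite_lists_length_eq[of "UNIV :: 'a set" "length ps"] by simp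
  have sub: "permutations_of_set (set ps) \<subseteq> {is. length is = length ps}"
    using assms(1) by (auto simp: permutations_of_set_def) (metis distinct_card)
  have "(\<Sum>is | length is = length ps. Q is) = (\<Sum>is\<in>permutations_of_set (set ps). Q is)"
    by (rule sum.mono_neutral_right[OF fin sub]) (use zero in \<open>auto simp: permutations_of_set_def\<close>)
  also have "\<dots> = (\<Sum>is\<in>permutations_of_set (set ps). Q ps)"
  proof (rule sum.cong[OF refl])
    fix "is" assume "is \<in> permutations_of_set (set ps)"
    then have "mset is = mset ps"
      using assms(1) by (auto simp: permutations_of_set_def set_eq_iff_mset_eq_distinct)
    then show "Q is = Q ps"
      using perm_induct_adjacent[of "\<lambda>l. Q l = Q ps" ps "is"] swap by metis
  qed
  finally show ?thesis by (simp add: distinct_card assms(1))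
qed

definition multilin :: "nat \<Rightarrow> 'a::real_vector polyform \<Rightarrow> bool" where
  "multilin k \<alpha> \<longleftrightarrow> (\<forall>xs i. length xs = k \<and> i < k \<longrightarrow> linear (\<lambda>v. \<alpha> (xs[i := v])))"

lemma multilinD: "multilin k \<alpha> \<Longrightarrow> length us + Suc (length vs) = k \<Longrightarrow> linear (\<lambda>v. \<alpha> (us @ v # vs))"
  unfolding multilin_def by (erule allE[of _ "us @ 0 # vs"], erule allE[of _ "length us"]) simp

lemma multilinI:
  assumes "\<And>us vs. length us + Suc (length vs) = k \<Longrightarrow> linear (\<lambda>v. \<alpha> (us @ v # vs))"
  shows "multilin k \<alpha>"
  unfolding multilin_def
proof (intro allI impI, elim conjE)
  fix xs :: "'a list" and i assume "length xs = k" "i < k"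
  then show "linear (\<lambda>v. \<alpha> (xs[i := v]))"
    using assms[of "take i xs" "drop (Suc i) xs"] by (simp add: upd_conv_take_nth_drop)
qed

lemma kforms_iff: "\<alpha> \<in> kforms k \<longleftrightarrow> (\<forall>xs. length xs \<noteq> k \<longrightarrow> \<alpha> xs = 0) \<and> multilin k \<alpha> \<and> (\<forall>xs. \<not> distinct xs \<longrightarrow> \<alpha> xs = 0)"
  by (auto simp: kforms_def multilin_def)

lemma kforms_multilin: "\<alpha> \<in> kforms k \<Longrightarrow> multilin k \<alpha>"
  and kforms_length: "\<alpha> \<in> kforms k \<Longrightarrow> length xs \<noteq> k \<Longrightarrow> \<alpha> xs = 0"
  and kforms_distinct: "\<alpha> \<in> kforms k \<Longrightarrow> \<not> distinct xs \<Longrightarrow> \<alpha> xs = 0"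
  by (auto simp: kforms_iff)

lemma multilin_Cons: "multilin (Suc k) \<alpha> \<Longrightarrow> multilin k (\<lambda>xs. \<alpha> (x # xs))"
  by (rule multilinI) (use multilinD[of "Suc k" \<alpha> "x # _"] in simp)

lemma kforms_swap:
  assumes "\<alpha> \<in> kforms k"
  shows "\<alpha> (us @ b # a # vs) = - \<alpha> (us @ a # b # vs)"
proof (cases "length us + 2 + length vs = k")
  case True
  show ?thesis
  proof (rule linear_alt_swap[where f = "\<lambda>x y. \<alpha> (us @ x # y # vs)"])
    show "linear (\<lambda>x. \<alpha> (us @ x # y # vs))" for y
      using multilinD[OF kforms_multilin[OF assms], of us "y # vs"] True by simp
    show "linear (\<lambda>y. \<alpha> (us @ x # y # vs))" for x
      using multilinD[OF kforms_multilin[OF assms], of "us @ [x]" "vs"] True by simp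
    show "\<alpha> (us @ x # x # vs) = 0" for x
      by (rule kforms_distinct[OF assms]) simp
  qed
next
  case False
  then show ?thesis using kforms_length[OF assms] by simp
qed

lemma kforms_map_swap:
  assumes "\<alpha> \<in> kforms k"
  shows "\<alpha> (map e (us @ b # a # vs)) = - \<alpha> (map e (us @ a # b # vs))"
  using kforms_swap[OF assms, of "map e us" "e b" "e a" "map e vs"] by simp

definition frame :: "(8 \<Rightarrow> 'a::euclidean_space) \<Rightarrow> bool" where
  "frame e \<longleftrightarrow> DIM('a) = 8 \<and> (\<forall>i j. e i \<bullet> e j = (if i = j then 1 else 0))"

lemma frame_inner: "frame e \<Longrightarrow> e i \<bullet> e j = (if i = j then 1 else 0)"
  by (simp add: frame_def)

lemma frame_inj: "frame e \<Longrightarrow> inj e"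
  by (metis frame_inner injI zero_neq_one)

lemma frame_expand:
  assumes "frame (e :: 8 \<Rightarrow> 'a::euclidean_space)"
  shows "(\<Sum>i\<in>UNIV. (x \<bullet> e i) *\<^sub>R e i) = x"
proof -
  have orth: "pairwise orthogonal (range e)"
    using assms by (auto simp: pairwise_def orthogonal_def frame_def)
  have "0 \<notin> range e" using frame_inner[OF assms] by (metis imageE inner_zero_left zero_neq_one)
  then have ind: "independent (range e)" using orth pairwise_orthogonal_independent by blast
  have "card (range e) = DIM('a)"
    using frame_inj[OF assms] assms by (simp add: card_image frame_def)
  then have "span (range e) = UNIV"
    using ind by (metis dim_eq_card_independent dim_eq_full)
  moreover have "norm v = 1" if "v \<in> range e" for v
    using that assms by (auto simp: frame_def norm_eq_sqrt_inner)
  ultimately have "(\<Sum>v\<in>range e. (x \<bullet> v) *\<^sub>R v) = x"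
    using orthonormal_basis_expand[OF orth, of x] by simp
  then show ?thesis
    using frame_inj[OF assms] by (simp add: sum.reindex)
qed

text \<open>The trace of a bilinear form does not depend on the orthonormal basis. By induction over the slots
(\<open>frame_list_sum\<close>) scalar products of forms may be computed in any orthonormal frame.\<close>

lemma frame_trace:
  assumes "frame e" and "\<And>y. linear (\<lambda>x. f x y)" "\<And>x. linear (f x)"
  shows "(\<Sum>b\<in>Basis. f b b) = (\<Sum>i\<in>UNIV. f (e i) (e i) :: real)"
proof -
  have "(\<Sum>b\<in>Basis. f b b) = (\<Sum>b\<in>Basis. \<Sum>i\<in>UNIV. f (e i) ((b \<bullet> e i) *\<^sub>R b))"
  proof (rule sum.cong[OF refl])
    fix b :: 'a
    have "f b b = f (\<Sum>i\<in>UNIV. (b \<bullet> e i) *\<^sub>R e i) b" by (simp add: frame_expand[OF assms(1)])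
    also have "\<dots> = (\<Sum>i\<in>UNIV. f (e i) ((b \<bullet> e i) *\<^sub>R b))"
      by (simp add: linear_sum[OF assms(2)] linear_cmul[OF assms(2)] linear_cmul[OF assms(3)])
    finally show "f b b = (\<Sum>i\<in>UNIV. f (e i) ((b \<bullet> e i) *\<^sub>R b))" .
  qed
  also have "\<dots> = (\<Sum>i\<in>UNIV. f (e i) (\<Sum>b\<in>Basis. (e i \<bullet> b) *\<^sub>R b))"
    by (subst sum.swap) (simp add: linear_sum[OF assms(3)] inner_commute)
  finally show ?thesis by (simp add: euclidean_representation)
qed

lemma sum_lists_Suc:
  assumes "finite A"
  shows "(\<Sum>xs | length xs = Suc n \<and> set xs \<subseteq> A. F xs) = (\<Sum>a\<in>A. \<Sum>xs | length xs = n \<and> set xs \<subseteq> A. F (a # xs))"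
proof -
  have "{xs. length xs = Suc n \<and> set xs \<subseteq> A} = (\<lambda>(a, xs). a # xs) ` (A \<times> {xs. length xs = n \<and> set xs \<subseteq> A})"
    by (auto simp: length_Suc_conv image_iff)
  moreover have "inj_on (\<lambda>(a, xs). a # xs) (A \<times> {xs. length xs = n \<and> set xs \<subseteq> A})"
    by (auto simp: inj_on_def)
  ultimately show ?thesis
    by (simp add: sum.reindex sum.cartesian_product split_def)
qed

lemma sum_index_lists_Suc:
  "(\<Sum>is | length is = Suc n. F is) = (\<Sum>i\<in>UNIV. \<Sum>is | length is = n. F ((i::'i::finite) # is))"
  using sum_lists_Suc[where A = "UNIV :: 'i set" and n = n and F = F] by simp

lemma sum_index_lists_4:
  "(\<Sum>is | length is = 4. F is) = (\<Sum>i\<in>UNIV. \<Sum>j\<in>UNIV. \<Sum>k\<in>UNIV. \<Sum>l\<in>UNIV. F [i::'i::finite, j, k, l])"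
  by (simp add: numeral_eq_Suc sum_index_lists_Suc)

lemma frame_list_sum:
  assumes "frame e" "multilin k \<alpha>" "multilin k \<beta>"
  shows "(\<Sum>xs | length xs = k \<and> set xs \<subseteq> Basis. \<alpha> xs * \<beta> xs) = (\<Sum>is | length is = k. \<alpha> (map e is) * \<beta> (map e is))"
  using assms(2,3)
proof (induction k arbitrary: \<alpha> \<beta>)
  case 0
  have "{xs :: 'a list. length xs = 0 \<and> set xs \<subseteq> Basis} = {[]}" by auto
  then show ?case by simp
next
  case (Suc k)
  have "(\<Sum>xs | length xs = Suc k \<and> set xs \<subseteq> Basis. \<alpha> xs * \<beta> xs) =
      (\<Sum>b\<in>Basis. \<Sum>is | length is = k. \<alpha> (b # map e is) * \<beta> (b # map e is))"
    by (subst sum_lists_Suc) (simp_all add: Suc.IH[OF multilin_Cons[OF Suc.prems(1)] multilin_Cons[OF Suc.prems(2)]])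
  also have "\<dots> = (\<Sum>is | length is = k. \<Sum>b\<in>Basis. \<alpha> (b # map e is) * \<beta> (b # map e is))"
    by (rule sum.swap)
  also have "\<dots> = (\<Sum>is | length is = k. \<Sum>i\<in>UNIV. \<alpha> (e i # map e is) * \<beta> (e i # map e is))"
  proof (rule sum.cong[OF refl])
    fix "is" :: "8 list" assume "is \<in> {is. length is = k}"
    then have l: "linear (\<lambda>v. \<alpha> (v # map e is))" "linear (\<lambda>v. \<beta> (v # map e is))"
      using multilinD[OF Suc.prems(1), of "[]" "map e is"] multilinD[OF Suc.prems(2), of "[]" "map e is"] by auto
    show "(\<Sum>b\<in>Basis. \<alpha> (b # map e is) * \<beta> (b # map e is)) = (\<Sum>i\<in>UNIV. \<alpha> (e i # map e is) * \<beta> (e i # map e is))"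
      by (rule frame_trace[OF assms(1)])
        (auto intro!: linearI simp: linear_add[OF l(1)] linear_add[OF l(2)] linear_cmul[OF l(1)] linear_cmul[OF
            l(2)] algebra_simps)
  qed
  also have "\<dots> = (\<Sum>i\<in>UNIV. \<Sum>is | length is = k. \<alpha> (e i # map e is) * \<beta> (e i # map e is))"
    by (rule sum.swap)
  finally show ?case by (simp add: sum_index_lists_Suc)
qed

lemma multilin_eqI:
  assumes "frame e" "multilin k \<alpha>" "multilin k \<beta>" "\<And>is. length is = k \<Longrightarrow> \<alpha> (map e is) = \<beta> (map e is)" "length xs = k"
  shows "\<alpha> xs = \<beta> xs"
  using assms(2-5)
proof (induction k arbitrary: \<alpha> \<beta> xs)
  case 0
  then show ?case by auto
next
  case (Suc k)
  obtain x ys where xs: "xs = x # ys" and ys: "length ys = k"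
    using Suc.prems(4) by (auto simp: length_Suc_conv)
  have *: "\<alpha> (e i # ys) = \<beta> (e i # ys)" for i
    by (rule Suc.IH[OF multilin_Cons[OF Suc.prems(1)] multilin_Cons[OF Suc.prems(2)] _ ys])
      (use Suc.prems(3)[of "i # _"] in simp)
  have l: "linear (\<lambda>v. \<alpha> (v # ys))" "linear (\<lambda>v. \<beta> (v # ys))"
    using multilinD[OF Suc.prems(1), of "[]" ys] multilinD[OF Suc.prems(2), of "[]" ys] ys by auto
  have "\<alpha> ((\<Sum>i\<in>UNIV. (x \<bullet> e i) *\<^sub>R e i) # ys) = \<beta> ((\<Sum>i\<in>UNIV. (x \<bullet> e i) *\<^sub>R e i) # ys)"
    by (simp add: linear_sum[OF l(1)] linear_sum[OF l(2)] linear_cmul[OF l(1)] linear_cmul[OF l(2)] *)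
  then show ?case by (simp add: frame_expand[OF assms(1)] xs)
qed

abbreviation std :: "8 list" where "std \<equiv> [1, 2, 3, 4, 5, 6, 7, 8]"

lemma distinct_std: "distinct std"
  by simp

lemma mset_std: "mset is = mset std \<longleftrightarrow> distinct is \<and> length is = 8"
proof
  assume m: "mset is = mset std"
  have "length is = 8" using mset_eq_length[OF m] by simp
  moreover have "distinct is" using mset_eq_imp_distinct_iff[OF m] by simp
  ultimately show "distinct is \<and> length is = 8" by simp
next
  assume a: "distinct is \<and> length is = 8"
  then have "card (set is) = CARD(8)" by (simp add: distinct_card)
  then have "set is = UNIV" by (metis card_subset_eq finite_class.finite_UNIV top_greatest)
  then have "set is = set std" using UNIV_8 by simp
  then show "mset is = mset std" using a distinct_std set_eq_iff_mset_eq_distinct[of "is" std] by blast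
qed

section \<open>Self-dual four-forms as traceless symmetric matrices\<close>

text \<open>All \<open>8!\<close> arrangements contribute the same square to the norm of the volume form, which is one.\<close>

lemma vol_frame_sq:
  assumes "volume_form (vol :: 'a::euclidean_space polyform)" "frame e" "distinct ps" "length ps = 8"
  shows "(vol (map e ps))\<^sup>2 = 1"
proof -
  have D: "DIM('a) = 8" using assms(2) by (simp add: frame_def)
  have k: "vol \<in> kforms 8" and n: "form_inner vol vol = 1"
    using assms(1) D by (simp_all add: volume_form_def)
  have "form_inner vol vol = (\<Sum>k\<in>{8}. (\<Sum>xs | length xs = k \<and> set xs \<subseteq> Basis. vol xs * vol xs) / fact k)"
    unfolding form_inner_def D by (rule sum.mono_neutral_right) (auto simp: kforms_length[OF k])
  also have "\<dots> = (\<Sum>is | length is = 8. vol (map e is) * vol (map e is)) / fact 8"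
    by (simp add: frame_list_sum[OF assms(2) kforms_multilin[OF k] kforms_multilin[OF k]])
  also have "(\<Sum>is | length is = 8. vol (map e is) * vol (map e is)) = (\<Sum>is | length is
      = length ps. vol (map e is) * vol (map e is))"
    by (simp add: assms(4))
  also have "\<dots> = fact (length ps) * (vol (map e ps) * vol (map e ps))"
  proof (rule sum_over_arrangements[OF assms(3)])
    fix us vs and a b :: 8
    show "vol (map e (us @ b # a # vs)) * vol (map e (us @ b # a # vs))
        = vol (map e (us @ a # b # vs)) * vol (map e (us @ a # b # vs))"
      using kforms_map_swap[OF k, of e us b a vs] by simp
  next
    fix "is" assume "length is = length ps" "\<not> (distinct is \<and> set is = set ps)"
    then have "\<not> distinct is"
      using assms(3,4) mset_std[of "is"] mset_std[of ps] mset_eq_setD by metis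
    then show "vol (map e is) * vol (map e is) = 0"
      using kforms_distinct[OF k, of "map e is"] by (simp add: distinct_map)
  qed
  finally show ?thesis using n assms(4) by (simp add: power2_eq_square)
qed

definition pos_frame :: "'a::euclidean_space polyform \<Rightarrow> (8 \<Rightarrow> 'a) \<Rightarrow> bool" where
  "pos_frame vol e \<longleftrightarrow> volume_form vol \<and> frame e \<and> vol (map e std) = 1"

lemma pos_frame_vol: "pos_frame vol e \<Longrightarrow> (vol :: 'a::euclidean_space polyform) \<in> kforms 8"
  by (auto simp: pos_frame_def frame_def volume_form_def)

lemma pos_frame_exists:
  fixes vol :: "'a::euclidean_space polyform"
  assumes "DIM('a) = 8" "volume_form vol"
  obtains e where "pos_frame vol e"
proof -
  obtain e0 :: "8 \<Rightarrow> 'a" where e0: "bij_betw e0 UNIV Basis"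
    using finite_same_card_bij[of "UNIV :: 8 set" "Basis :: 'a set"] assms(1) by auto
  then have "e0 i \<in> Basis" "e0 i = e0 j \<longleftrightarrow> i = j" for i j by (auto simp: bij_betw_def inj_on_def)
  then have f0: "frame e0"
    unfolding frame_def using assms(1) by (auto simp: inner_Basis)
  \<comment> \<open>One of the frames \<open>e0\<close> and \<open>e\<close> has the right orientation.\<close>
  define e where "e = e0(1 := - e0 1)"
  have fe: "frame e"
    using f0 by (auto simp: frame_def e_def)
  have k: "vol \<in> kforms 8" using assms by (simp add: volume_form_def)
  have "linear (\<lambda>v. vol (v # map e0 [2,3,4,5,6,7,8]))"
    using multilinD[OF kforms_multilin[OF k], of "[]" "map e0 [2,3,4,5,6,7,8]"] by simp
  from linear_neg[OF this, of "e0 1"] have "vol (map e std) = - vol (map e0 std)"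
    by (simp add: e_def)
  moreover have "(vol (map e0 std))\<^sup>2 = 1"
    by (rule vol_frame_sq[OF assms(2) f0 distinct_std]) simp
  ultimately have "vol (map e0 std) = 1 \<or> vol (map e std) = 1"
    by (auto simp: power2_eq_1_iff)
  then show ?thesis
    using that f0 fe assms(2) unfolding pos_frame_def by blast
qed

text \<open>Only the \<open>4!\<close> arrangements of the complement of \<open>vs\<close> survive in the sum that defines the Hodge dual.\<close>

lemma hodge_frame:
  assumes "pos_frame vol e" "\<Phi> \<in> kforms 4" "distinct (us @ vs)" "length us = 4" "length vs = 4"
  shows "hodge vol \<Phi> (map e vs) = vol (map e (us @ vs)) * \<Phi> (map e us)"
proof -
  have fr: "frame (e :: 8 \<Rightarrow> 'a)" and D: "DIM('a) = 8" using assms(1) by (auto simp: pos_frame_def frame_def)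
  have k: "vol \<in> kforms 8" by (rule pos_frame_vol[OF assms(1)])
  have ml: "multilin 4 (\<lambda>xs. vol (xs @ map e vs))"
    by (rule multilinI) (use multilinD[OF kforms_multilin[OF k], of _ "_ @ map e vs"] assms(5) in simp)
  have U: "set us \<union> set vs = UNIV"
  proof -
    have "set (us @ vs) = set std" using mset_std[of "us @ vs"] assms(3-5) mset_eq_setD[of "us @ vs" std] by simp
    then show ?thesis using UNIV_8 by simp
  qed
  have "hodge vol \<Phi> (map e vs) = (\<Sum>k\<in>{4}. (\<Sum>xs | length xs = k \<and> set xs \<subseteq> Basis. \<Phi> xs * vol (xs @ map e vs)) / fact k)"
    unfolding hodge_def D by (rule sum.mono_neutral_right) (auto simp: kforms_length[OF assms(2)])
  also have "\<dots> = (\<Sum>is | length is = length us. \<Phi> (map e is) * vol (map e is @ map e vs)) / fact 4"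
    by (simp add: frame_list_sum[OF fr kforms_multilin[OF assms(2)] ml] assms(4))
  also have "(\<Sum>is | length is = length us. \<Phi> (map e is) * vol (map e is @ map e vs))
     = fact (length us) * (\<Phi> (map e us) * vol (map e us @ map e vs))"
  proof (rule sum_over_arrangements)
    show "distinct us" using assms(3) by simp
    fix us' vs' and a b :: 8
    show "\<Phi> (map e (us' @ b # a # vs')) * vol (map e (us' @ b # a # vs') @ map e vs) = 
      \<Phi> (map e (us' @ a # b # vs')) * vol (map e (us' @ a # b # vs') @ map e vs)"
      using kforms_map_swap[OF assms(2), of e us' b a vs'] kforms_map_swap[OF k, of e us' b a "vs' @ vs"] by simp
  next
    fix "is" assume l: "length is = length us" and n: "\<not> (distinct is \<and> set is = set us)"
    show "\<Phi> (map e is) * vol (map e is @ map e vs) = 0"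
    proof (cases "distinct is")
      case False
      then show ?thesis using kforms_distinct[OF assms(2), of "map e is"] by (simp add: distinct_map)
    next
      case True
      then have "\<not> set is \<subseteq> set us"
        using n l assms(3) card_subset_eq[of "set us" "set is"] by (auto simp: distinct_card)
      then have "set is \<inter> set vs \<noteq> {}" using U by auto
      then have "\<not> distinct (map e is @ map e vs)" by auto
      then show ?thesis using kforms_distinct[OF k] by simp
    qed
  qed
  finally show ?thesis using assms(4) by simp
qed

definition coords :: "(8 \<Rightarrow> 'a::euclidean_space) \<Rightarrow> 'a \<Rightarrow> real^8" where
  "coords e x = (\<chi> i. x \<bullet> e i)"

lemma linear_coords: "linear (coords e)"
  by (auto intro!: linearI simp: coords_def vec_eq_iff inner_add_left)

lemma coords_frame: "frame e \<Longrightarrow> coords e (e i) = ax i"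
  by (auto simp: coords_def vec_eq_iff frame_inner axis_def)

definition matrix_form :: "(8 \<Rightarrow> 'a::euclidean_space) \<Rightarrow> mat8 \<Rightarrow> 'a polyform" where
  "matrix_form e B xs = (case xs of [x, y, z, w] \<Rightarrow> qform B (coords e x) (coords e y) (coords e z) (coords e w) | _ \<Rightarrow> 0)"

lemma matrix_form_4 [simp]: "matrix_form e B [x, y, z, w] = qform B (coords e x) (coords e y) (coords e z) (coords e w)"
  by (simp add: matrix_form_def)

lemma length_4: "length xs = 4 \<longleftrightarrow> (\<exists>x y z w. xs = [x, y, z, w])"
  by (auto simp: numeral_eq_Suc length_Suc_conv)

lemma matrix_form_length: "length xs \<noteq> 4 \<Longrightarrow> matrix_form e B xs = 0"
  by (auto simp: matrix_form_def split: list.splits)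

lemma multilin_4I:
  assumes "\<And>y z w. linear (\<lambda>x. \<alpha> [x, y, z, w])" "\<And>x z w. linear (\<lambda>y. \<alpha> [x, y, z, w])"
    "\<And>x y w. linear (\<lambda>z. \<alpha> [x, y, z, w])" "\<And>x y z. linear (\<lambda>w. \<alpha> [x, y, z, w])"
  shows "multilin 4 \<alpha>"
proof (rule multilinI)
  fix us vs :: "'a list" assume "length us + Suc (length vs) = 4"
  then have "(length us = 0 \<and> length vs = 3) \<or> (length us = 1 \<and> length vs = 2) \<or> (length us = 2 \<and> length vs
      = 1) \<or> (length us = 3 \<and> length vs = 0)"
    by arith
  then show "linear (\<lambda>v. \<alpha> (us @ v # vs))"
    by (auto simp: numeral_eq_Suc length_Suc_conv assms)
qed

lemma matrix_form_multilin: "multilin 4 (matrix_form e B)"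
proof (rule multilin_4I)
  note c = linear_compose[OF linear_coords, unfolded comp_def]
  show "linear (\<lambda>x. matrix_form e B [x, y, z, w])" "linear (\<lambda>x. matrix_form e B [y, x, z, w])"
    "linear (\<lambda>x. matrix_form e B [y, z, x, w])" "linear (\<lambda>x. matrix_form e B [y, z, w, x])" for y z w
    using c[OF qform_linear(1)] c[OF qform_linear(2)] c[OF qform_linear(3)] c[OF qform_linear(4)] by auto
qed

lemma matrix_form_kforms:
  assumes "B \<in> traceless_sym" shows "matrix_form e B \<in> kforms 4"
  unfolding kforms_iff
proof (intro conjI allI impI)
  show "multilin 4 (matrix_form e B)" by (rule matrix_form_multilin)
  fix xs :: "'a list" 
  show "matrix_form e B xs = 0" if "length xs \<noteq> 4" using matrix_form_length[OF that] .
  show "matrix_form e B xs = 0" if "\<not> distinct xs"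
  proof (cases "length xs = 4")
    case True
    then obtain x y z w where "xs = [x, y, z, w]" by (auto simp: length_4)
    with that show ?thesis by (auto simp: qform_eq[OF assms])
  qed (simp add: matrix_form_length)
qed

abbreviation gword :: "8 list \<Rightarrow> mat8" where "gword is \<equiv> gam.word True (map ax is)"

lemma gword_append: "even (length us) \<Longrightarrow> gword (us @ vs) = gword us ** gword vs"
  by (simp add: gam.word_append)

lemma gword_swap: "a \<noteq> b \<Longrightarrow> gword (us @ b # a # vs) = - gword (us @ a # b # vs)"
  using gam.word_swap[of "ax b" "ax a" True "map ax us" "map ax vs"] by (simp add: inner_axis_axis)

lemma gword_4: "gword [i, j, k, l] = bivec i j ** bivec k l"
  by (simp add: bivec_def matrix_mul_assoc)

lemma qform_gword: "qform B (ax i) (ax j) (ax k) (ax l) = trace (B ** gword [i, j, k, l])"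
  unfolding gword_4 qform_bivec by (simp add: matrix_mul_assoc)

lemma matrix_form_frame:
  assumes "frame e" "length is = 4" shows "matrix_form e B (map e is) = trace (B ** gword is)"
  using assms(2) by (auto simp: length_4 coords_frame[OF assms(1)] qform_gword simp del: gam.word.simps)

lemma transpose_gam_skew: "i \<noteq> 1 \<Longrightarrow> transpose (gam (ax i)) = - gam (ax i)"
  and gam_1: "gam (ax 1) = mat 1"
proof -
  show 1: "gam (ax 1) = mat 1"
    by (simp add: vec_eq_iff gam_nth forall_8 oct_mult_nth mat_def axis_def)
  show "i \<noteq> 1 \<Longrightarrow> transpose (gam (ax i)) = - gam (ax i)"
    using gam.rel[of "ax i" "ax 1"] by (simp add: 1 inner_axis_axis eq_neg_iff_add_eq_0)
qed

definition vec8 :: "real \<Rightarrow> real \<Rightarrow> real \<Rightarrow> real \<Rightarrow> real \<Rightarrow> real \<Rightarrow> real \<Rightarrow> real \<Rightarrow> real^8" where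
  "vec8 a b c d e f g h = (\<chi> k. if k = 1 then a else if k = 2 then b else if k = 3 then c else if k = 4 then d
     else if k = 5 then e else if k = 6 then f else if k = 7 then g else h)"

lemma vec8_nth [simp]:
  "vec8 a b c d e f g h $ 1 = a" "vec8 a b c d e f g h $ 2 = b" "vec8 a b c d e f g h $ 3
      = c" "vec8 a b c d e f g h $ 4 = d"
  "vec8 a b c d e f g h $ 5 = e" "vec8 a b c d e f g h $ 6 = f" "vec8 a b c d e f g h $ 7
      = g" "vec8 a b c d e f g h $ 8 = h"
  by (simp_all add: vec8_def)

lemma vec8_eta: "y = vec8 (y$1) (y$2) (y$3) (y$4) (y$5) (y$6) (y$7) (y$8)"
  by (simp add: vec_eq_8)

lemma oct_mult_ax_vec8:
  "oct_mult (ax 2) (vec8 a b c d e f g h) = vec8 (- b) a d (- c) f (- e) h (- g)"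
  "oct_mult (ax 3) (vec8 a b c d e f g h) = vec8 (- c) (- d) a b g (- h) (- e) f"
  "oct_mult (ax 4) (vec8 a b c d e f g h) = vec8 (- d) c (- b) a (- h) (- g) f e"
  "oct_mult (ax 5) (vec8 a b c d e f g h) = vec8 (- e) (- f) (- g) h a b c (- d)"
  "oct_mult (ax 6) (vec8 a b c d e f g h) = vec8 (- f) e h g (- b) a (- d) (- c)"
  "oct_mult (ax 7) (vec8 a b c d e f g h) = vec8 (- g) (- h) e (- f) (- c) d a b"
  "oct_mult (ax 8) (vec8 a b c d e f g h) = vec8 (- h) g (- f) (- e) d c (- b) a"
  by (simp_all only: vec_eq_8 vec8_nth oct_mult_nth) (simp_all add: axis_def)

text \<open>The chirality of the representation: the volume element acts as the identity on positive spinors, so these carry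
the self-dual and not the anti-self-dual forms.\<close>

lemma gword_std: "gword std = mat 1"
proof -
  have gword: "gword std = - (gam (ax 2) ** gam (ax 3) ** gam (ax 4) ** gam (ax 5) ** gam (ax 6) ** gam (ax 7)
      ** gam (ax 8))"
    by (simp add: gam_1 transpose_gam_skew mm_lin matrix_mul_assoc)
  have neg: "(- mat 1 :: mat8) *v y = - y" for y
    by (simp add: vec_eq_iff matrix_vector_mult_def mat_def if_distrib if_distribR sum_negf cong: if_cong)
  have "(gam (ax 2) ** gam (ax 3) ** gam (ax 4) ** gam (ax 5) ** gam (ax 6) ** gam (ax 7) ** gam (ax 8)) *v y = - y" for y
    by (subst (1 2) vec8_eta[of y]) (simp add: matrix_vector_mul_assoc[symmetric] gam_mult_vec oct_mult_ax_vec8 vec_eq_8)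
  then have "(gam (ax 2) ** gam (ax 3) ** gam (ax 4) ** gam (ax 5) ** gam (ax 6) ** gam (ax 7) ** gam (ax 8)) = - mat 1"
    using neg by (simp add: matrix_eq)
  then show ?thesis unfolding gword by simp
qed

lemma gword_vol:
  assumes "pos_frame vol e" "distinct ps" "length ps = 8"
  shows "gword ps = vol (map e ps) *\<^sub>R mat 1"
proof (rule alternating_agree[of gword "\<lambda>ps. vol (map e ps) *\<^sub>R mat 1"])
  show "gword std = vol (map e std) *\<^sub>R mat 1" using assms(1) by (simp only: gword_std) (simp add: pos_frame_def)
  show "mset ps = mset std" unfolding mset_std using assms by simp
  show "vol (map e (us @ b # a # vs)) *\<^sub>R mat 1 = - (vol (map e (us @ a # b # vs)) *\<^sub>R mat 1)" for us vs a b
    using kforms_map_swap[OF pos_frame_vol[OF assms(1)], of e us b a vs] by simp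
qed (rule gword_swap)

lemma gword_sq:
  assumes "distinct ps" "length ps = 4"
  shows "gword ps ** gword ps = mat 1" "transpose (gword ps) = gword ps"
proof -
  obtain i j k l where ps: "ps = [i, j, k, l]" using assms(2) by (auto simp: length_4)
  have d: "distinct [i, j, k, l]" using assms(1) ps by simp
  have "gword ps ** gword ps = bivec i j ** (bivec k l ** bivec i j) ** bivec k l"
      by (simp only: ps gword_4 matrix_mul_assoc)
  also have "\<dots> = (bivec i j ** bivec i j) ** (bivec k l ** bivec k l)"
    unfolding bivec_commute[OF d] by (simp add: matrix_mul_assoc)
  finally show "gword ps ** gword ps = mat 1" using d by (simp add: bivec_sq mm_lin)
  show "transpose (gword ps) = gword ps"
    using d bivec_commute[OF d] by (simp only: ps gword_4) (simp add: matrix_transpose_mul mm_lin bivec_flip[of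
        i j] bivec_flip[of k l])
qed

text \<open>The word of all eight letters is a sign, and a word of four distinct letters is its own inverse; so complementary
words agree up to the orientation sign. This is self-duality at the level of gamma matrices.\<close>

lemma gword_dual:
  assumes "pos_frame vol e" "distinct (us @ vs)" "length us = 4" "length vs = 4"
  shows "gword us = vol (map e (us @ vs)) *\<^sub>R gword vs"
proof -
  have "gword us ** gword vs = vol (map e (us @ vs)) *\<^sub>R mat 1"
    using gword_vol[OF assms(1,2)] gword_append[of us vs] assms(3,4) by simp
  then have "gword us ** gword vs ** gword vs = vol (map e (us @ vs)) *\<^sub>R gword vs" by (simp add: mm_lin)
  then show ?thesis using assms by (simp add: matrix_mul_assoc[symmetric] gword_sq)
qed

lemma card_compl_8: "card (- A) = 8 - card (A :: 8 set)"
  by (simp add: Compl_eq_Diff_UNIV card_Diff_subset)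

lemma complement_list:
  assumes "distinct (vs :: 8 list)" "length vs = 4"
  obtains us where "distinct (us @ vs)" "length us = 4"
proof -
  obtain us where us: "set us = - set vs" "distinct us" using finite_distinct_list[of "- set vs"] by auto
  have "length us = card (- set vs)" using us distinct_card by metis
  also have "\<dots> = 4" using assms by (simp add: card_compl_8 distinct_card)
  finally show ?thesis using that[of us] us assms by auto
qed

lemma hodge_multilin:
  assumes "pos_frame vol e"
  shows "multilin 4 (hodge vol \<Phi>)"
proof (rule multilinI)
  fix us vs :: "'a list"
  note k = pos_frame_vol[OF assms]
  have L: "linear (\<lambda>v. vol (xs @ us @ v # vs))" for xs
  proof (cases "length (xs @ us) + Suc (length vs) = 8")
    case True
    then show ?thesis using multilinD[OF kforms_multilin[OF k] True] by simp
  next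
    case False
    then have "vol (xs @ us @ v # vs) = 0" for v using kforms_length[OF k] by simp
    then show ?thesis by (simp add: linear_zero)
  qed
  show "linear (\<lambda>v. hodge vol \<Phi> (us @ v # vs))"
    unfolding hodge_def
    by (rule linearI) (simp_all add: linear_add[OF L] linear_cmul[OF L] sum.distrib sum_distrib_left
        algebra_simps add_divide_distrib)
qed

lemma hodge_length:
  assumes "pos_frame vol e" "\<Phi> \<in> kforms 4" "length ys \<noteq> 4"
  shows "hodge vol \<Phi> ys = 0"
proof -
  have "\<Phi> xs * vol (xs @ ys) = 0" for xs
    using kforms_length[OF assms(2), of xs] kforms_length[OF pos_frame_vol[OF assms(1)], of "xs @ ys"] assms(3)
    by (cases "length xs = 4") auto
  then show ?thesis unfolding hodge_def by (simp only:) simp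
qed

lemma matrix_form_self_dual:
  assumes "pos_frame vol e" "B \<in> traceless_sym"
  shows "matrix_form e B \<in> self_dual_four_forms vol"
proof -
  have fr: "frame e" using assms(1) by (simp add: pos_frame_def)
  note k = matrix_form_kforms[OF assms(2), of e]
  have "hodge vol (matrix_form e B) xs = matrix_form e B xs" for xs
  proof (cases "length xs = 4")
    case True
    show ?thesis
    proof (rule multilin_eqI[OF fr hodge_multilin[OF assms(1)] matrix_form_multilin _ True])
      fix vs :: "8 list" assume l: "length vs = 4"
      show "hodge vol (matrix_form e B) (map e vs) = matrix_form e B (map e vs)"
      proof (cases "distinct vs")
        case True
        then obtain us where us: "distinct (us @ vs)" "length us = 4" using complement_list l by blast
        have "vol (map e (us @ vs)) * vol (map e (us @ vs)) = 1"
          using vol_frame_sq[of vol e "us @ vs"] us l assms(1) by (simp add: pos_frame_def power2_eq_square)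
        then have "matrix_form e B (map e vs) = vol (map e (us @ vs)) * matrix_form e B (map e us)"
          using gword_dual[OF assms(1) us(1,2) l] us(2) l
          by (simp add: matrix_form_frame[OF fr] mm_lin trace_lin del: map_append)
        then show ?thesis using hodge_frame[OF assms(1) k us l] by simp
      next
        case False
        then have "matrix_form e B (map e vs) = 0" using kforms_distinct[OF k] by (simp add: distinct_map)
        moreover have "hodge vol (matrix_form e B) (map e vs) = 0"
        proof -
          have "vol (xs @ map e vs) = 0" for xs
            using kforms_distinct[OF pos_frame_vol[OF assms(1)], of "xs @ map e vs"] False by (auto simp: distinct_map)
          then show ?thesis by (simp add: hodge_def)
        qed
        ultimately show ?thesis by simp
      qed
    qed
  qed (use hodge_length[OF assms(1) k] matrix_form_length in metis)
  then show ?thesis using k by (auto simp: self_dual_four_forms_def)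
qed


lemma trace_gword_eq_0:
  assumes "even (length is)" "even (count_list is i)" "odd (count_list is j)"
  shows "trace (gword is) = 0"
  by (rule gam.trace_word_eq_0[OF assms])

lemma count_list_distinct: "distinct xs \<Longrightarrow> count_list xs x = (if x \<in> set xs then 1 else 0)"
  by (induction xs) auto

lemma count_list_append: "count_list (xs @ ys) x = count_list xs x + count_list ys x"
  by (induction xs) auto

text \<open>The words of four letters are orthogonal unless their index sets are equal or complementary: otherwise some index
occurs in both and some in exactly one.\<close>

lemma trace_gword_pair_eq_0:
  assumes "distinct is" "length is = 4" "distinct vs" "length vs = 4" "set is \<noteq> set vs" "set is \<noteq> - set vs"
  shows "trace (gword is ** gword vs) = 0"
proof -
  have fin: "card (set is) = 4" "card (set vs) = 4" using assms by (simp_all add: distinct_card)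
  then have "\<not> set is \<subseteq> set vs" using assms(5) card_subset_eq[of "set vs" "set is"] by auto
  then obtain j where j: "j \<in> set is" "j \<notin> set vs" by auto
  have "card (- set vs) = 4" using fin by (simp add: card_compl_8)
  then have "\<not> set is \<subseteq> - set vs" using assms(6) fin card_subset_eq[of "- set vs" "set is"] by auto
  then obtain i where i: "i \<in> set is" "i \<in> set vs" by auto
  have "trace (gword (is @ vs)) = 0"
    by (rule trace_gword_eq_0[of _ i j]) (use assms i j in \<open>simp_all add: count_list_distinct count_list_append\<close>)
  then show ?thesis using gword_append[of "is" vs] assms(2) by simp
qed

text \<open>The witness is the Clifford action of \<open>\<Phi>\<close> itself, \<open>B = 1/384 \<Sum> \<Phi>\<^sub>i\<^sub>j\<^sub>k\<^sub>l \<gamma>\<^sub>i\<^sup>T \<gamma>\<^sub>j \<gamma>\<^sub>k\<^sup>T \<gamma>\<^sub>l\<close>. By orthogonality of the words,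
its component at \<open>vs\<close> collects the \<open>24\<close> arrangements of \<open>vs\<close> and the \<open>24\<close> of the complement, each with trace
\<open>8\<close>, and these agree because \<open>\<Phi>\<close> is self-dual: \<open>2 \<sqdot> 24 \<sqdot> 8 = 384\<close>.\<close>

lemma self_dual_is_matrix_form:
  assumes e: "pos_frame vol e" and S: "\<Phi> \<in> self_dual_four_forms vol"
  obtains B where "B \<in> traceless_sym" "\<Phi> = matrix_form e B"
proof -
  have fr: "frame e" using e by (simp add: pos_frame_def)
  have k: "\<Phi> \<in> kforms 4" and hd: "hodge vol \<Phi> = \<Phi>" using S by (auto simp: self_dual_four_forms_def)
  define P where "P is = \<Phi> (map e is)" for "is"
  define B where "B = (1 / 384) *\<^sub>R (\<Sum>is | length is = 4. P is *\<^sub>R gword is)"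
  have P0: "P is = 0" if "\<not> distinct is" for "is"
    using that kforms_distinct[OF k] by (simp add: P_def distinct_map)
  have Pswap: "P (us @ b # a # vs) = - P (us @ a # b # vs)" for us a b vs
    using kforms_map_swap[OF k] by (simp add: P_def)
  have PT: "P is *\<^sub>R transpose (gword is) = P is *\<^sub>R gword is" if "length is = 4" for "is"
    using gword_sq(2)[of "is"] P0 that by (cases "distinct is") simp_all
  have BT: "transpose B = B"
    unfolding B_def linear_cmul[OF linear_transpose] linear_sum[OF linear_transpose]
    by (intro arg_cong[where f = "(*\<^sub>R) (1 / 384)"] sum.cong refl) (simp only: PT mem_Collect_eq)
  have "P is * trace (gword is) = 0" if l: "length is = 4" for "is"
  proof (cases "distinct is")
    case True
    obtain us where us: "distinct (us @ is)" "length us = 4" using complement_list True l by blast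
    have "trace (gword is) = 0"
      by (rule trace_gword_eq_0[of _ "hd us" "hd is"])
        (use us l True in \<open>auto simp: count_list_distinct length_4\<close>)
    then show ?thesis by (simp add: trace_lin)
  qed (simp add: P0)
  then have "(\<Sum>is | length is = 4. P is * trace (gword is)) = 0"
    by (intro sum.neutral ballI) (simp only: mem_Collect_eq)
  then have "trace B = 0" unfolding B_def trace_lin by simp
  then have B: "B \<in> traceless_sym" using BT by (simp add: traceless_sym_def)
  have key: "trace (B ** gword vs) = P vs" if d: "distinct vs" and l: "length vs = 4" for vs
  proof -
    obtain us where us: "distinct (us @ vs)" "length us = 4" using complement_list d l by blast
    have setus: "set us = - set vs"
    proof -
      have "set us \<subseteq> - set vs" using us by auto
      moreover have "card (set us) = card (- set vs)" using us d l by (simp add: distinct_card card_compl_8)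
      ultimately show ?thesis using card_subset_eq[of "- set vs" "set us"] by simp
    qed
    define Q where "Q A is = (if set is = A then P is * trace (gword is ** gword vs) else 0)" for A "is"
    have Qsum: "(\<Sum>is | length is = 4. Q (set ps) is) = 24 * (P ps * trace (gword ps ** gword vs))"
        if ps: "distinct ps" "length ps = 4" for ps
    proof -
      have "(\<Sum>is | length is = length ps. Q (set ps) is) = fact (length ps) * Q (set ps) ps"
      proof (rule sum_over_arrangements[OF ps(1)])
        show "Q (set ps) (us @ b # a # vs) = Q (set ps) (us @ a # b # vs)" if "a \<noteq> b" for us a b vs
          using Pswap[of us b a vs] gword_swap[OF that, of us vs] by (auto simp: Q_def mm_lin trace_lin simp
              del: gam.word.simps map_append)
      qed (auto simp: Q_def P0)
      then show ?thesis using ps by (simp add: Q_def fact_numeral)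
    qed
    have "P is * trace (gword is ** gword vs) = Q (set vs) is + Q (set us) is" if "length is = 4" for "is"
      using trace_gword_pair_eq_0[of "is" vs] P0[of "is"] that d l setus by (auto simp: Q_def)
    then have "384 * trace (B ** gword vs) = (\<Sum>is | length is = 4. Q (set vs) is + Q (set us) is)"
      by (simp add: B_def mm.sum_left mm_lin trace_lin)
    also have "\<dots> = 24 * (P vs * trace (gword vs ** gword vs)) + 24 * (P us * trace (gword us ** gword vs))"
      using Qsum[OF d l] Qsum[of us] us by (simp add: sum.distrib)
    also have "\<dots> = 192 * P vs + 192 * (vol (map e (us @ vs)) * P us)"
      using gword_dual[OF e us(1,2) l] by (simp add: gword_sq[OF d l] mm_lin trace_lin del: map_append)
    also have "vol (map e (us @ vs)) * P us = P vs"
      using hodge_frame[OF e k us l] hd by (simp add: P_def)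
    finally show ?thesis by simp
  qed
  have "\<Phi> xs = matrix_form e B xs" for xs
  proof (cases "length xs = 4")
    case True
    show ?thesis
    proof (rule multilin_eqI[OF fr kforms_multilin[OF k] matrix_form_multilin _ True])
      fix vs :: "8 list" assume l: "length vs = 4"
      show "\<Phi> (map e vs) = matrix_form e B (map e vs)"
      proof (cases "distinct vs")
        case True
        then show ?thesis using key[OF True l] matrix_form_frame[OF fr l, of B] by (simp add: P_def)
      next
        case False
        then show ?thesis using kforms_distinct[OF k, of "map e vs"] kforms_distinct[OF matrix_form_kforms[OF
            B], of "map e vs" e]
          by (simp add: distinct_map)
      qed
    qed
  qed (use kforms_length[OF k] matrix_form_length in metis)
  then show ?thesis using that[OF B] by blast
qed

section \<open>The potential as a function of the matrix\<close>

text \<open>The six terms are the shuffles of type \<open>(2, 2)\<close>; all other sets of positions give \<open>\<alpha>\<close> a wrong number of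
arguments.\<close>

lemma wedge_two_two:
  assumes "\<And>xs. length xs \<noteq> 2 \<Longrightarrow> \<alpha> xs = 0"
  shows "(\<alpha> \<and>\<^sub>f \<beta>) [x, y, z, w] = \<alpha> [x, y] * \<beta> [z, w] - \<alpha> [x, z] * \<beta> [y, w] + \<alpha> [x, w] * \<beta> [y, z]
     + \<alpha> [y, z] * \<beta> [x, w] - \<alpha> [y, w] * \<beta> [x, z] + \<alpha> [z, w] * \<beta> [x, y]"
proof -
  define T where "T S = (-1) ^ card {(i, j). i \<in> S \<and> j \<in> {..<4} - S \<and> j < i}
       * \<alpha> (nths [x, y, z, w] S) * \<beta> (nths [x, y, z, w] ({..<4::nat} - S))" for S
  define F :: "nat set set" where "F = {{0,1}, {0,2}, {0,3}, {1,2}, {1,3}, {2,3}}"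
  have len: "length [x, y, z, w] = 4" by simp
  have four: "{..<4::nat} = {0,1,2,3}" by auto
  have "(\<alpha> \<and>\<^sub>f \<beta>) [x, y, z, w] = (\<Sum>S\<in>Pow {..<4}. T S)"
    unfolding wedge_def T_def len by (rule refl)
  also have "\<dots> = (\<Sum>S\<in>F. T S)"
  proof (rule sum.mono_neutral_right)
    show "F \<subseteq> Pow {..<4}" by (auto simp: F_def)
    show "\<forall>S\<in>Pow {..<4} - F. T S = 0"
    proof
      fix S assume S: "S \<in> Pow {..<4::nat} - F"
      have "card S \<noteq> 2"
      proof
        assume "card S = 2"
        then obtain a b where ab: "S = {a, b}" "a \<noteq> b" by (auto simp: card_2_iff)
        then have "a \<in> {0,1,2,3}" "b \<in> {0,1,2,3}" using S four by auto
        then have "S \<in> F" using ab by (auto simp: F_def insert_commute)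
        then show False using S by simp
      qed
      moreover have "{i. i < length [x, y, z, w] \<and> i \<in> S} = S" unfolding len using S by blast
      ultimately have "length (nths [x, y, z, w] S) \<noteq> 2" by (simp only: length_nths) simp
      then show "T S = 0" by (simp add: T_def assms)
    qed
  qed simp
  also have "\<dots> = T {0,1} + T {0,2} + T {0,3} + T {1,2} + T {1,3} + T {2,3}"
    by (simp add: F_def doubleton_eq_iff add.assoc)
  also have "T {0,1} = \<alpha> [x, y] * \<beta> [z, w]"
  proof -
    have inv: "{(i, j). i \<in> {0,1} \<and> j \<in> {..<4::nat} - {0,1} \<and> j < i} = {}" by auto
    show ?thesis unfolding T_def inv by (simp add: four nths_Cons insert_Diff_if)
  qed
  also have "T {0,2} = - \<alpha> [x, z] * \<beta> [y, w]"
  proof -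
    have inv: "{(i, j). i \<in> {0,2} \<and> j \<in> {..<4::nat} - {0,2} \<and> j < i} = {(2,1)}" by auto
    show ?thesis unfolding T_def inv by (simp add: four nths_Cons insert_Diff_if)
  qed
  also have "T {0,3} = \<alpha> [x, w] * \<beta> [y, z]"
  proof -
    have inv: "{(i, j). i \<in> {0,3} \<and> j \<in> {..<4::nat} - {0,3} \<and> j < i} = {(3,1), (3,2)}" by auto
    show ?thesis unfolding T_def inv by (simp add: four nths_Cons insert_Diff_if)
  qed
  also have "T {1,2} = \<alpha> [y, z] * \<beta> [x, w]"
  proof -
    have inv: "{(i, j). i \<in> {1,2} \<and> j \<in> {..<4::nat} - {1,2} \<and> j < i} = {(1,0), (2,0)}" by auto
    show ?thesis unfolding T_def inv by (simp add: four nths_Cons insert_Diff_if)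
  qed
  also have "T {1,3} = - \<alpha> [y, w] * \<beta> [x, z]"
  proof -
    have inv: "{(i, j). i \<in> {1,3} \<and> j \<in> {..<4::nat} - {1,3} \<and> j < i} = {(1,0), (3,0), (3,2)}" by auto
    show ?thesis unfolding T_def inv by (simp add: four nths_Cons insert_Diff_if)
  qed
  also have "T {2,3} = \<alpha> [z, w] * \<beta> [x, y]"
  proof -
    have inv: "{(i, j). i \<in> {2,3} \<and> j \<in> {..<4::nat} - {2,3} \<and> j < i} = {(2,0), (2,1), (3,0), (3,1)}" by auto
    show ?thesis unfolding T_def inv by (simp add: four nths_Cons insert_Diff_if)
  qed
  finally show ?thesis by simp
qed

lemma kforms_4_linear:
  assumes "\<Phi> \<in> kforms 4"
  shows "linear (\<lambda>v. \<Phi> [v, x, y, z])" "linear (\<lambda>v. \<Phi> [x, v, y, z])" "linear (\<lambda>v. \<Phi> [x, y, v,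
      z])" "linear (\<lambda>v. \<Phi> [x, y, z, v])"
  using multilinD[OF kforms_multilin[OF assms], of "[]" "[x,y,z]"] multilinD[OF kforms_multilin[OF assms], of "[x]" "[y,z]"]
    multilinD[OF kforms_multilin[OF assms], of "[x,y]" "[z]"] multilinD[OF kforms_multilin[OF assms], of "[x,y,z]" "[]"]
  by auto

definition pair_sum :: "'a::euclidean_space polyform \<Rightarrow> 'a \<Rightarrow> 'a \<Rightarrow> 'a \<Rightarrow> 'a \<Rightarrow> real" where
  "pair_sum \<Phi> x y z w = (\<Sum>a\<in>Basis. \<Sum>b\<in>Basis. \<Phi> [b, a, x, y] * \<Phi> [b, a, z, w])"

text \<open>For equal arguments the six shuffles agree in pairs, which cancels the factor \<open>1/2\<close>.\<close>

lemma Delta2_pair_sum: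
  assumes "\<Phi> \<in> kforms 4"
  shows "Delta2 \<Phi> \<Phi> [x, y, z, w] = pair_sum \<Phi> x y z w - pair_sum \<Phi> x z y w + pair_sum \<Phi> x w y z"
proof -
  have "(interior a (interior b \<Phi>) \<and>\<^sub>f interior a (interior b \<Phi>)) [x, y, z, w] =
     2 * (\<Phi> [b, a, x, y] * \<Phi> [b, a, z, w] - \<Phi> [b, a, x, z] * \<Phi> [b, a, y, w] + \<Phi> [b, a, x, w] * \<Phi> [b, a, y, z])" for a b
    by (subst wedge_two_two) (auto simp: interior_def kforms_length[OF assms] algebra_simps)
  then show ?thesis
    by (simp add: Delta2_def pair_sum_def sum_distrib_left[symmetric] sum.distrib sum_subtractf)
qed

lemma linear_mult_const: "linear f \<Longrightarrow> linear (\<lambda>x. f x * (c::real))" "linear f \<Longrightarrow> linear (\<lambda>x. c * f x)"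
  by (auto intro!: linearI simp: linear_add linear_cmul algebra_simps)

lemma linear_add_fun: "linear f \<Longrightarrow> linear g \<Longrightarrow> linear (\<lambda>x. f x + g x :: real)"
  and linear_diff_fun: "linear f \<Longrightarrow> linear g \<Longrightarrow> linear (\<lambda>x. f x - g x :: real)"
  by (auto intro!: linearI simp: linear_add linear_cmul algebra_simps)

lemma linear_sum_fun: "(\<And>i. i \<in> A \<Longrightarrow> linear (f i)) \<Longrightarrow> linear (\<lambda>x. \<Sum>i\<in>A. f i x :: real)"
  by (rule linearI) (simp_all add: linear_add linear_cmul sum.distrib sum_distrib_left)

lemma Delta2_multilin:
  assumes "\<Phi> \<in> kforms 4" shows "multilin 4 (Delta2 \<Phi> \<Phi>)"
  by (rule multilin_4I; unfold Delta2_pair_sum[OF assms] pair_sum_def)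
    (intro linear_add_fun linear_diff_fun linear_sum_fun linear_mult_const kforms_4_linear[OF assms])+

lemma pair_sum_frame:
  assumes "\<Phi> \<in> kforms 4" "frame e"
  shows "pair_sum \<Phi> x y z w = (\<Sum>i\<in>UNIV. \<Sum>j\<in>UNIV. \<Phi> [e i, e j, x, y] * \<Phi> [e i, e j, z, w])"
proof -
  have "pair_sum \<Phi> x y z w = (\<Sum>a\<in>Basis. \<Sum>i\<in>UNIV. \<Phi> [e i, a, x, y] * \<Phi> [e i, a, z, w])"
    unfolding pair_sum_def
    by (intro sum.cong refl frame_trace[OF assms(2)] linear_mult_const kforms_4_linear[OF assms(1)])
  also have "\<dots> = (\<Sum>i\<in>UNIV. \<Sum>a\<in>Basis. \<Phi> [e i, a, x, y] * \<Phi> [e i, a, z, w])"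
    by (rule sum.swap)
  also have "\<dots> = (\<Sum>i\<in>UNIV. \<Sum>j\<in>UNIV. \<Phi> [e i, e j, x, y] * \<Phi> [e i, e j, z, w])"
    by (intro sum.cong refl frame_trace[OF assms(2)] linear_mult_const kforms_4_linear[OF assms(1)])
  finally show ?thesis .
qed

lemma form_inner_frame:
  assumes "frame e" "multilin 4 \<alpha>" "multilin 4 \<beta>" "\<And>xs. length xs \<noteq> 4 \<Longrightarrow> \<beta> xs = 0"
  shows "form_inner \<alpha> \<beta> = (\<Sum>i\<in>UNIV. \<Sum>j\<in>UNIV. \<Sum>k\<in>UNIV. \<Sum>l\<in>UNIV. \<alpha> [e i, e j, e k, e l] * \<beta> [e i, e j, e k, e l]) / 24"
proof -
  have D: "DIM('a) = 8" using assms(1) by (simp add: frame_def)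
  have "form_inner \<alpha> \<beta> = (\<Sum>k\<in>{4}. (\<Sum>xs | length xs = k \<and> set xs \<subseteq> Basis. \<alpha> xs * \<beta> xs) / fact k)"
    unfolding form_inner_def D by (rule sum.mono_neutral_right) (auto simp: assms(4))
  also have "\<dots> = (\<Sum>is | length is = 4. \<alpha> (map e is) * \<beta> (map e is)) / fact 4"
    by (simp add: frame_list_sum[OF assms(1-3)])
  finally show ?thesis by (simp add: sum_index_lists_4 fact_numeral)
qed

lemma matrix_form_inner:
  assumes "frame e" "transpose B = B" "C \<in> traceless_sym"
  shows "form_inner (matrix_form e B) (matrix_form e C) = 16 * (B \<bullet> C)"
  by (subst form_inner_frame[OF assms(1) matrix_form_multilin matrix_form_multilin matrix_form_length])
    (simp_all add: coords_frame[OF assms(1)] qform_inner[OF assms(2,3)])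

lemma matrix_form_Delta2_inner:
  assumes "frame e" "B \<in> traceless_sym" "C \<in> traceless_sym"
  shows "form_inner (Delta2 (matrix_form e B) (matrix_form e B)) (matrix_form e C) = - 256 * ((B ** B) \<bullet> C)"
proof -
  note k = matrix_form_kforms[OF assms(2), of e]
  have "Delta2 (matrix_form e B) (matrix_form e B) [e i, e j, e k, e l] = delta_comp B i j k l" for i j k l
    by (simp add: Delta2_pair_sum[OF k] pair_sum_frame[OF k assms(1)] coords_frame[OF assms(1)] delta_comp_def
        Let_def sum.distrib sum_subtractf)
  then show ?thesis
    by (subst form_inner_frame[OF assms(1) Delta2_multilin[OF k] matrix_form_multilin matrix_form_length])
      (simp_all add: coords_frame[OF assms(1)] delta_comp_inner[OF assms(2,3)])
qed

definition matrix_potential :: "mat8 \<Rightarrow> real" where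
  "matrix_potential B = 256 * ((B \<bullet> B) powr (3 / 2) - sqrt 14 / 3 * ((B ** B) \<bullet> B))"

lemma potential_matrix_form:
  assumes "frame e" "B \<in> traceless_sym"
  shows "potential (matrix_form e B) = matrix_potential B"
proof -
  have "(16::real) powr (3 / 2) = (4 powr 2) powr (3 / 2)" by simp
  also have "\<dots> = 64" by (subst powr_powr) simp
  finally have "(16 * (B \<bullet> B)) powr (3 / 2) = 64 * (B \<bullet> B) powr (3 / 2)"
    by (subst powr_mult) auto
  then show ?thesis
    using assms(2) by (simp add: potential_def matrix_potential_def matrix_form_Delta2_inner[OF assms assms(2)]
      matrix_form_inner[OF assms(1) _ assms(2)] traceless_sym_def algebra_simps)
qed

lemma matrix_form_add: "matrix_form e (B + C) = matrix_form e B + matrix_form e C"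
  by (rule ext) (auto simp: matrix_form_def linear_add[OF qform_linear_matrix] split: list.splits)

lemma traceless_sym_add: "B \<in> traceless_sym \<Longrightarrow> C \<in> traceless_sym \<Longrightarrow> B + C \<in> traceless_sym"
  and traceless_sym_scale: "B \<in> traceless_sym \<Longrightarrow> c *\<^sub>R B \<in> traceless_sym"
  by (auto simp: traceless_sym_def transpose_lin trace_lin)

lemma form_norm_matrix_form:
  assumes "frame e" "C \<in> traceless_sym" shows "form_norm (matrix_form e C) = 4 * norm C"
  using assms(2) by (simp add: form_norm_def matrix_form_inner[OF assms(1) _ assms(2)] traceless_sym_def
      real_sqrt_mult norm_eq_sqrt_inner)

section \<open>Critical points\<close>

lemma matrix_potential_derivative:
  assumes "B \<noteq> 0"
  shows "(matrix_potential has_derivative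
     (\<lambda>C. 256 * (3 * sqrt (B \<bullet> B) * (B \<bullet> C) - sqrt 14 / 3 * ((B ** B) \<bullet> C + (B ** C + C ** B) \<bullet> B)))) (at B)"
proof -
  have "B \<bullet> B > 0" using assms by simp
  have 1: "((\<lambda>M. M \<bullet> M) has_derivative (\<lambda>C. B \<bullet> C + C \<bullet> B)) (at B)"
    by (rule has_derivative_inner[OF has_derivative_ident has_derivative_ident])
  have 2: "((\<lambda>M. (M \<bullet> M) powr (3/2)) has_derivative (\<lambda>C. (B \<bullet> C + C \<bullet> B) * (3/2 * (B \<bullet> B) powr (3/2 - 1)))) (at B)"
    by (rule DERIV_compose_FDERIV[OF has_real_derivative_powr[OF \<open>B \<bullet> B > 0\<close>] 1])
  have 3: "((\<lambda>M. (M ** M)) has_derivative (\<lambda>C. B ** C + C ** B)) (at B)"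
    by (rule mm.FDERIV[OF has_derivative_ident has_derivative_ident])
  have 4: "((\<lambda>M. (M ** M) \<bullet> M) has_derivative (\<lambda>C. (B ** B) \<bullet> C + (B ** C + C ** B) \<bullet> B)) (at B)"
    by (rule has_derivative_inner[OF 3 has_derivative_ident])
  have "(matrix_potential has_derivative (\<lambda>C. 256 * ((B \<bullet> C + C \<bullet> B) * (3/2 * (B \<bullet> B) powr (3/2 - 1))
      - sqrt 14 / 3 * ((B ** B) \<bullet> C + (B ** C + C ** B) \<bullet> B)))) (at B)"
    unfolding matrix_potential_def
    by (intro has_derivative_mult_right has_derivative_diff 2 4)
  moreover have "(B \<bullet> B) powr (3/2 - 1) = sqrt (B \<bullet> B)"
    using \<open>B \<bullet> B > 0\<close> by (simp add: powr_half_sqrt)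
  ultimately show ?thesis by (simp add: inner_commute algebra_simps)
qed

text \<open>For \<open>B \<noteq> 0\<close> in \<open>traceless_sym\<close> this says that the derivative of \<open>matrix_potential\<close> vanishes on \<open>traceless_sym\<close>.\<close>

definition matrix_critical :: "mat8 \<Rightarrow> bool" where
  "matrix_critical B \<longleftrightarrow> (\<forall>C\<in>traceless_sym. 3 * sqrt (B \<bullet> B) * (B \<bullet> C) = sqrt 14 * ((B ** B) \<bullet> C))"

text \<open>Along the linear parametrisation \<open>B \<mapsto> \<Phi>\<^sub>B\<close>, which scales norms by \<open>4\<close>, critical points are the zeros of the
derivative of \<open>matrix_potential\<close> on the traceless symmetric matrices. There the three terms of the derivative of
the cubic part coincide, by cyclicity of the trace.\<close>

lemma critical_matrix_form:
  assumes e: "pos_frame vol e" and B: "B \<in> traceless_sym" "B \<noteq> 0"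
  shows "critical_point_on (self_dual_four_forms vol) potential (matrix_form e B) \<longleftrightarrow> matrix_critical B"
proof -
  have fr: "frame e" using e by (simp add: pos_frame_def)
  define D where "D C = 256 * (3 * sqrt (B \<bullet> B) * (B \<bullet> C) - sqrt 14 / 3 * ((B ** B) \<bullet> C + (B ** C + C ** B) \<bullet> B))" for C
  have der: "(matrix_potential has_derivative D) (at B)"
    unfolding D_def by (rule matrix_potential_derivative[OF B(2)])
  have lin: "linear D" using der has_derivative_linear by blast
  have D: "D C = 256 * (3 * sqrt (B \<bullet> B) * (B \<bullet> C) - sqrt 14 * ((B ** B) \<bullet> C))" if "C \<in> traceless_sym" for C
  proof -
    have T: "transpose B = B" "transpose C = C" using that B by (auto simp: traceless_sym_def)
    have "(B ** B) \<bullet> C = trace (B ** B ** C)" by (simp add: inner_matrix matrix_transpose_mul T)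
    moreover have "(B ** C) \<bullet> B = trace (C ** B ** B)" by (simp add: inner_matrix matrix_transpose_mul T)
    moreover have "(C ** B) \<bullet> B = trace (B ** C ** B)" by (simp add: inner_matrix matrix_transpose_mul T)
    ultimately have "(B ** C) \<bullet> B = (B ** B) \<bullet> C" "(C ** B) \<bullet> B = (B ** B) \<bullet> C"
      by (metis trace_cycle3)+
    then show ?thesis by (simp add: D_def inner_add_left)
  qed
  have pot: "potential (matrix_form e B + matrix_form e C) - potential (matrix_form e B) = matrix_potential (B
      + C) - matrix_potential B" if "C \<in> traceless_sym" for C
    using potential_matrix_form[OF fr traceless_sym_add[OF B(1) that]] potential_matrix_form[OF fr B(1)]
        by (simp add: matrix_form_add)
  have approx: "\<exists>d>0. \<forall>C. norm C < d \<longrightarrow> \<bar>matrix_potential (B + C) - matrix_potential B - D C\<bar> \<le> \<epsilon> * norm C"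
      if eps: "\<epsilon> > 0" for \<epsilon>
  proof -
    obtain d where d: "d > 0" "\<And>y. norm (y - B) < d \<Longrightarrow> norm (matrix_potential y - matrix_potential B - D (y
        - B)) \<le> \<epsilon> * norm (y - B)"
      using der[unfolded has_derivative_at_alt, THEN conjunct2, rule_format, OF eps] by auto
    have "\<bar>matrix_potential (B + C) - matrix_potential B - D C\<bar> \<le> \<epsilon> * norm C" if "norm C < d" for C
      using d(2)[of "B + C"] that by simp
    then show ?thesis using d(1) by blast
  qed
  show ?thesis
  proof
    assume crit: "critical_point_on (self_dual_four_forms vol) potential (matrix_form e B)"
    have D0: "D C = 0" if C: "C \<in> traceless_sym" for C
    proof (rule ccontr)
      assume nz: "D C \<noteq> 0"
      then have nC: "norm C > 0" using lin linear_0 by auto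
      \<comment> \<open>Both error terms together are at most \<open>5 \<epsilon> |C|\<close> per unit of \<open>t\<close>, which is half of \<open>|D C|\<close>.\<close>
      define \<epsilon> where "\<epsilon> = \<bar>D C\<bar> / (10 * norm C)"
      have eps: "\<epsilon> > 0" using nz nC by (simp add: \<epsilon>_def)
      obtain d where d: "d > 0" "\<And>C. norm C < d \<Longrightarrow> \<bar>matrix_potential (B + C) - matrix_potential B - D C\<bar> \<le> \<epsilon> * norm C"
        using approx[OF eps] by blast
      obtain d' where d': "d' > 0" "\<And>\<Psi>. \<Psi> \<in> self_dual_four_forms vol \<Longrightarrow> form_norm \<Psi> < d' \<Longrightarrow> 
          \<bar>potential (matrix_form e B + \<Psi>) - potential (matrix_form e B)\<bar> \<le> \<epsilon> * form_norm \<Psi>"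
        using crit eps unfolding critical_point_on_def by blast
      define t where "t = min d (d' / 4) / (2 * norm C)"
      have t: "t > 0" using d d' nC by (simp add: t_def)
      have tn: "norm (t *\<^sub>R C) = min d (d' / 4) / 2" using t nC d(1) d'(1) by (simp add: t_def)
      have tC: "t *\<^sub>R C \<in> traceless_sym" by (rule traceless_sym_scale[OF C])
      have "\<bar>matrix_potential (B + t *\<^sub>R C) - matrix_potential B - D (t *\<^sub>R C)\<bar> \<le> \<epsilon> * norm (t *\<^sub>R C)"
        by (rule d(2)) (use tn d(1) d'(1) in linarith)
      moreover have "\<bar>potential (matrix_form e B + matrix_form e (t *\<^sub>R C))
          - potential (matrix_form e B)\<bar> \<le> \<epsilon> * form_norm (matrix_form e (t *\<^sub>R C))"
        by (rule d'(2)[OF matrix_form_self_dual[OF e tC]]) (use form_norm_matrix_form[OF fr tC] tn d(1) d'(1) in linarith)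
      ultimately have "\<bar>D (t *\<^sub>R C)\<bar> \<le> \<epsilon> * norm (t *\<^sub>R C) + \<epsilon> * (4 * norm (t *\<^sub>R C))"
        unfolding pot[OF tC] form_norm_matrix_form[OF fr tC] by linarith
      then have "t * \<bar>D C\<bar> \<le> t * (5 * \<epsilon> * norm C)"
        using t by (simp add: linear_cmul[OF lin] abs_mult algebra_simps)
      then have "\<bar>D C\<bar> \<le> 5 * \<epsilon> * norm C" using t by simp
      then show False using nC nz by (simp add: \<epsilon>_def)
    qed
    show "matrix_critical B" unfolding matrix_critical_def
    proof
      fix C assume "C \<in> traceless_sym"
      then have "256 * (3 * sqrt (B \<bullet> B) * (B \<bullet> C) - sqrt 14 * ((B ** B) \<bullet> C)) = 0" using D D0 by metis
      then show "3 * sqrt (B \<bullet> B) * (B \<bullet> C) = sqrt 14 * ((B ** B) \<bullet> C)" by (simp only: mult_eq_0_iff) simp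
    qed
  next
    assume "matrix_critical B"
    then have D0: "D C = 0" if "C \<in> traceless_sym" for C using D that by (simp add: matrix_critical_def)
    show "critical_point_on (self_dual_four_forms vol) potential (matrix_form e B)"
      unfolding critical_point_on_def
    proof (intro conjI allI impI)
      show "matrix_form e B \<in> self_dual_four_forms vol" by (rule matrix_form_self_dual[OF e B(1)])
      fix \<epsilon> :: real assume "\<epsilon> > 0"
      then obtain d where d: "d > 0" "\<And>C. norm C < d \<Longrightarrow> \<bar>matrix_potential (B + C) - matrix_potential B
          - D C\<bar> \<le> (4 * \<epsilon>) * norm C"
        using approx[of "4 * \<epsilon>"] by auto
      show "\<exists>\<delta>>0. \<forall>\<Psi>\<in>self_dual_four_forms vol. form_norm \<Psi> < \<delta> \<longrightarrow>
          \<bar>potential (matrix_form e B + \<Psi>) - potential (matrix_form e B)\<bar> \<le> \<epsilon> * form_norm \<Psi>"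
      proof (intro exI[of _ "4 * d"] conjI ballI impI)
        fix \<Psi> assume "\<Psi> \<in> self_dual_four_forms vol" and n: "form_norm \<Psi> < 4 * d"
        then obtain C where C: "C \<in> traceless_sym" "\<Psi> = matrix_form e C" using self_dual_is_matrix_form[OF e] by blast
        have "norm C < d" using n form_norm_matrix_form[OF fr C(1)] C(2) by simp
        then show "\<bar>potential (matrix_form e B + \<Psi>) - potential (matrix_form e B)\<bar> \<le> \<epsilon> * form_norm \<Psi>"
          using d(2)[of C] D0[OF C(1)] unfolding C(2) pot[OF C(1)] form_norm_matrix_form[OF fr C(1)] by simp
      qed (use d in simp)
    qed
  qed
qed

definition outer :: "real^8 \<Rightarrow> mat8" where "outer v = (\<chi> i j. v $ i * v $ j)"

lemma trace_outer: "trace (outer v) = v \<bullet> v"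
  by (simp add: trace_def outer_def inner_vec_def)

lemma transpose_outer: "transpose (outer v) = outer v"
  by (simp add: outer_def transpose_def mult.commute)

lemma outer_mult_outer: "outer v ** outer v = (v \<bullet> v) *\<^sub>R outer v"
proof -
  have "(outer v ** outer v) $ j $ k = (v \<bullet> v) * (v $ j * v $ k)" for j k
    by (simp add: matrix_matrix_mult_def outer_def inner_vec_def sum_distrib_left sum_distrib_right mult_ac)
  then show ?thesis by (simp add: vec_eq_iff outer_def)
qed

text \<open>A normalised nonzero row \<open>v\<close> of \<open>P\<close> is a unit vector fixed by \<open>P\<close>; then \<open>P - v v\<^sup>T\<close> is a symmetric idempotent
of trace zero, so its norm is zero.\<close>

lemma projection_rank_one:
  assumes T: "transpose P = P" and PP: "P ** P = P" and tr: "trace P = (1::real)"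
  obtains v :: "real^8" where "norm v = 1" "P = outer v"
proof -
  have sym: "P $ i $ j = P $ j $ i" for i j 
    using arg_cong[OF T, of "\<lambda>M. M $ i $ j"] by (simp add: transpose_def)
  have row: "(\<Sum>j\<in>UNIV. P $ i $ j * P $ j $ k) = P $ i $ k" for i k
    using arg_cong[OF PP, of "\<lambda>M. M $ i $ k"] by (simp add: matrix_matrix_mult_def)
  have "\<exists>i. P $ i $ i \<noteq> 0" using tr by (auto simp: trace_def intro: ccontr)
  then obtain i where i: "P $ i $ i \<noteq> 0" ..
  have "P $ i $ i = (\<Sum>j\<in>UNIV. P $ i $ j * P $ j $ i)" by (simp only: row)
  also have "\<dots> = (\<Sum>j\<in>UNIV. P $ i $ j * P $ i $ j)"
    by (intro sum.cong refl arg_cong2[where f = "(*)"]) (rule sym)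
  finally have Pii: "P $ i $ i = (\<Sum>j\<in>UNIV. P $ i $ j * P $ i $ j)" .
  have "(\<Sum>j\<in>UNIV. P $ i $ j * P $ i $ j) \<ge> 0" by (simp add: sum_nonneg)
  then have "P $ i $ i \<ge> 0" unfolding Pii[symmetric] .
  with i have ip: "P $ i $ i > 0" by simp
  define v where "v = (1 / sqrt (P $ i $ i)) *\<^sub>R P $ i"
  have nv: "v \<bullet> v = 1"
  proof -
    have "v \<bullet> v = (\<Sum>j\<in>UNIV. P $ i $ j * P $ i $ j) / P $ i $ i"
      using ip by (simp add: v_def inner_vec_def sum_divide_distrib)
    then show ?thesis unfolding Pii[symmetric] using ip by simp
  qed
  have ov: "outer v $ j $ k = P $ i $ j * P $ i $ k / P $ i $ i" for j k
    using ip by (simp add: outer_def v_def)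
  define Q where "Q = P - outer v"
  have QT: "transpose Q = Q" 
    by (simp add: Q_def transpose_lin T transpose_outer)
  have Po: "P ** outer v = outer v"
  proof -
    have "(P ** outer v) $ j $ k = outer v $ j $ k" for j k
    proof -
      have "(P ** outer v) $ j $ k = (\<Sum>l\<in>UNIV. P $ i $ l * P $ l $ j) * P $ i $ k / P $ i $ i"
        unfolding sum_distrib_right sum_divide_distrib matrix_matrix_mult_def
        using sym by (auto simp: ov intro!: sum.cong)
      then show ?thesis by (simp add: row ov)
    qed
    then show ?thesis by (simp add: vec_eq_iff)
  qed
  have oP: "outer v ** P = outer v"
    using arg_cong[OF Po, of transpose] by (simp add: matrix_transpose_mul T transpose_outer)
  have oo: "outer v ** outer v = outer v" by (simp add: outer_mult_outer nv)
  have "Q \<bullet> Q = trace (Q ** Q)" by (rule inner_matrix_sym[OF QT])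
  also have "Q ** Q = Q" by (simp add: Q_def mm_lin PP Po oP oo)
  also have "trace Q = 1 - v \<bullet> v" by (simp add: Q_def trace_lin tr trace_outer)
  finally have "Q = 0" using nv by simp
  then show ?thesis using that[of v] nv by (simp add: Q_def norm_eq_sqrt_inner)
qed


text \<open>For a unit spinor \<open>v\<close> this is the traceless part of its square \<open>v v\<^sup>T\<close>, scaled by \<open>t\<close>.\<close>

definition spinor_matrix :: "real \<Rightarrow> real^8 \<Rightarrow> mat8" where
  "spinor_matrix t v = t *\<^sub>R (outer v - (1 / 8) *\<^sub>R mat 1)"

lemma spinor_matrix_traceless_sym: "norm v = 1 \<Longrightarrow> spinor_matrix t v \<in> traceless_sym"
  by (simp add: spinor_matrix_def traceless_sym_def transpose_lin trace_lin trace_outer transpose_outer norm_eq_1)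

lemma mat1_inner_traceless_sym: "C \<in> traceless_sym \<Longrightarrow> mat 1 \<bullet> C = 0"
  by (simp add: inner_matrix traceless_sym_def)

text \<open>Criticality says that \<open>3 |B| B - \<surd>14 B\<^sup>2\<close> is orthogonal to all traceless symmetric matrices, hence a multiple of the
identity. With \<open>s = |B| / \<surd>14\<close> this reads \<open>B\<^sup>2 = 3 s B + m\<close>, and the trace gives \<open>m = 7 s\<^sup>2 / 4\<close>. So
\<open>(B - 7 s / 2) (B + s / 2) = 0\<close>, and \<open>(B + s / 2) / (4 s)\<close> is the projection on the first eigenspace, with trace one.\<close>

lemma critical_imp_spinor_matrix:
  assumes B: "B \<in> traceless_sym" "B \<noteq> 0" and crit: "matrix_critical B"
  obtains t v where "t > 0" "norm v = 1" "B = spinor_matrix t v"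
proof -
  have T: "transpose B = B" "trace B = 0" using B by (auto simp: traceless_sym_def)
  define X where "X = (3 * sqrt (B \<bullet> B)) *\<^sub>R B - sqrt 14 *\<^sub>R (B ** B)"
  define M where "M = X - (trace X / 8) *\<^sub>R mat 1"
  have M0: "M \<in> traceless_sym"
    by (simp add: M_def X_def traceless_sym_def trace_lin transpose_lin matrix_transpose_mul T)
  have "X \<bullet> M = 0" using crit M0 by (simp add: matrix_critical_def X_def inner_diff_left)
  then have "M \<bullet> M = 0" using mat1_inner_traceless_sym[OF M0] by (simp add: M_def inner_diff_left)
  then have X: "X = (trace X / 8) *\<^sub>R mat 1" by (simp add: M_def)
  define s where "s = sqrt (B \<bullet> B) / sqrt 14"
  have s: "s > 0" using B(2) by (simp add: s_def)
  have BB: "B \<bullet> B = 14 * s\<^sup>2" by (simp add: s_def power_divide)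
  have r: "sqrt (B \<bullet> B) = sqrt 14 * s" by (simp add: s_def)
  define c where "c = trace X / 8"
  have Xc: "(3 * (sqrt 14 * s)) *\<^sub>R B - sqrt 14 *\<^sub>R (B ** B) = c *\<^sub>R mat 1"
    using X unfolding c_def[symmetric] unfolding X_def r .
  define m where "m = - c / sqrt 14"
  have "sqrt 14 *\<^sub>R (B ** B) = (3 * (sqrt 14 * s)) *\<^sub>R B - c *\<^sub>R mat 1"
    unfolding Xc[symmetric] by simp
  also have "\<dots> = sqrt 14 *\<^sub>R ((3 * s) *\<^sub>R B + m *\<^sub>R mat 1)"
    by (simp add: m_def algebra_simps)
  finally have "sqrt 14 *\<^sub>R (B ** B) = sqrt 14 *\<^sub>R ((3 * s) *\<^sub>R B + m *\<^sub>R mat 1)" .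
  then have B2: "B ** B = (3 * s) *\<^sub>R B + m *\<^sub>R mat 1" by (simp only: scaleR_cancel_left) simp
  have "14 * s\<^sup>2 = trace (B ** B)" using BB inner_matrix_sym[OF T(1), of B] by simp
  also have "\<dots> = 8 * m" by (simp add: B2 trace_lin T)
  finally have m: "m = 7 * s\<^sup>2 / 4" by simp
  define P where "P = (1 / (4 * s)) *\<^sub>R (B + (s / 2) *\<^sub>R mat 1)"
  have sqr: "(B + h *\<^sub>R mat 1) ** (B + h *\<^sub>R mat 1) = B ** B + (h + h) *\<^sub>R B + (h * h) *\<^sub>R mat 1" for h
    by (simp only: mm_lin scaleR_add_left matrix_mul_lid matrix_mul_rid scaleR_add_right scaleR_scaleR) (simp add: ac_simps)
  have "P ** P = (1 / (4 * s) * (1 / (4 * s))) *\<^sub>R (B ** B + (s / 2 + s / 2) *\<^sub>R B + (s / 2 * (s / 2)) *\<^sub>R mat 1)"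
    by (simp only: P_def mm.scaleR_left mm.scaleR_right sqr scaleR_scaleR)
  also have "B ** B + (s / 2 + s / 2) *\<^sub>R B + (s / 2 * (s / 2)) *\<^sub>R mat 1
      = (3 * s + (s / 2 + s / 2)) *\<^sub>R B + (m + s / 2 * (s / 2)) *\<^sub>R mat 1"
    by (simp only: B2 scaleR_add_left) (simp only: ac_simps)
  also have "3 * s + (s / 2 + s / 2) = 4 * s" by simp
  also have "m + s / 2 * (s / 2) = 4 * s * (s / 2)" by (simp add: m power2_eq_square)
  also have "(1 / (4 * s) * (1 / (4 * s))) *\<^sub>R ((4 * s) *\<^sub>R B + (4 * s * (s / 2)) *\<^sub>R mat 1) = P"
    using s by (simp add: P_def scaleR_add_right)
  finally have "P ** P = P" .
  moreover have "transpose P = P" by (simp add: P_def transpose_lin T)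
  moreover have "trace P = 1" using s by (simp add: P_def trace_lin T)
  ultimately obtain v where v: "norm v = 1" "P = outer v" using projection_rank_one by blast
  have "B = spinor_matrix (4 * s) v"
    using s by (simp add: spinor_matrix_def v(2)[symmetric] P_def algebra_simps)
  then show ?thesis using that[of "4 * s" v] s v by simp
qed

lemma spinor_matrix_critical:
  assumes "t > 0" "norm v = 1"
  shows "matrix_critical (spinor_matrix t v)" "matrix_potential (spinor_matrix t v) = 0"
proof -
  let ?B = "spinor_matrix t v"
  have vv: "v \<bullet> v = 1" using assms(2) by (simp add: norm_eq_1)
  have oo: "outer v \<bullet> outer v = 1"
    by (simp add: inner_matrix_sym transpose_outer outer_mult_outer vv trace_outer)
  have om: "outer v \<bullet> mat 1 = 1" "mat 1 \<bullet> outer v = 1" "mat 1 \<bullet> (mat 1 :: mat8) = 8"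
    by (simp_all add: inner_matrix transpose_outer trace_outer vv)
  have BB: "?B \<bullet> ?B = 7 / 8 * t\<^sup>2"
    by (simp add: spinor_matrix_def inner_diff_left inner_diff_right oo om power2_eq_square)
  have B2: "?B ** ?B = t\<^sup>2 *\<^sub>R ((3/4) *\<^sub>R outer v + (1/64) *\<^sub>R mat 1)"
  proof -
    have "?B ** ?B = t\<^sup>2 *\<^sub>R ((1 - 1/8 - 1/8) *\<^sub>R outer v + (1/64) *\<^sub>R mat 1)"
      unfolding scaleR_diff_left by (simp add: spinor_matrix_def mm_lin outer_mult_outer vv power2_eq_square algebra_simps)
    then show ?thesis by simp
  qed
  have sq: "sqrt (?B \<bullet> ?B) = sqrt 14 / 4 * t"
    by (rule real_sqrt_unique) (use assms(1) in \<open>simp_all add: BB power_mult_distrib power_divide\<close>)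
  show "matrix_critical ?B"
    unfolding matrix_critical_def
  proof
    fix C :: mat8 assume "C \<in> traceless_sym"
    then have m: "mat 1 \<bullet> C = 0" by (rule mat1_inner_traceless_sym)
    then have "?B \<bullet> C = t * (outer v \<bullet> C)"
      by (simp add: spinor_matrix_def inner_diff_left)
    moreover have "(?B ** ?B) \<bullet> C = 3/4 * t\<^sup>2 * (outer v \<bullet> C)"
      unfolding B2 using m by (simp add: inner_add_left)
    ultimately show "3 * sqrt (?B \<bullet> ?B) * (?B \<bullet> C) = sqrt 14 * ((?B ** ?B) \<bullet> C)"
      unfolding sq by (simp add: power2_eq_square)
  qed
  have "(?B \<bullet> ?B) powr (3 / 2) = (sqrt (?B \<bullet> ?B)) ^ 3"
  proof -
    have "?B \<bullet> ?B > 0" using assms(1) by (simp add: BB)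
    then show ?thesis by (simp add: powr_half_sqrt[symmetric] powr_powr flip: powr_numeral)
  qed
  also have "\<dots> = 7 / 32 * sqrt 14 * t ^ 3" unfolding sq by (simp add: power3_eq_cube)
  finally have "(?B \<bullet> ?B) powr (3 / 2) = 7 / 32 * sqrt 14 * t ^ 3" .
  moreover have "(?B ** ?B) \<bullet> ?B = 21 / 32 * t ^ 3"
    unfolding B2 by (simp add: spinor_matrix_def inner_diff_left inner_diff_right inner_add_left oo om
        power2_eq_square power3_eq_cube)
  ultimately show "matrix_potential ?B = 0" unfolding matrix_potential_def by (simp only:) simp
qed

section \<open>Exterior products of covectors\<close>

lemma nths_single: "m < length xs \<Longrightarrow> nths xs {m} = [xs ! m]"
proof (induction xs arbitrary: m)
  case (Cons x xs)
  show ?case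
  proof (cases m)
    case 0
    then show ?thesis by (simp add: nths_Cons)
  next
    case (Suc k)
    then have "{j. Suc j \<in> {m}} = {k}" by auto
    then show ?thesis using Suc Cons by (simp add: nths_Cons)
  qed
qed simp

lemma nths_omit: "m < length xs \<Longrightarrow> nths xs ({..<length xs} - {m}) = take m xs @ drop (Suc m) xs"
proof (induction xs arbitrary: m)
  case (Cons x xs)
  show ?case
  proof (cases m)
    case 0
    then have "{j. Suc j \<in> {..<length (x # xs)} - {m}} = {..<length xs}" by auto
    then show ?thesis using 0 unfolding nths_Cons by (simp add: nths_all)
  next
    case (Suc k)
    then have "{j. Suc j \<in> {..<length (x # xs)} - {m}} = {..<length xs} - {k}" by auto
    then show ?thesis using Suc Cons unfolding nths_Cons by simp
  qed
qed simp

text \<open>The shuffles with one position on the left: expansion along the first factor.\<close>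

lemma covector_wedge:
  "(covector i \<and>\<^sub>f \<omega>) xs = (\<Sum>m<length xs. (- 1) ^ m * xs ! m $ i * \<omega> (take m xs @ drop (Suc m) xs))"
proof -
  define n where "n = length xs"
  define T where "T S = (-1) ^ card {(i, j). i \<in> S \<and> j \<in> {..<n} - S \<and> j < i}
       * covector i (nths xs S) * \<omega> (nths xs ({..<n} - S))" for S
  have "(covector i \<and>\<^sub>f \<omega>) xs = (\<Sum>S\<in>Pow {..<n}. T S)"
    by (simp add: wedge_def T_def n_def)
  also have "\<dots> = (\<Sum>S\<in>(\<lambda>m. {m}) ` {..<n}. T S)"
  proof (rule sum.mono_neutral_right)
    show "\<forall>S\<in>Pow {..<n} - (\<lambda>m. {m}) ` {..<n}. T S = 0"
    proof
      fix S assume S: "S \<in> Pow {..<n} - (\<lambda>m. {m}) ` {..<n}"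
      have "card S \<noteq> 1"
      proof
        assume "card S = 1"
        then obtain m where "S = {m}" by (auto simp: card_1_singleton_iff)
        then show False using S by auto
      qed
      moreover have "{i. i < length xs \<and> i \<in> S} = S" using S by (auto simp: n_def)
      ultimately have "length (nths xs S) \<noteq> 1" by (simp only: length_nths) simp
      then have "covector i (nths xs S) = 0" by (auto simp: covector_def split: list.splits)
      then show "T S = 0" by (simp add: T_def)
    qed
  qed auto
  also have "\<dots> = (\<Sum>m<n. T {m})" by (subst sum.reindex) auto
  also have "\<dots> = (\<Sum>m<n. (- 1) ^ m * xs ! m $ i * \<omega> (take m xs @ drop (Suc m) xs))"
  proof (rule sum.cong[OF refl])
    fix m assume "m \<in> {..<n}"
    then have m: "m < length xs" by (simp add: n_def)
    have "{(i, j). i \<in> {m} \<and> j \<in> {..<n} - {m} \<and> j < i} = {m} \<times> {..<m}" using m by (auto simp: n_def)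
    then have "card {(i, j). i \<in> {m} \<and> j \<in> {..<n} - {m} \<and> j < i} = m" by (simp only:) (simp add: card_cartesian_product)
    then show "T {m} = (- 1) ^ m * xs ! m $ i * \<omega> (take m xs @ drop (Suc m) xs)"
      using m unfolding T_def by (simp only: n_def nths_omit nths_single) (simp add: covector_def)
  qed
  finally show ?thesis by (simp add: n_def)
qed

lemma kforms_move:
  assumes "\<omega> \<in> kforms k"
  shows "\<omega> (us @ x # vs @ ws) = (- 1) ^ length vs * \<omega> (us @ vs @ x # ws)"
proof (induction vs arbitrary: us)
  case (Cons v vs)
  have "\<omega> (us @ x # v # (vs @ ws)) = - \<omega> (us @ v # x # (vs @ ws))" by (rule kforms_swap[OF assms])
  with Cons[of "us @ [v]"] show ?case by simp
qed simp

text \<open>If two arguments agree, all terms of the expansion keep both of them except two, which differ by moving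
one argument past those between the two positions, and cancel.\<close>

lemma covector_wedge_kforms:
  assumes w: "\<omega> \<in> kforms k"
  shows "covector i \<and>\<^sub>f \<omega> \<in> kforms (Suc k)"
  unfolding kforms_iff
proof (intro conjI allI impI)
  fix xs :: "(real^8) list"
  show "(covector i \<and>\<^sub>f \<omega>) xs = 0" if "length xs \<noteq> Suc k"
    unfolding covector_wedge using that by (intro sum.neutral) (auto simp: kforms_length[OF w])
  show "(covector i \<and>\<^sub>f \<omega>) xs = 0" if nd: "\<not> distinct xs"
  proof -
    obtain us vs ws x where xs: "xs = us @ x # vs @ x # ws"
      using not_distinct_decomp[OF nd] by auto
    define a where "a = length us"
    define b where "b = length us + Suc (length vs)"
    define f where "f m = (- 1) ^ m * xs ! m $ i * \<omega> (take m xs @ drop (Suc m) xs)" for m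
    have ab: "a < length xs" "b < length xs" "a \<noteq> b" by (auto simp: xs a_def b_def)
    have f0: "f m = 0" if "m < length xs" "m \<noteq> a" "m \<noteq> b" for m
    proof -
      have "\<not> distinct (take m xs @ drop (Suc m) xs)"
      proof -
        have xa: "xs ! a = x" and xb: "xs ! b = x" by (auto simp: xs a_def b_def nth_append)
        \<comment> \<open>The position of the argument number \<open>p\<close> after omission of the argument number \<open>m\<close>.\<close>
        let ?g = "\<lambda>p. if p < m then p else p - 1"
        have nth: "(take m xs @ drop (Suc m) xs) ! (?g p) = xs ! p" if "p < length xs" "p \<noteq> m" for p
          using that \<open>m < length xs\<close> by (auto simp: nth_append min_def)
        have eq: "(take m xs @ drop (Suc m) xs) ! (?g a) = (take m xs @ drop (Suc m) xs) ! (?g b)"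
          using nth[OF ab(1)] nth[OF ab(2)] that xa xb by (simp only:)
        have "?g a < length (take m xs @ drop (Suc m) xs)" "?g b < length (take m xs @ drop (Suc m) xs)" "?g a \<noteq> ?g b"
          using ab that by auto
        then show ?thesis using eq nth_eq_iff_index_eq by blast
      qed
      then show ?thesis by (simp add: f_def kforms_distinct[OF w])
    qed
    have fa: "f a = (- 1) ^ a * x $ i * \<omega> (us @ vs @ x # ws)"
      by (simp add: f_def a_def xs)
    have fb: "f b = (- 1) ^ b * x $ i * \<omega> (us @ x # vs @ ws)"
      by (simp add: f_def b_def xs nth_append)
    have "(covector i \<and>\<^sub>f \<omega>) xs = (\<Sum>m<length xs. f m)" unfolding covector_wedge f_def ..
    also have "\<dots> = (\<Sum>m\<in>{a, b}. f m)"
      by (rule sum.mono_neutral_right) (use ab f0 in auto)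
    also have "\<dots> = f a + f b" using ab by simp
    also have "\<dots> = 0"
      unfolding fa fb kforms_move[OF w, of us x vs ws]
      by (simp add: a_def b_def power_add mult.commute flip: power_mult_distrib)
    finally show ?thesis .
  qed
next
  show "multilin (Suc k) (covector i \<and>\<^sub>f \<omega>)"
  proof (rule multilinI)
    fix us vs :: "(real^8) list" assume l: "length us + Suc (length vs) = Suc k"
    have L: "linear (\<lambda>v. (us @ v # vs) ! m $ i * \<omega> (take m (us @ v # vs) @ drop (Suc m) (us @ v # vs)))"
      if "m < length us + Suc (length vs)" for m
    proof -
      consider "m < length us" | "m = length us" | "m > length us" by linarith
      then show ?thesis
      proof cases
        case 1
        then have "linear (\<lambda>v. \<omega> ((take m us @ drop (Suc m) us) @ v # vs))"
          using l by (intro multilinD[OF kforms_multilin[OF w]]) simp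
        then show ?thesis using 1 by (simp add: nth_append linear_mult_const)
      next
        case 2
        have "linear (\<lambda>v::real^8. v $ i)" by (auto intro!: linearI)
        then show ?thesis using 2 by (simp add: linear_mult_const)
      next
        case 3
        then obtain p where p: "m = Suc (length us + p)" by (metis less_iff_Suc_add)
        have "linear (\<lambda>v. \<omega> (us @ v # (take p vs @ drop (Suc p) vs)))"
          using l p that by (intro multilinD[OF kforms_multilin[OF w]]) (simp add: min_def)
        then show ?thesis using p by (simp add: nth_append linear_mult_const)
      qed
    qed
    have "(covector i \<and>\<^sub>f \<omega>) (us @ v # vs) = (\<Sum>m<length us + Suc (length vs). (- 1) ^ m *
        ((us @ v # vs) ! m $ i * \<omega> (take m (us @ v # vs) @ drop (Suc m) (us @ v # vs))))" for v
      unfolding covector_wedge by (simp only: length_append length_Cons mult.assoc)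
    then show "linear (\<lambda>v. (covector i \<and>\<^sub>f \<omega>) (us @ v # vs))"
      by (simp only:) (intro linear_sum_fun linear_mult_const(2) L, simp)
  qed
qed

lemma covectors_kforms: "covectors is \<in> kforms (length is)"
proof (induction "is")
  case Nil
  show ?case by (auto simp: covectors_def kforms_iff multilin_def)
next
  case (Cons i "is")
  then show ?case using covector_wedge_kforms by (simp add: covectors_def)
qed

lemma covectors_Cons: "covectors (i # is) xs = (\<Sum>m<length xs. (- 1) ^ m * xs ! m $ i * covectors is (take m xs @
    drop (Suc m) xs))"
  unfolding covectors_def by (simp add: covector_wedge)

lemma covectors_missing:
  "i \<in> set is \<Longrightarrow> i \<notin> set js \<Longrightarrow> covectors is (map ax js) = 0"
proof (induction "is" arbitrary: js)
  case (Cons k "is")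
  show ?case unfolding covectors_Cons
  proof (rule sum.neutral, rule ballI)
    fix m assume m: "m \<in> {..<length (map ax js)}"
    show "(- 1) ^ m * map ax js ! m $ k * covectors is (take m (map ax js) @ drop (Suc m) (map ax js)) = 0"
    proof (cases "i = k")
      case True
      then have "js ! m \<noteq> k" using m Cons.prems by auto
      then show ?thesis using m by (simp add: axis_def)
    next
      case False
      have "covectors is (map ax (take m js @ drop (Suc m) js)) = 0"
        using Cons.prems False by (intro Cons.IH) (auto dest: in_set_takeD in_set_dropD)
      then show ?thesis by (simp add: take_map drop_map)
    qed
  qed
qed simp

lemma covectors_self: "distinct is \<Longrightarrow> covectors is (map ax is) = 1"
proof (induction "is")
  case Nil
  then show ?case by (simp add: covectors_def)
next
  case (Cons i "is")
  have "covectors (i # is) (map ax (i # is)) = (\<Sum>m\<in>{0}. (- 1) ^ m * map ax (i # is) ! m $ i 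
      * covectors is (take m (map ax (i # is)) @ drop (Suc m) (map ax (i # is))))"
    unfolding covectors_Cons
  proof (rule sum.mono_neutral_right)
    show "\<forall>m\<in>{..<length (map ax (i # is))} - {0}. (- 1) ^ m * map ax (i # is) ! m $ i 
      * covectors is (take m (map ax (i # is)) @ drop (Suc m) (map ax (i # is))) = 0"
    proof
      fix m assume m: "m \<in> {..<length (map ax (i # is))} - {0}"
      then obtain p where p: "m = Suc p" "p < length is" by (cases m) auto
      then have "is ! p \<noteq> i" using Cons.prems by auto
      then show "(- 1) ^ m * map ax (i # is) ! m $ i 
      * covectors is (take m (map ax (i # is)) @ drop (Suc m) (map ax (i # is))) = 0" using p by (simp add: axis_def)
    qed
  qed auto
  then show ?case using Cons by simp
qed

lemma kforms_add: "\<alpha> \<in> kforms k \<Longrightarrow> \<beta> \<in> kforms k \<Longrightarrow> \<alpha> + \<beta> \<in> kforms k"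
  and kforms_diff: "\<alpha> \<in> kforms k \<Longrightarrow> \<beta> \<in> kforms k \<Longrightarrow> \<alpha> - \<beta> \<in> kforms k"
  by (auto simp: kforms_def linear_add_fun linear_diff_fun)

lemma kforms_scale: "\<alpha> \<in> kforms k \<Longrightarrow> (\<lambda>xs. c * \<alpha> xs) \<in> kforms k"
  by (auto simp: kforms_def linear_mult_const)

lemma vol0_kforms: "vol0 \<in> kforms 8" and vol0_std: "vol0 (map ax std) = 1"
  using covectors_kforms[of std] covectors_self[OF distinct_std] by (simp_all add: vol0_def numeral_eq_Suc)

lemma Phi0_kforms: "Phi0 \<in> kforms 4"
proof -
  have "covectors [i, j, k, l] \<in> kforms 4" for i j k l
    using covectors_kforms[of "[i, j, k, l]"] by (simp add: numeral_eq_Suc)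
  then show ?thesis unfolding Phi0_def by (intro kforms_add kforms_diff)
qed

lemma spin7_model_kforms: "spin7_model \<in> kforms 4"
  using kforms_scale[OF Phi0_kforms, of "- 1"] by (simp add: spin7_model_def fun_Compl_def)

section \<open>The model form is the square of a spinor\<close>

lemma frame_ax: "frame ax"
  by (simp add: frame_def inner_axis_axis)

lemma coords_ax: "coords ax x = x"
  by (simp add: coords_def vec_eq_iff inner_axis)

lemma oct_mult_vec8:
  "oct_mult (vec8 a1 a2 a3 a4 a5 a6 a7 a8) (vec8 b1 b2 b3 b4 b5 b6 b7 b8) = vec8
    (a1 * b1 - a2 * b2 - a3 * b3 - a4 * b4 - a5 * b5 - a6 * b6 - a7 * b7 - a8 * b8)
    (a1 * b2 + a2 * b1 - a3 * b4 + a4 * b3 - a5 * b6 + a6 * b5 - a7 * b8 + a8 * b7)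
    (a1 * b3 + a2 * b4 + a3 * b1 - a4 * b2 - a5 * b7 + a6 * b8 + a7 * b5 - a8 * b6)
    (a1 * b4 - a2 * b3 + a3 * b2 + a4 * b1 + a5 * b8 + a6 * b7 - a7 * b6 - a8 * b5)
    (a1 * b5 + a2 * b6 + a3 * b7 - a4 * b8 + a5 * b1 - a6 * b2 - a7 * b3 + a8 * b4)
    (a1 * b6 - a2 * b5 - a3 * b8 - a4 * b7 + a5 * b2 + a6 * b1 + a7 * b4 + a8 * b3)
    (a1 * b7 + a2 * b8 - a3 * b5 + a4 * b6 + a5 * b3 - a6 * b4 + a7 * b1 - a8 * b2)
    (a1 * b8 - a2 * b7 + a3 * b6 + a4 * b5 - a5 * b4 - a6 * b3 + a7 * b2 + a8 * b1)"
  by (simp add: vec_eq_8 oct_mult_nth)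

lemma inner_vec8: "vec8 a1 a2 a3 a4 a5 a6 a7 a8 \<bullet> vec8 b1 b2 b3 b4 b5 b6 b7 b8 =
    a1 * b1 + a2 * b2 + a3 * b3 + a4 * b4 + a5 * b5 + a6 * b6 + a7 * b7 + a8 * b8"
  by (simp add: inner_vec_def sum_8)

lemma ax_vec8:
  "ax 1 = vec8 1 0 0 0 0 0 0 0" "ax 2 = vec8 0 1 0 0 0 0 0 0" "ax 3 = vec8 0 0 1 0 0 0 0 0" "ax 4 = vec8 0 0 0 1 0 0 0 0"
  "ax 5 = vec8 0 0 0 0 1 0 0 0" "ax 6 = vec8 0 0 0 0 0 1 0 0" "ax 7 = vec8 0 0 0 0 0 0 1 0" "ax 8 = vec8 0 0 0 0 0 0 0 1"
  by (simp_all add: vec_eq_8 axis_def)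

lemma oct_mult_ax1: "oct_mult x (ax 1) = x"
  by (simp add: vec_eq_8 oct_mult_nth axis_def)

lemma trace_outer_mult: "trace (outer v ** A) = v \<bullet> (A *v v)"
proof -
  have "trace (outer v ** A) = (\<Sum>i\<in>UNIV. \<Sum>j\<in>UNIV. v $ i * v $ j * A $ j $ i)"
    by (simp add: trace_mult outer_def)
  also have "\<dots> = (\<Sum>j\<in>UNIV. \<Sum>i\<in>UNIV. v $ i * v $ j * A $ j $ i)" by (rule sum.swap)
  finally show ?thesis
    by (simp add: inner_vec_def matrix_vector_mult_def sum_distrib_left mult_ac)
qed

lemma inner_mult_vec: "x \<bullet> (A *v y) = (transpose A *v x) \<bullet> (y :: real^8)"
  by (metis dot_lmul_matrix transpose_matrix_vector)

text \<open>The scalar part of \<open>v v\<^sup>T - 1/8\<close> does not contribute on distinct indices. The skew \<open>\<gamma>\<^sub>j\<close> and \<open>\<gamma>\<^sub>k\<close> are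
moved to the two sides of the scalar product, and \<open>\<gamma>\<^sub>x e\<^sub>1 = x\<close>.\<close>

lemma matrix_form_model_value:
  assumes "distinct [i, j, k, l]" "j \<noteq> 1" "k \<noteq> 1"
  shows "matrix_form ax (spinor_matrix 1 (ax 1)) (map ax [i, j, k, l]) = oct_mult (ax j) (ax i) \<bullet> oct_mult (ax k) (ax l)"
proof -
  have "trace (gword [i, j, k, l]) = 0"
  proof -
    have "card (set [i,j,k,l]) \<noteq> CARD(8)" using assms(1) distinct_card[of "[i,j,k,l]"] by simp
    then obtain p where "p \<notin> set [i,j,k,l]" by (metis UNIV_eq_I)
    then show ?thesis by (intro trace_gword_eq_0[of _ p i]) (use assms in auto)
  qed
  then have "trace (spinor_matrix 1 (ax 1) ** gword [i, j, k, l]) = ax 1 \<bullet> (gword [i, j, k, l] *v ax 1)"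
    by (simp add: spinor_matrix_def mm_lin trace_lin trace_outer_mult del: gam.word.simps)
  also have "\<dots> = ax 1 \<bullet> (transpose (gam (ax i)) *v (gam (ax j) *v (transpose (gam (ax k)) *v (gam (ax l) *v ax 1))))"
    by (simp add: matrix_vector_mul_assoc matrix_mul_assoc)
  also have "\<dots> = (transpose (gam (ax j)) *v (gam (ax i) *v ax 1)) \<bullet> (transpose (gam (ax k)) *v (gam (ax l) *v ax 1))"
    by (simp only: inner_mult_vec transpose_transpose)
  also have "\<dots> = oct_mult (ax j) (ax i) \<bullet> oct_mult (ax k) (ax l)"
  proof -
    have *: "transpose (gam (ax q)) *v x = - oct_mult (ax q) x" if "q \<noteq> 1" for q x
    proof -
      have "(- gam (ax q)) *v x = - (gam (ax q) *v x)"
        by (simp add: vec_eq_iff matrix_vector_mult_def sum_negf)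
      then show ?thesis unfolding transpose_gam_skew[OF that] by (simp add: gam_mult_vec)
    qed
    show ?thesis unfolding *[OF assms(2)] *[OF assms(3)] gam_mult_vec oct_mult_ax1 by simp
  qed
  finally show ?thesis using matrix_form_frame[OF frame_ax, of "[i, j, k, l]"] by simp
qed

lemma covectors_0: "\<exists>p\<in>set is. p \<notin> set js \<Longrightarrow> covectors is (map ax js) = 0"
  using covectors_missing by blast

text \<open>Alternating functions of four indices are determined by the \<open>70\<close> increasing index lists.\<close>

lemma distinct_sorted_rep:
  fixes "is" :: "8 list"
  assumes "distinct is" "length is = 4"
  obtains a b c d where "a < b" "b < c" "c < d" "d < 8" "mset is = mset [std ! a, std ! b, std ! c, std ! d]"
proof -
  define N where "N = {n. n < 8 \<and> std ! n \<in> set is}"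
  have l: "length std = 8" by simp
  have inj: "inj_on ((!) std) {..<8}"
    using inj_on_nth[OF distinct_std, of "{..<8}"] l by simp
  have im: "(!) std ` N = set is"
  proof
    show "set is \<subseteq> (!) std ` N"
    proof
      fix i assume "i \<in> set is"
      moreover have "i \<in> set std" using UNIV_8 by simp
      then obtain n where "n < length std" "std ! n = i" by (metis in_set_conv_nth)
      ultimately show "i \<in> (!) std ` N" unfolding N_def l by blast
    qed
  qed (auto simp: N_def)
  have fN: "finite N" by (simp add: N_def)
  have injN: "inj_on ((!) std) N" by (rule inj_on_subset[OF inj]) (auto simp: N_def)
  have cN: "card N = 4" using card_image[OF injN] im assms by (simp add: distinct_card)
  define ns where "ns = sorted_list_of_set N"
  have ns: "set ns = N" "sorted_wrt (<) ns" "length ns = 4" "distinct ns"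
    using fN cN by (simp_all add: ns_def)
  then obtain a b c d where abcd: "ns = [a, b, c, d]" by (auto simp: length_4)
  have "mset is = mset (map ((!) std) ns)"
  proof (rule set_eq_iff_mset_eq_distinct[THEN iffD1])
    show "distinct (map ((!) std) ns)" using ns(1,4) injN by (simp add: distinct_map)
    show "set is = set (map ((!) std) ns)" using im ns(1) by simp
  qed (rule assms)
  moreover have "d < 8" using ns(1) abcd by (auto simp: N_def)
  ultimately show ?thesis using that[of a b c d] ns(2) abcd by simp
qed

definition component :: "8 list \<Rightarrow> 8 list \<Rightarrow> real" where
  "component is js = covectors is (map ax js)"

lemma component_eval:
  "\<not> (a \<in> {i,j,k,l} \<and> b \<in> {i,j,k,l} \<and> c \<in> {i,j,k,l} \<and> d \<in> {i,j,k,l}) \<Longrightarrow> component [a,b,c,d] [i,j,k,l] = 0"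
  "distinct [a,b,c,d] \<Longrightarrow> component [a,b,c,d] [a,b,c,d] = 1"
  using covectors_0[of "[a,b,c,d]" "[i,j,k,l]"] covectors_self[of "[a,b,c,d]"]
  unfolding component_def by auto

lemma spin7_model_component: "spin7_model (map ax js) = - (
     component [1,2,3,4] js + component [1,2,5,6] js + component [1,2,7,8] js + component [1,3,5,7] js
     - component [1,3,6,8] js - component [1,4,5,8] js - component [1,4,6,7] js + component [5,6,7,8] js
     + component [3,4,7,8] js + component [3,4,5,6] js + component [2,4,6,8] js - component [2,4,5,7] js
     - component [2,3,5,8] js - component [2,3,6,7] js)"
  by (simp add: spin7_model_def Phi0_def component_def)

text \<open>The finite check that ties the octonions to the Cayley form: the \<open>70\<close> increasing components agree.\<close>

lemma model_table:
  "\<forall>d<8. \<forall>c<d. \<forall>b<c. \<forall>a<b. spin7_model (map ax [std ! a, std ! b, std ! c, std ! d]) =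
     oct_mult (ax (std ! b)) (ax (std ! a)) \<bullet> oct_mult (ax (std ! c)) (ax (std ! d))"
  unfolding spin7_model_component
  by (simp add: All_less_Suc numeral_eq_Suc component_eval ax_vec8 oct_mult_vec8 inner_vec8)

lemma std_nth_neq_1: "0 < n \<Longrightarrow> n < 8 \<Longrightarrow> std ! n \<noteq> 1"
  using nth_eq_iff_index_eq[OF distinct_std, of n 0] by simp

text \<open>Both sides are alternating and multilinear, so the table of increasing components decides.\<close>

lemma spin7_model_matrix_form: "spin7_model = matrix_form ax (spinor_matrix 1 (ax 1))"
proof
  fix xs :: "(real^8) list"
  have B: "spinor_matrix 1 (ax 1) \<in> traceless_sym" by (rule spinor_matrix_traceless_sym) simp
  note k = matrix_form_kforms[OF B, of ax]
  show "spin7_model xs = matrix_form ax (spinor_matrix 1 (ax 1)) xs"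
  proof (cases "length xs = 4")
    case True
    show ?thesis
    proof (rule multilin_eqI[OF frame_ax kforms_multilin[OF spin7_model_kforms] matrix_form_multilin _ True])
      fix "is" :: "8 list" assume l: "length is = 4"
      show "spin7_model (map ax is) = matrix_form ax (spinor_matrix 1 (ax 1)) (map ax is)"
      proof (cases "distinct is")
        case True
        obtain a b c d where abcd: "a < b" "b < c" "c < d" "d < 8" "mset is = mset [std ! a, std ! b, std ! c, std ! d]"
          by (rule distinct_sorted_rep[OF True l])
        have ds: "distinct [std ! a, std ! b, std ! c, std ! d]"
          using mset_eq_imp_distinct_iff[OF abcd(5)] True by simp
        have n1: "std ! b \<noteq> 1" "std ! c \<noteq> 1"
          by (rule std_nth_neq_1; use abcd in linarith)+
        show ?thesis
        proof (rule alternating_agree[of "\<lambda>is. spin7_model (map ax is)"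
            "\<lambda>is. matrix_form ax (spinor_matrix 1 (ax 1)) (map ax is)", OF _ _ _ abcd(5)])
          show "spin7_model (map ax [std ! a, std ! b, std ! c, std ! d])
              = matrix_form ax (spinor_matrix 1 (ax 1)) (map ax [std ! a, std ! b, std ! c, std ! d])"
            unfolding matrix_form_model_value[OF ds n1] using model_table abcd(1-4) by blast
        qed (rule kforms_map_swap[OF spin7_model_kforms], rule kforms_map_swap[OF k])
      next
        case False
        then show ?thesis using kforms_distinct[OF k, of "map ax is"] kforms_distinct[OF spin7_model_kforms, of "map ax is"]
          by (simp add: distinct_map)
      qed
    qed
  qed (simp add: kforms_length[OF spin7_model_kforms] matrix_form_length)
qed

section \<open>Rotations act transitively on unit spinors\<close>

lemma qform_scale: "qform B (s *\<^sub>R x) (s *\<^sub>R y) (s *\<^sub>R z) (s *\<^sub>R w) = s ^ 4 * qform B x y z w"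
  by (simp add: qform_def gam.g_scaleR transpose_lin mm_lin trace_lin power4_eq_xxxx)

lemma qform_spinor_scale: "qform (spinor_matrix t v) x y z w = t * qform (spinor_matrix 1 v) x y z w"
  by (simp add: spinor_matrix_def linear_cmul[OF qform_linear_matrix])

lemma multilin_scale: "multilin k \<alpha> \<Longrightarrow> length xs = k \<Longrightarrow> \<alpha> (map (\<lambda>x. s *\<^sub>R x) xs) = s ^ k * \<alpha> xs"
proof (induction k arbitrary: \<alpha> xs)
  case (Suc k)
  then obtain x ys where xs: "xs = x # ys" "length ys = k" by (auto simp: length_Suc_conv)
  have L: "linear (\<lambda>v. \<alpha> (v # map (\<lambda>x. s *\<^sub>R x) ys))"
    using multilinD[OF Suc.prems(1), of "[]" "map (\<lambda>x. s *\<^sub>R x) ys"] xs by simp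
  show ?case
    using Suc.IH[OF multilin_Cons[OF Suc.prems(1), of x] xs(2)] linear_cmul[OF L, of s x] xs by simp
qed simp

lemma pullback_kforms:
  assumes "linear f" "inj f" "\<alpha> \<in> kforms k"
  shows "pullback f \<alpha> \<in> kforms k"
  unfolding kforms_iff
proof (intro conjI allI impI)
  show "pullback f \<alpha> xs = 0" if "length xs \<noteq> k" for xs
    using that kforms_length[OF assms(3)] by (simp add: pullback_def)
  show "pullback f \<alpha> xs = 0" if "\<not> distinct xs" for xs
    using that kforms_distinct[OF assms(3), of "map f xs"] assms(2) by (simp add: pullback_def distinct_map inj_on_subset)
  show "multilin k (pullback f \<alpha>)"
  proof (rule multilinI)
    fix us vs :: "'a list" assume "length us + Suc (length vs) = k"
    then have "linear (\<lambda>v. \<alpha> (map f us @ v # map f vs))"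
      using multilinD[OF kforms_multilin[OF assms(3)]] by simp
    from linear_compose[OF assms(1) this] show "linear (\<lambda>v. pullback f \<alpha> (us @ v # vs))"
      by (simp add: pullback_def comp_def)
  qed
qed

text \<open>Forms of top degree are determined by one value on one frame, so they are proportional.\<close>

lemma top_form_zero:
  assumes "\<alpha> \<in> kforms 8" "frame e" "\<alpha> (map e std) = 0"
  shows "\<alpha> xs = 0"
proof (cases "length xs = 8")
  case True
  have z: "multilin 8 (\<lambda>_. 0)" by (simp add: multilin_def linear_zero)
  show ?thesis
  proof (rule multilin_eqI[OF assms(2) kforms_multilin[OF assms(1)] z _ True])
    fix "is" :: "8 list" assume l: "length is = 8"
    show "\<alpha> (map e is) = 0"
    proof (cases "distinct is")
      case True
      show ?thesis
        by (rule alternating_agree[of "\<lambda>is. \<alpha> (map e is)" "\<lambda>is. 0" std "is"])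
          (use kforms_map_swap[OF assms(1)] assms(3) True l mset_std in auto)
    next
      case False
      then show ?thesis using kforms_distinct[OF assms(1), of "map e is"] by (simp add: distinct_map)
    qed
  qed
qed (rule kforms_length[OF assms(1)])

lemma top_form_proportional:
  assumes "\<alpha> \<in> kforms 8" "\<beta> \<in> kforms 8" "frame e"
  shows "\<beta> (map e std) * \<alpha> xs = \<alpha> (map e std) * \<beta> xs"
proof -
  have "(\<lambda>xs. \<beta> (map e std) * \<alpha> xs) - (\<lambda>xs. \<alpha> (map e std) * \<beta> xs) \<in> kforms 8"
    by (intro kforms_diff kforms_scale assms)
  from top_form_zero[OF this assms(3), of xs] show ?thesis by simp
qed

definition reflection :: "real^8 \<Rightarrow> real^8 \<Rightarrow> real^8" where
  "reflection v x = x - (2 * (v \<bullet> x)) *\<^sub>R v"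

lemma linear_reflection: "linear (reflection v)"
  by (rule linearI) (simp_all add: reflection_def inner_add_right algebra_simps)

lemma reflection_involution: "norm v = 1 \<Longrightarrow> reflection v (reflection v x) = x"
  by (simp add: reflection_def inner_diff_right norm_eq_1 algebra_simps)

lemma reflection_bij: "norm v = 1 \<Longrightarrow> bij (reflection v)"
  by (rule involuntory_imp_bij) (rule reflection_involution)

lemma reflection_inner: "norm v = 1 \<Longrightarrow> reflection v x \<bullet> reflection v y = x \<bullet> y"
  by (simp add: reflection_def inner_diff_right inner_diff_left norm_eq_1 inner_commute algebra_simps)

lemma frame_with_first:
  assumes "norm (v :: real^8) = 1"
  obtains b where "frame b" "b 1 = v"
proof -
  obtain A where A: "orthogonal_matrix A" "A *v axis 1 1 = v"
    using orthogonal_matrix_exists_basis[OF assms] by blast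
  have "transpose A ** A = mat 1" using A(1) by (simp add: orthogonal_matrix_def)
  then have "(A *v x) \<bullet> (A *v y) = x \<bullet> y" for x y
    by (simp add: inner_mult_vec matrix_vector_mul_assoc del: transpose_matrix_vector)
  then have "frame (\<lambda>i. A *v ax i)" by (simp add: frame_def inner_axis_axis)
  then show ?thesis using that A(2) by blast
qed

text \<open>The factor by which a reflection scales the volume form can be read off in a frame whose first vector is \<open>v\<close>:
there one argument changes its sign.\<close>

lemma vol0_reflection:
  assumes "norm v = 1"
  shows "vol0 (map (reflection v) xs) = - vol0 xs"
proof -
  obtain b where b: "frame b" "b 1 = v" by (rule frame_with_first[OF assms])
  have fix1: "reflection v (b i) = b i" if "i \<noteq> 1" for i
    using frame_inner[OF b(1), of 1 i] that b(2) by (simp add: reflection_def)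
  have flip: "reflection v (b 1) = - b 1"
    using assms b(2) by (simp add: reflection_def norm_eq_1 scaleR_2)
  have "linear (\<lambda>x. vol0 (x # map b [2,3,4,5,6,7,8]))"
    using multilinD[OF kforms_multilin[OF vol0_kforms], of "[]" "map b [2,3,4,5,6,7,8]"] by simp
  from linear_neg[OF this, of "b 1"] have m: "vol0 (map (reflection v) (map b std)) = - vol0 (map b std)"
    by (simp add: fix1 flip)
  have "pullback (reflection v) vol0 \<in> kforms 8"
    by (rule pullback_kforms[OF linear_reflection bij_is_inj[OF reflection_bij[OF assms]] vol0_kforms])
  from top_form_proportional[OF this vol0_kforms b(1), of xs]
  have "vol0 (map b std) * vol0 (map (reflection v) xs) = vol0 (map b std) * (- vol0 xs)"
    by (simp only: pullback_def m mult_minus_left mult_minus_right)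
  moreover have "vol0 (map b std) \<noteq> 0"
    using top_form_zero[OF vol0_kforms b(1), of "map ax std"] vol0_std by (metis zero_neq_one)
  ultimately show ?thesis by (rule mult_left_cancel[THEN iffD1, rotated])
qed

text \<open>The rotation covered by the spin transformation that takes the spinor \<open>e\<^sub>1\<close> to \<open>v\<close>. As \<open>\<gamma>\<^sub>1 = 1\<close>, the vector
\<open>v\<close> of the second reflection is the target spinor itself.\<close>

definition spin_rotation :: "real^8 \<Rightarrow> real^8 \<Rightarrow> real^8" where
  "spin_rotation v x = reflection v (reflection (ax 1) x)"

lemma gam_reflection:
  assumes "norm v = 1"
  shows "gam (reflection v y) = - (gam v ** transpose (gam y) ** gam v)"
proof -
  have "gam v ** transpose (gam y) ** gam v = (2 * (v \<bullet> y)) *\<^sub>R gam v - gam y ** (transpose (gam v) ** gam v)"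
    using arg_cong[OF gam.rel'[of v y], of "\<lambda>M. M ** gam v"] by (simp add: mm_lin matrix_mul_assoc algebra_simps)
  then show ?thesis using assms by (simp add: reflection_def gam.g_diff gam.g_scaleR gam.sq norm_eq_1)
qed

text \<open>The reflection in \<open>v\<close> is \<open>y \<mapsto> - \<gamma>\<^sub>v \<gamma>\<^sub>y\<^sup>T \<gamma>\<^sub>v\<close>, and for \<open>v = e\<^sub>1\<close> it is \<open>y \<mapsto> - \<gamma>\<^sub>y\<^sup>T\<close>.\<close>

lemma gam_spin_rotation:
  assumes "norm v = 1"
  shows "gam (spin_rotation v x) = gam v ** gam x ** gam v"
proof -
  have "gam (reflection (ax 1) x) = - transpose (gam x)"
    by (subst gam_reflection) (simp_all add: gam_1)
  then show ?thesis
    unfolding spin_rotation_def gam_reflection[OF assms] by (simp add: transpose_lin mm_lin)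
qed

lemma outer_conj: "A ** outer v ** transpose A = outer (A *v v)"
proof -
  have "(A ** outer v ** transpose A) $ i $ j = outer (A *v v) $ i $ j" for i j
    by (simp add: matrix_matrix_mult_def matrix_vector_mult_def transpose_def outer_def sum_product
        sum_distrib_left sum_distrib_right mult_ac)
  then show ?thesis by (simp add: vec_eq_iff)
qed

text \<open>Inner factors \<open>\<gamma>\<^sub>v \<gamma>\<^sub>v\<^sup>T\<close> cancel, and the outer ones conjugate the matrix of \<open>e\<^sub>1\<close> into the matrix of
\<open>\<gamma>\<^sub>v e\<^sub>1 = v\<close>.\<close>

lemma qform_spin_rotation:
  assumes "norm v = 1"
  shows "qform (spinor_matrix 1 (ax 1)) (spin_rotation v x) (spin_rotation v y) (spin_rotation v z) (spin_rotation v w)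
    = qform (spinor_matrix 1 v) x y z w"
proof -
  let ?g = "gam v"
  have vv: "v \<bullet> v = 1" using assms by (simp add: norm_eq_1)
  have gg: "transpose ?g ** ?g = mat 1" "?g ** transpose ?g = mat 1" by (simp_all add: gam.sq gam.sq' vv)
  have pair: "transpose (gam (spin_rotation v x)) ** gam (spin_rotation v y)
      = transpose ?g ** (transpose (gam x) ** gam y) ** ?g" for x y
  proof -
    have "transpose (gam (spin_rotation v x)) ** gam (spin_rotation v y)
       = transpose ?g ** transpose (gam x) ** (transpose ?g ** ?g) ** gam y ** ?g"
      by (simp add: gam_spin_rotation[OF assms] matrix_transpose_mul matrix_mul_assoc)
    then show ?thesis by (simp add: gg matrix_mul_assoc)
  qed
  define M where "M = (transpose (gam x) ** gam y) ** (transpose (gam z) ** gam w)"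
  have "(transpose ?g ** (transpose (gam x) ** gam y) ** ?g) ** (transpose ?g ** (transpose (gam z) ** gam w) ** ?g)
     = transpose ?g ** (transpose (gam x) ** gam y) ** (?g ** transpose ?g) ** (transpose (gam z) ** gam w) ** ?g"
    by (simp only: matrix_mul_assoc)
  also have "\<dots> = transpose ?g ** M ** ?g" by (simp only: gg M_def matrix_mul_rid matrix_mul_assoc)
  finally have prod: "(transpose ?g ** (transpose (gam x) ** gam y) ** ?g) ** (transpose ?g ** (transpose (gam
      z) ** gam w) ** ?g)
     = transpose ?g ** M ** ?g" .
  have "qform (spinor_matrix 1 (ax 1)) (spin_rotation v x) (spin_rotation v y) (spin_rotation v z) (spin_rotation v w)
     = trace (spinor_matrix 1 (ax 1) ** (transpose ?g ** M ** ?g))"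
    unfolding qform_def pair prod[symmetric] by (simp only: matrix_mul_assoc)
  also have "\<dots> = trace ((spinor_matrix 1 (ax 1) ** transpose ?g ** M) ** ?g)"
    by (simp only: matrix_mul_assoc)
  also have "\<dots> = trace (?g ** (spinor_matrix 1 (ax 1) ** transpose ?g ** M))" by (rule trace_mul_sym)
  also have "\<dots> = trace ((?g ** spinor_matrix 1 (ax 1) ** transpose ?g) ** M)"
    by (simp only: matrix_mul_assoc)
  also have "?g ** spinor_matrix 1 (ax 1) ** transpose ?g = spinor_matrix 1 v"
    by (simp add: spinor_matrix_def mm_lin outer_conj gg gam_mult_vec oct_mult_ax1)
  finally show ?thesis by (simp add: qform_def M_def matrix_mul_assoc)
qed

lemma coords_inner: assumes "frame e" shows "coords e x \<bullet> coords e y = x \<bullet> y"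
proof -
  have "x \<bullet> y = x \<bullet> (\<Sum>i\<in>UNIV. (y \<bullet> e i) *\<^sub>R e i)" by (simp add: frame_expand[OF assms])
  then show ?thesis by (simp add: inner_sum_right inner_vec_def coords_def mult.commute)
qed

lemma coords_bij: assumes "frame e" shows "bij (coords e)"
proof (rule bijI)
  show "inj (coords e)"
  proof (rule injI)
    fix x y assume "coords e x = coords e y"
    then have "x \<bullet> e i = y \<bullet> e i" for i by (simp add: coords_def vec_eq_iff)
    then have "(\<Sum>i\<in>UNIV. (x \<bullet> e i) *\<^sub>R e i) = (\<Sum>i\<in>UNIV. (y \<bullet> e i) *\<^sub>R e i)" by (simp only:)
    then show "x = y" by (simp only: frame_expand[OF assms])
  qed
  have "coords e (\<Sum>i\<in>UNIV. y $ i *\<^sub>R e i) = y" for y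
    by (simp add: coords_def vec_eq_iff inner_sum_left frame_inner[OF assms] if_distrib cong: if_cong)
  then show "surj (coords e)" by (rule surjI)
qed

text \<open>The frame map rotates by \<open>spin_rotation v\<close> and scales by the fourth root of \<open>t\<close>, because four-forms scale with
the fourth power. It preserves the orientation, being made of two reflections.\<close>

lemma spinor_form_conformal:
  assumes e: "pos_frame vol e" and t: "t > 0" and v: "norm v = 1"
  shows "conformal_spin7_form vol (matrix_form e (spinor_matrix t v))"
proof -
  have fr: "frame e" using e by (simp add: pos_frame_def)
  define s where "s = sqrt (sqrt t)"
  have "s ^ 4 = (s\<^sup>2)\<^sup>2" by simp
  then have s: "s > 0" "s ^ 4 = t" using t by (simp_all add: s_def)
  define f where "f x = s *\<^sub>R spin_rotation v (coords e x)" for x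
  have lin: "linear f"
    unfolding f_def spin_rotation_def
    by (intro linear_compose_scale_right linear_compose[OF _ linear_reflection, unfolded comp_def] linear_coords)
  have bij: "bij f"
  proof -
    have "bij (\<lambda>x::real^8. s *\<^sub>R x)"
      by (rule bij_betw_byWitness[where f' = "\<lambda>x. (1 / s) *\<^sub>R x"]) (use s in auto)
    moreover have "f = (\<lambda>x. s *\<^sub>R x) \<circ> (reflection v \<circ> (reflection (ax 1) \<circ> coords e))"
      by (auto simp: f_def spin_rotation_def)
    ultimately show ?thesis
      by (simp only:) (intro bij_comp reflection_bij v coords_bij[OF fr], simp_all)
  qed
  have inner: "f x \<bullet> f y = s\<^sup>2 * (x \<bullet> y)" for x y
    by (simp add: f_def spin_rotation_def reflection_inner v coords_inner[OF fr] power2_eq_square)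
  have vol: "pullback f vol0 xs = s ^ 8 * vol xs" for xs
  proof -
    have "map f (map e std) = map (\<lambda>x. s *\<^sub>R x) (map (reflection v) (map (reflection (ax 1)) (map ax std)))"
      by (simp add: f_def spin_rotation_def coords_frame[OF fr])
    then have "pullback f vol0 (map e std) = s ^ 8"
      using multilin_scale[OF kforms_multilin[OF vol0_kforms],
          of "map (reflection v) (map (reflection (ax 1)) (map ax std))" s]
        vol0_reflection[OF v, of "map (reflection (ax 1)) (map ax std)"] vol0_reflection[of "ax 1" "map ax std"] vol0_std
      by (simp add: pullback_def)
    then show ?thesis
      using top_form_proportional[OF pullback_kforms[OF lin bij_is_inj[OF bij] vol0_kforms] pos_frame_vol[OF e] fr, of xs] e
      by (simp add: pos_frame_def)
  qed
  have form: "matrix_form e (spinor_matrix t v) xs = pullback f spin7_model xs" for xs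
  proof (cases "length xs = 4")
    case True
    then obtain x y z w where xs: "xs = [x, y, z, w]" by (auto simp: length_4)
    show ?thesis
      unfolding xs pullback_def spin7_model_matrix_form
      by (simp add: coords_ax f_def qform_scale qform_spin_rotation[OF v] s(2)) (simp add: qform_spinor_scale[of t])
  qed (simp add: matrix_form_length pullback_def kforms_length[OF spin7_model_kforms])
  have "spin7_frame vol (matrix_form e (spinor_matrix t v)) f"
    unfolding spin7_frame_def using lin bij vol form s by (auto intro!: exI[of _ "s ^ 8"])
  then show ?thesis
    unfolding conformal_spin7_form_def using inner s by (auto intro!: exI[of _ f] exI[of _ "s\<^sup>2"])
qed

text \<open>Rescaled to an isometry, the inverse of a conformal frame map is a positively oriented orthonormal frame, in which
\<open>\<Phi>\<close> is a multiple of the model form.\<close>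

lemma conformal_imp_spinor_form:
  fixes vol \<Phi> :: "'a::euclidean_space polyform"
  assumes "DIM('a) = 8" "volume_form vol" "\<Phi> \<in> kforms 4" "conformal_spin7_form vol \<Phi>"
  obtains e t where "pos_frame vol e" "t > 0" "\<Phi> = matrix_form e (spinor_matrix t (ax 1))"
proof -
  obtain f k where f: "spin7_frame vol \<Phi> f" and k: "k > 0" "\<And>x y. f x \<bullet> f y = k * (x \<bullet> y)"
    using assms(4) unfolding conformal_spin7_form_def by blast
  then obtain c where lin: "linear f" and bij: "bij f" and c: "c > 0" "pullback f vol0 = (\<lambda>xs. c * vol xs)"
    and \<Phi>: "\<Phi> = pullback f spin7_model"
    unfolding spin7_frame_def by blast
  define e where "e i = sqrt k *\<^sub>R inv f (ax i)" for i
  have fe: "f (e i) = sqrt k *\<^sub>R ax i" for i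
    by (simp add: e_def linear_cmul[OF lin] bij_is_surj[OF bij] surj_f_inv_f)
  have fr: "frame e"
  proof -
    have "k * (e i \<bullet> e j) = k * (if i = j then 1 else 0)" for i j
    proof -
      have "k * (e i \<bullet> e j) = sqrt k * sqrt k * (ax i \<bullet> ax j)"
        by (simp only: k(2)[symmetric] fe inner_scaleR_left inner_scaleR_right mult.assoc)
      also have "sqrt k * sqrt k = k" using k(1) by simp
      finally show ?thesis by (simp only: frame_inner[OF frame_ax])
    qed
    then have "e i \<bullet> e j = (if i = j then 1 else 0)" for i j
      by (rule mult_left_cancel[THEN iffD1, rotated]) (use k(1) in simp)
    then show ?thesis using assms(1) unfolding frame_def by blast
  qed
  have fc: "f x = sqrt k *\<^sub>R coords e x" for x
  proof -
    have "f x = f (\<Sum>i\<in>UNIV. (x \<bullet> e i) *\<^sub>R e i)" by (simp add: frame_expand[OF fr])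
    also have "\<dots> = (\<Sum>i\<in>UNIV. (x \<bullet> e i) *\<^sub>R sqrt k *\<^sub>R ax i)"
      by (simp add: linear_sum[OF lin] linear_cmul[OF lin] fe)
    also have "\<dots> = sqrt k *\<^sub>R coords e x"
      by (simp add: vec_eq_iff coords_def axis_def if_distrib if_distribR cong: if_cong)
    finally show ?thesis .
  qed
  have "c * vol (map e std) = vol0 (map f (map e std))"
    using fun_cong[OF c(2), of "map e std"] by (simp add: pullback_def)
  also have "map f (map e std) = map (\<lambda>x. sqrt k *\<^sub>R x) (map ax std)" by (simp add: fe)
  also have "vol0 \<dots> = sqrt k ^ 8"
    using multilin_scale[OF kforms_multilin[OF vol0_kforms], of "map ax std" "sqrt k"] vol0_std by simp
  finally have "c * vol (map e std) > 0" using k(1) by simp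
  then have "vol (map e std) > 0" using c(1) by (simp add: zero_less_mult_iff)
  moreover have "(vol (map e std))\<^sup>2 = 1" by (rule vol_frame_sq[OF assms(2) fr distinct_std]) simp
  ultimately have "vol (map e std) = 1" by (auto simp: power2_eq_1_iff)
  then have p: "pos_frame vol e" using assms(2) fr by (simp add: pos_frame_def)
  have "\<Phi> xs = matrix_form e (spinor_matrix (k\<^sup>2) (ax 1)) xs" for xs
  proof (cases "length xs = 4")
    case True
    then obtain x y z w where xs: "xs = [x, y, z, w]" by (auto simp: length_4)
    have "sqrt k ^ 4 = k\<^sup>2" using k(1) by (simp add: power4_eq_xxxx power2_eq_square)
    then show ?thesis
      unfolding xs \<Phi> pullback_def spin7_model_matrix_form
      by (simp add: coords_ax fc qform_scale) (simp add: qform_spinor_scale[of "k\<^sup>2"])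
  qed (simp add: matrix_form_length kforms_length[OF assms(3)])
  then show ?thesis using that[OF p, of "k\<^sup>2"] k(1) by auto
qed

theorem theorem4p5:
  fixes vol \<Phi> :: "'a::euclidean_space polyform"
  assumes "DIM('a) = 8"
    and "volume_form vol"
    and "\<Phi> \<in> self_dual_four_forms vol - {0}"
  shows "(conformal_spin7_form vol \<Phi> \<longleftrightarrow>
            critical_point_on (self_dual_four_forms vol) potential \<Phi>)
       \<and> (conformal_spin7_form vol \<Phi> \<longrightarrow> potential \<Phi> = 0)"
proof -
  have S: "\<Phi> \<in> self_dual_four_forms vol" and nz: "\<Phi> \<noteq> 0" using assms(3) by auto
  have k: "\<Phi> \<in> kforms 4" using S by (simp add: self_dual_four_forms_def)
  have nonzero: "B \<noteq> 0" if "\<Phi> = matrix_form e B" for e B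
  proof
    assume "B = 0"
    then have "\<Phi> xs = 0" for xs using that by (simp add: matrix_form_def linear_0[OF qform_linear_matrix] split:
        list.splits)
    then show False using nz by (auto simp: fun_eq_iff)
  qed
  have "critical_point_on (self_dual_four_forms vol) potential \<Phi> \<and> potential \<Phi> = 0" if conf: "conformal_spin7_form vol \<Phi>"
  proof -
    obtain e t where e: "pos_frame vol e" and t: "t > 0" and \<Phi>: "\<Phi> = matrix_form e (spinor_matrix t (ax 1))"
      by (rule conformal_imp_spinor_form[OF assms(1,2) k conf])
    have B: "spinor_matrix t (ax 1) \<in> traceless_sym" by (rule spinor_matrix_traceless_sym) simp
    have fr: "frame e" using e by (simp add: pos_frame_def)
    show ?thesis
      using critical_matrix_form[OF e B nonzero[OF \<Phi>]] potential_matrix_form[OF fr B] spinor_matrix_critical[OF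
          t, of "ax 1"]
      unfolding \<Phi> by simp
  qed
  moreover have "conformal_spin7_form vol \<Phi>" if crit: "critical_point_on (self_dual_four_forms vol) potential \<Phi>"
  proof -
    obtain e where e: "pos_frame vol e" by (rule pos_frame_exists[OF assms(1,2)])
    obtain B where B: "B \<in> traceless_sym" and \<Phi>: "\<Phi> = matrix_form e B" by (rule self_dual_is_matrix_form[OF e S])
    have "matrix_critical B" using crit critical_matrix_form[OF e B nonzero[OF \<Phi>]] unfolding \<Phi> by simp
    then obtain t v where "t > 0" "norm v = 1" "B = spinor_matrix t v"
      using critical_imp_spinor_matrix[OF B nonzero[OF \<Phi>]] by blast
    then show ?thesis unfolding \<Phi> using spinor_form_conformal[OF e] by simp
  qed
  ultimately show ?thesis by blast
qed

end
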